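(* Let $M$ be a 3-dimensional normal almost paracontact metric manifold with structure $(\varphi,\xi,\eta,g)$ and associated functions $\alpha,\beta$. Let $\gamma\colon I\to M$ be a slant non-geodesic curve with null normal, with $\eta(\dot\gamma)=c$ constant and $c^2\neq1$. Then, for one choice of sign (upper signs throughout, or lower signs throughout), $$\alpha=\pm\frac{g(N,\varphi\dot\gamma)}{1-c^2}\neq0,$$ and $$N=-\alpha(\xi-c\dot\gamma\pm\varphi\dot\gamma),$$ $$\kappa=\frac{\dot\alpha}{\alpha}\pm\beta+\alpha c,$$ $$W=\frac{-1}{2\alpha(1-c^2)}(\xi-c\dot\gamma\mp\varphi\dot\gamma),$$ where $N,W,\kappa$ are the elements of the Cartan frame and the curvature of $\gamma$, and $\alpha,\beta$ stand for $\alpha\circ\gamma,\beta\circ\gamma$ (a dot denotes the derivative along $\gamma$).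
   Context: An almost paracontact structure on a $(2n+1)$-dimensional manifold $M$ is a triple $(\varphi,\xi,\eta)$ of a $(1,1)$-tensor field, a vector field and a 1-form with $\eta(\xi)=1$, $\varphi^2=\mathrm{Id}-\eta\otimes\xi$, and such that the eigendistributions of $\varphi$ on $\ker\eta$ for the eigenvalues $1$ and $-1$ both have dimension $n$. It is almost paracontact metric if $M$ also carries a pseudo-Riemannian metric $g$ of signature $(n+1,n)$ with $g(\varphi X,\varphi Y)=-g(X,Y)+\eta(X)\eta(Y)$; then $\eta(X)=g(X,\xi)$, $\varphi\xi=0$, $\eta\circ\varphi=0$, and $g(X,\varphi Y)$ is skew-symmetric. It is normal if $[\varphi,\varphi](X,Y)-2\,d\eta(X,Y)\xi=0$, where $[\varphi,\varphi](X,Y)=\varphi^2[X,Y]+[\varphi X,\varphi Y]-\varphi[\varphi X,Y]-\varphi[X,\varphi Y]$. Here $n=1$, $\nabla$ is the Levi-Civita connection of $g$, and it is known that normality is equivalent to the existence of functions $\alpha,\beta$ on $M$ with $\nabla_X\xi=\alpha(X-\eta(X)\xi)+\beta\varphi X$, and equivalent to $(\nabla_X\varphi)Y=\beta(g(X,Y)\xi-\eta(Y)X)+\alpha(g(\varphi X,Y)\xi-\eta(Y)\varphi X)$ for functions $\alpha,\beta$; these functions are given by $2\alpha=\mathrm{Trace}\{X\mapsto\nabla_X\xi\}$, $2\beta=\mathrm{Trace}\{X\mapsto\varphi\nabla_X\xi\}$. A curve $\gamma\colon I\to M$ ($I$ an interval) is slant if $g(\dot\gamma,\xi)=\eta(\dot\gamma)=c$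 is constant. A curve $\gamma$ has null normal if $g(\dot\gamma,\dot\gamma)=\varepsilon_1=\pm1$, $\nabla_{\dot\gamma}\dot\gamma\neq0$ and $g(\nabla_{\dot\gamma}\dot\gamma,\nabla_{\dot\gamma}\dot\gamma)=0$; by the signature of $g$ one necessarily has $\varepsilon_1=1$. Its Cartan frame is $T=\dot\gamma$, $N=\nabla_{\dot\gamma}T$, and the vector field $W$ along $\gamma$ with $g(N,W)=1$, $g(W,W)=g(T,W)=0$ (also $g(T,T)=1$, $g(N,N)=g(T,N)=0$). The Cartan equations, which define the curvature function $\kappa$, are $\nabla_{\dot\gamma}T=N$, $\nabla_{\dot\gamma}N=\kappa N$, $\nabla_{\dot\gamma}W=-T-\kappa W$. *)

theory Defs
  imports "HOL-Analysis.Analysis" "HOL-Library.Function_Algebras"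
begin

section \<open>Smooth manifolds and tangent spaces\<close>

text \<open>On an open set, or on a nondegenerate interval of reals (with one-sided derivatives at
  end points), the derivatives below are unique and this is the usual notion of smoothness.\<close>

primrec Ck_on :: "nat \<Rightarrow> 'a::real_normed_vector set \<Rightarrow> ('a \<Rightarrow> 'b::real_normed_vector) \<Rightarrow> bool" where
  "Ck_on 0 S f \<longleftrightarrow> continuous_on S f"
| "Ck_on (Suc k) S f \<longleftrightarrow>
     f differentiable_on S \<and> (\<forall>v. Ck_on k S (\<lambda>x. frechet_derivative f (at x within S) v))"

definition smooth_on :: "'a::real_normed_vector set \<Rightarrow> ('a \<Rightarrow> 'b::real_normed_vector) \<Rightarrow> bool" where
  "smooth_on S f \<longleftrightarrow> (\<forall>k. Ck_on k S f)"

text \<open>A chart is a pair of a coordinate domain and a coordinate map into the model space \<open>'e\<close>.\<close>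

type_synonym ('m, 'e) chart = "'m set \<times> ('m \<Rightarrow> 'e)"

abbreviation dom_of :: "('m, 'e) chart \<Rightarrow> 'm set" where
  "dom_of c \<equiv> fst c"

abbreviation coords :: "('m, 'e) chart \<Rightarrow> 'm \<Rightarrow> 'e" where
  "coords c \<equiv> snd c"

definition coords_inv :: "('m, 'e) chart \<Rightarrow> 'e \<Rightarrow> 'm" where
  "coords_inv c = the_inv_into (dom_of c) (coords c)"

text \<open>As every chart domain is open in the ambient Hausdorff, second countable space, the
  carrier is an open subspace, hence itself Hausdorff and second countable.\<close>

definition carrier_of :: "('m, 'e) chart set \<Rightarrow> 'm set" where
  "carrier_of A = (\<Union>c\<in>A. dom_of c)"

definition smooth_atlas ::
  "('m::{t2_space, second_countable_topology}, 'e::euclidean_space) chart set \<Rightarrow> bool" where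
  "smooth_atlas A \<longleftrightarrow>
     carrier_of A \<noteq> {} \<and>
     (\<forall>c\<in>A. open (dom_of c) \<and> open (coords c ` dom_of c) \<and> inj_on (coords c) (dom_of c) \<and>
        homeomorphism (dom_of c) (coords c ` dom_of c) (coords c) (coords_inv c)) \<and>
     (\<forall>c\<in>A. \<forall>c'\<in>A.
        smooth_on (coords c ` (dom_of c \<inter> dom_of c')) (\<lambda>x. coords c' (coords_inv c x)))"

definition transition_deriv ::
  "('m, 'e::euclidean_space) chart \<Rightarrow> ('m, 'e) chart \<Rightarrow> 'm \<Rightarrow> 'e \<Rightarrow> 'e" where
  "transition_deriv c c' p =
     frechet_derivative (\<lambda>x. coords c' (coords_inv c x)) (at (coords c p))"

definition chart_at :: "('m, 'e) chart set \<Rightarrow> 'm \<Rightarrow> ('m, 'e) chart" where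
  "chart_at A p = (SOME c. c \<in> A \<and> p \<in> dom_of c)"

instantiation "fun" :: (type, real_vector) real_vector
begin

definition scaleR_fun :: "real \<Rightarrow> ('a \<Rightarrow> 'b) \<Rightarrow> 'a \<Rightarrow> 'b" where
  "scaleR_fun a f = (\<lambda>x. a *\<^sub>R f x)"

instance
  by standard (simp_all add: scaleR_fun_def fun_eq_iff scaleR_add_right scaleR_add_left)

end

text \<open>A tangent vector at \<open>p\<close> is the family of its coordinate representations in all charts
  around \<open>p\<close>, related by the derivatives of the transition maps.  The value at every other
  argument is 0, so that equality of families is equality of tangent vectors and the linear
  structure is the pointwise one.\<close>

type_synonym ('m, 'e) tvec = "('m, 'e) chart \<Rightarrow> 'e"

definition tangent_space ::
  "('m, 'e::euclidean_space) chart set \<Rightarrow> 'm \<Rightarrow> ('m, 'e) tvec set" where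
  "tangent_space A p =
     {v. (\<forall>c\<in>A. \<forall>c'\<in>A. p \<in> dom_of c \<and> p \<in> dom_of c' \<longrightarrow> v c' = transition_deriv c c' p (v c)) \<and>
         (\<forall>c. \<not> (c \<in> A \<and> p \<in> dom_of c) \<longrightarrow> v c = 0)}"

text \<open>The tangent vector at \<open>p\<close> represented by \<open>u\<close> in the chart \<open>c\<close>.\<close>

definition tangent_of ::
  "('m, 'e::euclidean_space) chart set \<Rightarrow> ('m, 'e) chart \<Rightarrow> 'm \<Rightarrow> 'e \<Rightarrow> ('m, 'e) tvec" where
  "tangent_of A c p u =
     (\<lambda>c'. if c' \<in> A \<and> p \<in> dom_of c' then transition_deriv c c' p u else 0)"

section \<open>Tensor fields\<close>

definition linear_between ::
  "'a::real_vector set \<Rightarrow> 'b::real_vector set \<Rightarrow> ('a \<Rightarrow> 'b) \<Rightarrow> bool" where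
  "linear_between V W f \<longleftrightarrow>
     (\<forall>v\<in>V. f v \<in> W) \<and> (\<forall>u\<in>V. \<forall>v\<in>V. f (u + v) = f u + f v) \<and>
     (\<forall>a. \<forall>v\<in>V. f (a *\<^sub>R v) = a *\<^sub>R f v)"

definition vector_field_on ::
  "('m, 'e::euclidean_space) chart set \<Rightarrow> 'm set \<Rightarrow> ('m \<Rightarrow> ('m, 'e) tvec) \<Rightarrow> bool" where
  "vector_field_on A S X \<longleftrightarrow>
     (\<forall>p\<in>S. X p \<in> tangent_space A p) \<and>
     (\<forall>c\<in>A. smooth_on (coords c ` (dom_of c \<inter> S)) (\<lambda>x. X (coords_inv c x) c))"

definition one_form ::
  "('m, 'e::euclidean_space) chart set \<Rightarrow> ('m \<Rightarrow> ('m, 'e) tvec \<Rightarrow> real) \<Rightarrow> bool" where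
  "one_form A \<eta> \<longleftrightarrow>
     (\<forall>p\<in>carrier_of A. linear_between (tangent_space A p) UNIV (\<eta> p)) \<and>
     (\<forall>c\<in>A. \<forall>u. smooth_on (coords c ` dom_of c)
        (\<lambda>x. \<eta> (coords_inv c x) (tangent_of A c (coords_inv c x) u)))"

definition endomorphism_field ::
  "('m, 'e::euclidean_space) chart set \<Rightarrow> ('m \<Rightarrow> ('m, 'e) tvec \<Rightarrow> ('m, 'e) tvec) \<Rightarrow> bool" where
  "endomorphism_field A \<phi> \<longleftrightarrow>
     (\<forall>p\<in>carrier_of A. linear_between (tangent_space A p) (tangent_space A p) (\<phi> p)) \<and>
     (\<forall>c\<in>A. \<forall>u. smooth_on (coords c ` dom_of c)
        (\<lambda>x. \<phi> (coords_inv c x) (tangent_of A c (coords_inv c x) u) c))"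

text \<open>The components, in the chart \<open>c\<close>, of a field \<open>g\<close> of bilinear forms.\<close>

definition local_form ::
  "('m, 'e::euclidean_space) chart set \<Rightarrow> ('m \<Rightarrow> ('m, 'e) tvec \<Rightarrow> ('m, 'e) tvec \<Rightarrow> real) \<Rightarrow>
   ('m, 'e) chart \<Rightarrow> 'e \<Rightarrow> 'e \<Rightarrow> 'e \<Rightarrow> real" where
  "local_form A g c x u v =
     g (coords_inv c x) (tangent_of A c (coords_inv c x) u) (tangent_of A c (coords_inv c x) v)"

definition has_signature ::
  "'a::real_vector set \<Rightarrow> ('a \<Rightarrow> 'a \<Rightarrow> real) \<Rightarrow> nat \<Rightarrow> nat \<Rightarrow> bool" where
  "has_signature V b r s \<longleftrightarrow>
     (\<exists>P N. finite P \<and> card P = r \<and> finite N \<and> card N = s \<and> P \<inter> N = {} \<and> span (P \<union> N) = V \<and>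
        (\<forall>u\<in>P \<union> N. \<forall>v\<in>P \<union> N. u \<noteq> v \<longrightarrow> b u v = 0) \<and>
        (\<forall>u\<in>P. b u u = 1) \<and> (\<forall>u\<in>N. b u u = - 1))"

definition pseudo_riemannian_metric ::
  "('m, 'e::euclidean_space) chart set \<Rightarrow> ('m \<Rightarrow> ('m, 'e) tvec \<Rightarrow> ('m, 'e) tvec \<Rightarrow> real) \<Rightarrow>
   nat \<Rightarrow> nat \<Rightarrow> bool" where
  "pseudo_riemannian_metric A g r s \<longleftrightarrow>
     r + s = DIM('e) \<and>
     (\<forall>p\<in>carrier_of A.
        (\<forall>u\<in>tangent_space A p. linear_between (tangent_space A p) UNIV (g p u)) \<and>
        (\<forall>u\<in>tangent_space A p. \<forall>v\<in>tangent_space A p. g p u v = g p v u) \<and>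
        has_signature (tangent_space A p) (g p) r s) \<and>
     (\<forall>c\<in>A. \<forall>u v. smooth_on (coords c ` dom_of c) (\<lambda>x. local_form A g c x u v))"

text \<open>The next definitions use the coordinate expression in one chart around the point; the
  results do not depend on which chart that is.\<close>

definition lie_bracket ::
  "('m, 'e::euclidean_space) chart set \<Rightarrow> ('m \<Rightarrow> ('m, 'e) tvec) \<Rightarrow> ('m \<Rightarrow> ('m, 'e) tvec) \<Rightarrow>
   'm \<Rightarrow> ('m, 'e) tvec" where
  "lie_bracket A X Y p =
     (let c = chart_at A p in
      tangent_of A c p
        (frechet_derivative (\<lambda>x. Y (coords_inv c x) c) (at (coords c p)) (X p c) -
         frechet_derivative (\<lambda>x. X (coords_inv c x) c) (at (coords c p)) (Y p c)))"

definition dir_deriv ::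
  "('m, 'e::euclidean_space) chart set \<Rightarrow> ('m \<Rightarrow> ('m, 'e) tvec) \<Rightarrow> ('m \<Rightarrow> real) \<Rightarrow> 'm \<Rightarrow> real" where
  "dir_deriv A X f p =
     (let c = chart_at A p in
      frechet_derivative (\<lambda>x. f (coords_inv c x)) (at (coords c p)) (X p c))"

text \<open>The exterior derivative is normalised with the factor 1/2, as is implicit in the normality
  condition \<open>[\<phi>,\<phi>] - 2 d\<eta> \<otimes> \<xi> = 0\<close>.\<close>

definition ext_deriv ::
  "('m, 'e::euclidean_space) chart set \<Rightarrow> ('m \<Rightarrow> ('m, 'e) tvec \<Rightarrow> real) \<Rightarrow>
   ('m \<Rightarrow> ('m, 'e) tvec) \<Rightarrow> ('m \<Rightarrow> ('m, 'e) tvec) \<Rightarrow> 'm \<Rightarrow> real" where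
  "ext_deriv A \<eta> X Y p =
     (dir_deriv A X (\<lambda>q. \<eta> q (Y q)) p - dir_deriv A Y (\<lambda>q. \<eta> q (X q)) p
      - \<eta> p (lie_bracket A X Y p)) / 2"

definition nijenhuis ::
  "('m, 'e::euclidean_space) chart set \<Rightarrow> ('m \<Rightarrow> ('m, 'e) tvec \<Rightarrow> ('m, 'e) tvec) \<Rightarrow>
   ('m \<Rightarrow> ('m, 'e) tvec) \<Rightarrow> ('m \<Rightarrow> ('m, 'e) tvec) \<Rightarrow> 'm \<Rightarrow> ('m, 'e) tvec" where
  "nijenhuis A \<phi> X Y p =
     \<phi> p (\<phi> p (lie_bracket A X Y p))
     + lie_bracket A (\<lambda>q. \<phi> q (X q)) (\<lambda>q. \<phi> q (Y q)) p
     - \<phi> p (lie_bracket A (\<lambda>q. \<phi> q (X q)) Y p)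
     - \<phi> p (lie_bracket A X (\<lambda>q. \<phi> q (Y q)) p)"

section \<open>The Levi-Civita connection\<close>

text \<open>In a chart, a connection is \<open>D\<^sub>u Y + \<Gamma>(u, Y)\<close> with \<open>\<Gamma>\<close> bilinear at each point; it is
  torsion-free iff \<open>\<Gamma>\<close> is symmetric, and it is metric iff the derivative of the components of
  \<open>g\<close> satisfies the last clause.\<close>

definition christoffel ::
  "('m, 'e::euclidean_space) chart set \<Rightarrow> ('m \<Rightarrow> ('m, 'e) tvec \<Rightarrow> ('m, 'e) tvec \<Rightarrow> real) \<Rightarrow>
   ('m, 'e) chart \<Rightarrow> 'm \<Rightarrow> 'e \<Rightarrow> 'e \<Rightarrow> 'e" where
  "christoffel A g c p =
     (THE \<Gamma>. bilinear \<Gamma> \<and> (\<forall>u v. \<Gamma> u v = \<Gamma> v u) \<and>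
        (\<forall>u v w. frechet_derivative (\<lambda>x. local_form A g c x v w) (at (coords c p)) u =
           local_form A g c (coords c p) (\<Gamma> u v) w + local_form A g c (coords c p) v (\<Gamma> u w)))"

definition nabla ::
  "('m, 'e::euclidean_space) chart set \<Rightarrow> ('m \<Rightarrow> ('m, 'e) tvec \<Rightarrow> ('m, 'e) tvec \<Rightarrow> real) \<Rightarrow>
   ('m, 'e) tvec \<Rightarrow> ('m \<Rightarrow> ('m, 'e) tvec) \<Rightarrow> 'm \<Rightarrow> ('m, 'e) tvec" where
  "nabla A g v X p =
     (let c = chart_at A p in
      tangent_of A c p
        (frechet_derivative (\<lambda>x. X (coords_inv c x) c) (at (coords c p)) (v c)
         + christoffel A g c p (v c) (X p c)))"

section \<open>Almost paracontact metric structures\<close>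

definition almost_paracontact ::
  "nat \<Rightarrow> ('m, 'e::euclidean_space) chart set \<Rightarrow> ('m \<Rightarrow> ('m, 'e) tvec \<Rightarrow> ('m, 'e) tvec) \<Rightarrow>
   ('m \<Rightarrow> ('m, 'e) tvec) \<Rightarrow> ('m \<Rightarrow> ('m, 'e) tvec \<Rightarrow> real) \<Rightarrow> bool" where
  "almost_paracontact n A \<phi> \<xi> \<eta> \<longleftrightarrow>
     DIM('e) = 2 * n + 1 \<and>
     endomorphism_field A \<phi> \<and> vector_field_on A (carrier_of A) \<xi> \<and> one_form A \<eta> \<and>
     (\<forall>p\<in>carrier_of A.
        \<eta> p (\<xi> p) = 1 \<and>
        (\<forall>v\<in>tangent_space A p. \<phi> p (\<phi> p v) = v - \<eta> p v *\<^sub>R \<xi> p) \<and>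
        dim {v \<in> tangent_space A p. \<eta> p v = 0 \<and> \<phi> p v = v} = n \<and>
        dim {v \<in> tangent_space A p. \<eta> p v = 0 \<and> \<phi> p v = - v} = n)"

definition almost_paracontact_metric ::
  "nat \<Rightarrow> ('m, 'e::euclidean_space) chart set \<Rightarrow> ('m \<Rightarrow> ('m, 'e) tvec \<Rightarrow> ('m, 'e) tvec) \<Rightarrow>
   ('m \<Rightarrow> ('m, 'e) tvec) \<Rightarrow> ('m \<Rightarrow> ('m, 'e) tvec \<Rightarrow> real) \<Rightarrow>
   ('m \<Rightarrow> ('m, 'e) tvec \<Rightarrow> ('m, 'e) tvec \<Rightarrow> real) \<Rightarrow> bool" where
  "almost_paracontact_metric n A \<phi> \<xi> \<eta> g \<longleftrightarrow>
     almost_paracontact n A \<phi> \<xi> \<eta> \<and> pseudo_riemannian_metric A g (n + 1) n \<and>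
     (\<forall>p\<in>carrier_of A. \<forall>u\<in>tangent_space A p. \<forall>v\<in>tangent_space A p.
        g p (\<phi> p u) (\<phi> p v) = - g p u v + \<eta> p u * \<eta> p v)"

text \<open>Vector fields on arbitrary open subsets are used, so that coordinate fields are available;
  the expression is tensorial in \<open>X\<close> and \<open>Y\<close>.\<close>

definition normal_structure ::
  "('m::topological_space, 'e::euclidean_space) chart set \<Rightarrow>
   ('m \<Rightarrow> ('m, 'e) tvec \<Rightarrow> ('m, 'e) tvec) \<Rightarrow>
   ('m \<Rightarrow> ('m, 'e) tvec) \<Rightarrow> ('m \<Rightarrow> ('m, 'e) tvec \<Rightarrow> real) \<Rightarrow> bool" where
  "normal_structure A \<phi> \<xi> \<eta> \<longleftrightarrow>
     (\<forall>S X Y. open S \<and> S \<subseteq> carrier_of A \<and> vector_field_on A S X \<and> vector_field_on A S Y \<longrightarrow>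
        (\<forall>p\<in>S. nijenhuis A \<phi> X Y p - (2 * ext_deriv A \<eta> X Y p) *\<^sub>R \<xi> p = 0))"

text \<open>The trace of an endomorphism of a finite-dimensional subspace, computed in some basis.\<close>

definition trace_on :: "'a::real_vector set \<Rightarrow> ('a \<Rightarrow> 'a) \<Rightarrow> real" where
  "trace_on V L =
     (let B = (SOME B. independent B \<and> span B = V) in \<Sum>b\<in>B. representation B (L b) b)"

definition assoc_alpha ::
  "('m, 'e::euclidean_space) chart set \<Rightarrow> ('m \<Rightarrow> ('m, 'e) tvec) \<Rightarrow>
   ('m \<Rightarrow> ('m, 'e) tvec \<Rightarrow> ('m, 'e) tvec \<Rightarrow> real) \<Rightarrow> 'm \<Rightarrow> real" where
  "assoc_alpha A \<xi> g p = trace_on (tangent_space A p) (\<lambda>v. nabla A g v \<xi> p) / 2"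

definition assoc_beta ::
  "('m, 'e::euclidean_space) chart set \<Rightarrow> ('m \<Rightarrow> ('m, 'e) tvec \<Rightarrow> ('m, 'e) tvec) \<Rightarrow>
   ('m \<Rightarrow> ('m, 'e) tvec) \<Rightarrow> ('m \<Rightarrow> ('m, 'e) tvec \<Rightarrow> ('m, 'e) tvec \<Rightarrow> real) \<Rightarrow> 'm \<Rightarrow> real" where
  "assoc_beta A \<phi> \<xi> g p = trace_on (tangent_space A p) (\<lambda>v. \<phi> p (nabla A g v \<xi> p)) / 2"

section \<open>Curves and the Cartan frame\<close>

definition smooth_curve ::
  "('m::topological_space, 'e::euclidean_space) chart set \<Rightarrow> real set \<Rightarrow> (real \<Rightarrow> 'm) \<Rightarrow> bool" where
  "smooth_curve A I \<gamma> \<longleftrightarrow>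
     is_interval I \<and> interior I \<noteq> {} \<and> \<gamma> ` I \<subseteq> carrier_of A \<and> continuous_on I \<gamma> \<and>
     (\<forall>c\<in>A. smooth_on {t \<in> I. \<gamma> t \<in> dom_of c} (\<lambda>t. coords c (\<gamma> t)))"

definition velocity ::
  "('m, 'e::euclidean_space) chart set \<Rightarrow> real set \<Rightarrow> (real \<Rightarrow> 'm) \<Rightarrow> real \<Rightarrow> ('m, 'e) tvec" where
  "velocity A I \<gamma> t =
     (let c = chart_at A (\<gamma> t) in
      tangent_of A c (\<gamma> t) (vector_derivative (\<lambda>s. coords c (\<gamma> s)) (at t within I)))"

definition cov_along ::
  "('m, 'e::euclidean_space) chart set \<Rightarrow> ('m \<Rightarrow> ('m, 'e) tvec \<Rightarrow> ('m, 'e) tvec \<Rightarrow> real) \<Rightarrow>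
   real set \<Rightarrow> (real \<Rightarrow> 'm) \<Rightarrow> (real \<Rightarrow> ('m, 'e) tvec) \<Rightarrow> real \<Rightarrow> ('m, 'e) tvec" where
  "cov_along A g I \<gamma> V t =
     (let c = chart_at A (\<gamma> t) in
      tangent_of A c (\<gamma> t)
        (vector_derivative (\<lambda>s. V s c) (at t within I)
         + christoffel A g c (\<gamma> t) (velocity A I \<gamma> t c) (V t c)))"

definition slant ::
  "('m, 'e::euclidean_space) chart set \<Rightarrow> ('m \<Rightarrow> ('m, 'e) tvec \<Rightarrow> real) \<Rightarrow>
   real set \<Rightarrow> (real \<Rightarrow> 'm) \<Rightarrow> real \<Rightarrow> bool" where
  "slant A \<eta> I \<gamma> c \<longleftrightarrow> (\<forall>t\<in>I. \<eta> (\<gamma> t) (velocity A I \<gamma> t) = c)"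

definition cartan_N ::
  "('m, 'e::euclidean_space) chart set \<Rightarrow> ('m \<Rightarrow> ('m, 'e) tvec \<Rightarrow> ('m, 'e) tvec \<Rightarrow> real) \<Rightarrow>
   real set \<Rightarrow> (real \<Rightarrow> 'm) \<Rightarrow> real \<Rightarrow> ('m, 'e) tvec" where
  "cartan_N A g I \<gamma> = cov_along A g I \<gamma> (velocity A I \<gamma>)"

definition null_normal ::
  "('m, 'e::euclidean_space) chart set \<Rightarrow> ('m \<Rightarrow> ('m, 'e) tvec \<Rightarrow> ('m, 'e) tvec \<Rightarrow> real) \<Rightarrow>
   real set \<Rightarrow> (real \<Rightarrow> 'm) \<Rightarrow> bool" where
  "null_normal A g I \<gamma> \<longleftrightarrow>
     (\<exists>\<epsilon>\<in>{1, -1}. \<forall>t\<in>I. g (\<gamma> t) (velocity A I \<gamma> t) (velocity A I \<gamma> t) = \<epsilon>) \<and>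
     (\<forall>t\<in>I. cartan_N A g I \<gamma> t \<noteq> 0 \<and>
        g (\<gamma> t) (cartan_N A g I \<gamma> t) (cartan_N A g I \<gamma> t) = 0)"

definition cartan_W ::
  "('m, 'e::euclidean_space) chart set \<Rightarrow> ('m \<Rightarrow> ('m, 'e) tvec \<Rightarrow> ('m, 'e) tvec \<Rightarrow> real) \<Rightarrow>
   real set \<Rightarrow> (real \<Rightarrow> 'm) \<Rightarrow> real \<Rightarrow> ('m, 'e) tvec" where
  "cartan_W A g I \<gamma> t =
     (THE w. w \<in> tangent_space A (\<gamma> t) \<and> g (\<gamma> t) (cartan_N A g I \<gamma> t) w = 1 \<and>
        g (\<gamma> t) w w = 0 \<and> g (\<gamma> t) (velocity A I \<gamma> t) w = 0)"

text \<open>The first Cartan equation is the definition of \<open>N\<close>; the other two define the curvature.\<close>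

definition cartan_curvature ::
  "('m, 'e::euclidean_space) chart set \<Rightarrow> ('m \<Rightarrow> ('m, 'e) tvec \<Rightarrow> ('m, 'e) tvec \<Rightarrow> real) \<Rightarrow>
   real set \<Rightarrow> (real \<Rightarrow> 'm) \<Rightarrow> real \<Rightarrow> real" where
  "cartan_curvature A g I \<gamma> t =
     (THE k. cov_along A g I \<gamma> (cartan_N A g I \<gamma>) t = k *\<^sub>R cartan_N A g I \<gamma> t \<and>
        cov_along A g I \<gamma> (cartan_W A g I \<gamma>) t
          = - velocity A I \<gamma> t - k *\<^sub>R cartan_W A g I \<gamma> t)"

end

theory Submission
  imports Defs
begin

text \<open>Write \<open>T\<close> for the velocity, \<open>N = \<nabla>\<^bsub>T\<^esub>T\<close> and \<open>L v = \<nabla>\<^bsub>v\<^esub>\<xi>\<close>.  Everything follows from one consequence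
of normality, \<open>L v = \<alpha> (v - \<eta>(v) \<xi>) + \<beta> \<phi>(v)\<close> (theorem \<open>nabla_xi\<close>), and from the rigidity of
null vectors in a three-dimensional paracontact metric space.

\<^bold>\<open>The formula for \<open>L\<close>.\<close>  Apply normality to the pairs \<open>(X, \<xi>)\<close>.  Its component along
\<open>\<xi>\<close> says \<open>d\<eta>(X, \<xi>) = 0\<close>, that is \<open>L \<xi> = 0\<close>; and \<open>L v \<bottom> \<xi>\<close> because \<open>\<xi>\<close> has unit length.  On an
eigenvector \<open>e\<close> of \<open>\<phi>\<close> in \<open>ker \<eta>\<close> the remaining component says that the Lie derivative of \<open>g\<close>
along \<open>\<xi>\<close> vanishes on \<open>(e, e)\<close>, that is \<open>g(L e, e) = 0\<close>.  In dimension three the eigenspaces are null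
lines, so \<open>L e\<close> is a multiple of \<open>e\<close>: \<open>L\<close> is diagonal with eigenvalues \<open>\<alpha> \<plusminus> \<beta>\<close> and 0, and the
traces that define \<open>\<alpha>\<close> and \<open>\<beta>\<close> give these eigenvalues.

\<^bold>\<open>The normal vector.\<close>  Differentiating \<open>g(T, \<xi>) = c\<close> gives \<open>g(N, \<xi>) = - g(T, L T) = - \<alpha> (1 - c\<^sup>2)\<close>.
As \<open>T\<close>, \<open>\<xi>\<close>, \<open>\<phi> T\<close> span the tangent space, the null vectors orthogonal to \<open>T\<close> are the multiples of
\<open>\<xi> - c T \<plusminus> \<phi> T\<close>, which fixes \<open>N\<close> up to the sign and forces \<open>\<alpha> \<noteq> 0\<close> and \<open>g(T, T) = 1\<close>
(\<open>null_vector_normal_form\<close>).  The sign is \<open>g(N, \<phi> T) / (\<alpha> (1 - c\<^sup>2))\<close>, which is continuous on an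
interval, hence constant.

\<^bold>\<open>The curvature.\<close>  Differentiating the scalar products of the frame shows \<open>\<nabla>\<^bsub>T\<^esub>N = k N\<close> and
\<open>\<nabla>\<^bsub>T\<^esub>W = - T - k W\<close>; differentiating \<open>g(N, \<xi>) = - \<alpha> (1 - c\<^sup>2)\<close> once more, with \<open>L T\<close> known, gives \<open>k\<close>.

\<^bold>\<open>Regularity.\<close>  \<open>N\<close> at time \<open>t\<close> is computed in a chart chosen at \<open>\<gamma>(t)\<close>, so differentiability of
\<open>N\<close> requires comparing charts.  The components of \<open>N\<close> in a fixed chart would involve the inverse
matrix of the metric; instead \<open>g(N, w)\<close> has an explicit Koszul expression valid in every chart
(\<open>cartan_N_any_chart\<close>, by the transformation law \<open>koszul_change\<close>, which rests on the symmetry of second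
derivatives).  It makes \<open>\<alpha> = - g(N, \<xi>) / (1 - c\<^sup>2)\<close> and \<open>g(N, \<phi> T)\<close> differentiable, and then
\<open>N = - \<alpha> (\<xi> - c T \<plusminus> \<phi> T)\<close> is differentiable as well.\<close>

section \<open>Maps of class \<open>C\<^sup>k\<close>\<close>

lemma frechet_derivative_at_eq:
  "(f has_derivative f') (at x) \<Longrightarrow> frechet_derivative f (at x) = f'"
  using frechet_derivative_at by metis

lemma frechet_derivative_within_cong:
  assumes "x \<in> S" "\<And>y. y \<in> S \<Longrightarrow> f y = g y"
  shows "frechet_derivative f (at x within S) = frechet_derivative g (at x within S)"
proof -
  have "(f has_derivative D) (at x within S) \<longleftrightarrow> (g has_derivative D) (at x within S)" for D
    using has_derivative_transform[of x S f g D] has_derivative_transform[of x S g f D] assms by auto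
  then show ?thesis unfolding frechet_derivative_def by simp
qed

lemma Ck_on_cong:
  assumes "\<And>y. y \<in> S \<Longrightarrow> f y = g y"
  shows "Ck_on k S f \<longleftrightarrow> Ck_on k S g"
  using assms
proof (induction k arbitrary: f g)
  case 0
  then show ?case using continuous_on_cong[of S S f g] by simp
next
  case (Suc k)
  have "f differentiable_on S \<longleftrightarrow> g differentiable_on S"
    by (metis Suc.prems differentiable_on_def differentiable_transform_within zero_less_one)
  moreover have "Ck_on k S (\<lambda>x. frechet_derivative f (at x within S) v) \<longleftrightarrow>
        Ck_on k S (\<lambda>x. frechet_derivative g (at x within S) v)" for v
    by (rule Suc.IH) (use frechet_derivative_within_cong[of _ S f g] Suc.prems in auto)
  ultimately show ?case by simp
qed

lemma Ck_on_Suc_open: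
  assumes "open S"
  shows "Ck_on (Suc k) S f \<longleftrightarrow>
    (\<forall>x\<in>S. f differentiable (at x)) \<and> (\<forall>v. Ck_on k S (\<lambda>x. frechet_derivative f (at x) v))"
proof -
  have "Ck_on k S (\<lambda>x. frechet_derivative f (at x within S) v) \<longleftrightarrow>
        Ck_on k S (\<lambda>x. frechet_derivative f (at x) v)" for v
    by (rule Ck_on_cong) (use assms at_within_open in metis)
  then show ?thesis
    by (simp add: differentiable_on_eq_differentiable_at assms)
qed

text \<open>The derivative may be given by any family \<open>D\<close>; this avoids computing with \<^const>\<open>frechet_derivative\<close>,
which is a choice operator, in the inductions below.\<close>

lemma Ck_on_SucI:
  assumes "open S" "\<And>x. x \<in> S \<Longrightarrow> (f has_derivative D x) (at x)"
    and "\<And>v. Ck_on k S (\<lambda>x. D x v)"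
  shows "Ck_on (Suc k) S f"
proof -
  have "Ck_on k S (\<lambda>x. frechet_derivative f (at x) v)" for v
    by (rule Ck_on_cong[THEN iffD1, OF _ assms(3)[of v]])
      (simp add: frechet_derivative_at_eq[OF assms(2)])
  then show ?thesis
    using assms(2) unfolding Ck_on_Suc_open[OF assms(1)] differentiable_def by blast
qed

lemma Ck_on_SucD:
  assumes "open S" "Ck_on (Suc k) S f"
  shows "x \<in> S \<Longrightarrow> (f has_derivative frechet_derivative f (at x)) (at x)"
    and "Ck_on k S (\<lambda>x. frechet_derivative f (at x) v)"
  using assms(2) unfolding Ck_on_Suc_open[OF assms(1)] frechet_derivative_works by blast+

lemma Ck_on_Suc_imp: "Ck_on (Suc k) S f \<Longrightarrow> Ck_on k S f"
proof (induction k arbitrary: f)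
  case 0
  then show ?case by (simp add: differentiable_imp_continuous_on)
next
  case (Suc k)
  then show ?case by (metis Ck_on.simps(2))
qed

lemma Ck_on_subset:
  assumes S: "open S" and R: "open R" "R \<subseteq> S" and "Ck_on k S f"
  shows "Ck_on k R f"
  using assms(4)
proof (induction k arbitrary: f)
  case 0
  then show ?case using R continuous_on_subset by auto
next
  case (Suc k)
  note f = Ck_on_SucD[OF S Suc.prems]
  show ?case
    by (rule Ck_on_SucI[OF R(1) f(1) Suc.IH[OF f(2)]]) (use R in auto)
qed

lemma Ck_on_const: "open S \<Longrightarrow> Ck_on k S (\<lambda>x. a)"
proof (induction k arbitrary: a)
  case (Suc k)
  show ?case
    by (rule Ck_on_SucI[where D = "\<lambda>_ _. 0"]) (auto simp: Suc)
qed simp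

lemma Ck_on_add:
  assumes S: "open S" and "Ck_on k S f" "Ck_on k S h"
  shows "Ck_on k S (\<lambda>x. f x + h x)"
  using assms(2,3)
proof (induction k arbitrary: f h)
  case 0
  then show ?case by (simp add: continuous_on_add)
next
  case (Suc k)
  note f = Ck_on_SucD[OF S Suc.prems(1)] and h = Ck_on_SucD[OF S Suc.prems(2)]
  show ?case
    by (rule Ck_on_SucI[OF S has_derivative_add[OF f(1) h(1)] Suc.IH[OF f(2) h(2)]])
qed

lemma Ck_on_sum:
  assumes "open S" "\<And>i. i \<in> F \<Longrightarrow> Ck_on k S (f i)"
  shows "Ck_on k S (\<lambda>x. \<Sum>i\<in>F. f i x)"
  using assms(2)
  by (induction F rule: infinite_finite_induct) (auto intro: Ck_on_const Ck_on_add assms(1))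

lemma Ck_on_scaleR:
  fixes f :: "_ \<Rightarrow> real"
  assumes S: "open S" and "Ck_on k S f" "Ck_on k S h"
  shows "Ck_on k S (\<lambda>x. f x *\<^sub>R h x)"
  using assms(2,3)
proof (induction k arbitrary: f h)
  case 0
  then show ?case by (simp add: continuous_on_scaleR)
next
  case (Suc k)
  note f = Ck_on_SucD[OF S Suc.prems(1)] and h = Ck_on_SucD[OF S Suc.prems(2)]
  have "Ck_on k S (\<lambda>x. f x *\<^sub>R frechet_derivative h (at x) v + frechet_derivative f (at x) v *\<^sub>R h x)" for v
    by (rule Ck_on_add[OF S Suc.IH[OF Ck_on_Suc_imp[OF Suc.prems(1)] h(2)]
          Suc.IH[OF f(2) Ck_on_Suc_imp[OF Suc.prems(2)]]])
  from Ck_on_SucI[OF S has_derivative_scaleR[OF f(1) h(1)] this] show ?case .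
qed

lemma Ck_on_bounded_linear:
  assumes S: "open S" and "bounded_linear L" "Ck_on k S f"
  shows "Ck_on k S (\<lambda>x. L (f x))"
  using assms(3)
proof (induction k arbitrary: f)
  case 0
  then show ?case using assms(2) by (simp add: bounded_linear.continuous_on)
next
  case (Suc k)
  note f = Ck_on_SucD[OF S Suc.prems]
  show ?case
    by (rule Ck_on_SucI[OF S bounded_linear.has_derivative[OF assms(2) f(1)] Suc.IH[OF f(2)]])
qed

lemma linear_euclidean_expansion:
  fixes L :: "'a::euclidean_space \<Rightarrow> 'b::real_vector"
  assumes "linear L"
  shows "L w = (\<Sum>i\<in>Basis. (w \<bullet> i) *\<^sub>R L i)"
proof -
  have "(\<Sum>i\<in>Basis. (w \<bullet> i) *\<^sub>R L i) = L (\<Sum>i\<in>Basis. (w \<bullet> i) *\<^sub>R i)"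
    by (simp only: linear_sum[OF assms] linear_scale[OF assms])
  then show ?thesis by (simp only: euclidean_representation)
qed

text \<open>Expanding \<open>w = \<Sum>\<^sub>i (w \<bullet> i) i\<close> turns the chain rule into a sum of products of a component of the
derivative of \<open>f\<close> with a partial derivative of \<open>h\<close> composed with \<open>f\<close>, to which the induction
hypothesis applies.\<close>

lemma Ck_on_compose:
  fixes f :: "'a::euclidean_space \<Rightarrow> 'b::euclidean_space"
    and h :: "'b \<Rightarrow> 'c::real_normed_vector"
  assumes S: "open S" and R: "open R" and "f ` S \<subseteq> R" "Ck_on k S f" "Ck_on k R h"
  shows "Ck_on k S (\<lambda>x. h (f x))"
  using assms(3-)
proof (induction k arbitrary: f h)
  case 0
  then show ?case using continuous_on_compose2[of R h S f] by simp
next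
  case (Suc k)
  note f = Ck_on_SucD[OF S Suc.prems(2)] and h = Ck_on_SucD[OF R Suc.prems(3)]
  have fS: "f x \<in> R" if "x \<in> S" for x using Suc.prems(1) that by auto
  define D where "D = (\<lambda>x v. \<Sum>i\<in>Basis. (frechet_derivative f (at x) v \<bullet> i) *\<^sub>R
            frechet_derivative h (at (f x)) i)"
  show ?case
  proof (rule Ck_on_SucI[OF S, where D = D])
    fix x assume x: "x \<in> S"
    have "D x = (\<lambda>v. frechet_derivative h (at (f x)) (frechet_derivative f (at x) v))"
      unfolding D_def
      by (rule ext, rule linear_euclidean_expansion[OF has_derivative_linear[OF h(1)[OF fS[OF x]]], symmetric])
    then show "((\<lambda>x. h (f x)) has_derivative D x) (at x)"
      using diff_chain_at[OF f(1)[OF x] h(1)[OF fS[OF x]]] by (simp add: o_def)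
  next
    fix v
    show "Ck_on k S (\<lambda>x. D x v)"
      unfolding D_def
    proof (intro Ck_on_sum Ck_on_scaleR S)
      fix i :: 'b
      show "Ck_on k S (\<lambda>x. frechet_derivative f (at x) v \<bullet> i)"
        by (rule Ck_on_bounded_linear[OF S bounded_linear_inner_left f(2)])
      show "Ck_on k S (\<lambda>x. frechet_derivative h (at (f x)) i)"
        by (rule Suc.IH[OF Suc.prems(1) Ck_on_Suc_imp[OF Suc.prems(2)] h(2)])
    qed
  qed
qed

lemma smooth_on_differentiable:
  "smooth_on S f \<Longrightarrow> open S \<Longrightarrow> x \<in> S \<Longrightarrow> f differentiable (at x)"
  unfolding smooth_on_def by (metis Ck_on_Suc_open)

lemma smooth_on_derivative:
  "smooth_on S f \<Longrightarrow> open S \<Longrightarrow> smooth_on S (\<lambda>x. frechet_derivative f (at x) v)"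
  unfolding smooth_on_def by (metis Ck_on_Suc_open)

lemma smooth_on_has_derivative:
  "smooth_on S f \<Longrightarrow> open S \<Longrightarrow> x \<in> S \<Longrightarrow> (f has_derivative frechet_derivative f (at x)) (at x)"
  using smooth_on_differentiable frechet_derivative_works by blast

lemma smooth_on_compose:
  fixes f :: "'a::euclidean_space \<Rightarrow> 'b::euclidean_space"
  assumes "open S" "open R" "f ` S \<subseteq> R" "smooth_on S f" "smooth_on R h"
  shows "smooth_on S (\<lambda>x. h (f x))"
  using assms unfolding smooth_on_def by (blast intro: Ck_on_compose)

lemma smooth_on_cong: "(\<And>y. y \<in> S \<Longrightarrow> f y = g y) \<Longrightarrow> smooth_on S f \<longleftrightarrow> smooth_on S g"
  unfolding smooth_on_def using Ck_on_cong by blast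

lemma smooth_on_subset: "open S \<Longrightarrow> open R \<Longrightarrow> R \<subseteq> S \<Longrightarrow> smooth_on S f \<Longrightarrow> smooth_on R f"
  unfolding smooth_on_def using Ck_on_subset by blast

text \<open>The second difference of \<open>f\<close> over a parallelogram is symmetric in \<open>u\<close> and \<open>v\<close>, and two applications
of the mean value theorem express it by a mixed derivative at a nearby point.  Letting the
parallelogram shrink makes the two mixed derivatives equal.\<close>

lemma second_difference_eq:
  fixes f :: "'a::real_normed_vector \<Rightarrow> real"
  assumes h: "h > 0"
    and sq: "\<And>s r. 0 \<le> s \<Longrightarrow> s \<le> h \<Longrightarrow> 0 \<le> r \<Longrightarrow> r \<le> h \<Longrightarrow> x + s *\<^sub>R u + r *\<^sub>R v \<in> S"
    and f: "\<And>y. y \<in> S \<Longrightarrow> f differentiable (at y)"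
    and f2: "\<And>y. y \<in> S \<Longrightarrow> (\<lambda>y. frechet_derivative f (at y) u) differentiable (at y)"
  shows "\<exists>s r. 0 \<le> s \<and> s \<le> h \<and> 0 \<le> r \<and> r \<le> h \<and>
     f (x + h *\<^sub>R u + h *\<^sub>R v) - f (x + h *\<^sub>R u) - f (x + h *\<^sub>R v) + f x =
     h * h * frechet_derivative (\<lambda>y. frechet_derivative f (at y) u) (at (x + s *\<^sub>R u + r *\<^sub>R v)) v"
proof -
  define A where "A = (\<lambda>y. frechet_derivative f (at y) u)"
  have line: "((\<lambda>t. F (a + t *\<^sub>R w)) has_real_derivative frechet_derivative F (at (a + t *\<^sub>R w)) w) (at t)"
    if "F differentiable (at (a + t *\<^sub>R w))" for F :: "'a \<Rightarrow> real" and a w t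
  proof -
    interpret D: linear "frechet_derivative F (at (a + t *\<^sub>R w))"
      using linear_frechet_derivative[OF that] .
    have "((\<lambda>t. a + t *\<^sub>R w) has_derivative (\<lambda>t. t *\<^sub>R w)) (at t)"
      by (auto intro!: derivative_eq_intros)
    from diff_chain_at[OF this that[unfolded frechet_derivative_works]]
    show ?thesis by (simp add: o_def has_field_derivative_def D.scale mult_commute_abs)
  qed
  have d1: "((\<lambda>s. f (x + h *\<^sub>R v + s *\<^sub>R u) - f (x + s *\<^sub>R u)) has_real_derivative
        (A (x + h *\<^sub>R v + s *\<^sub>R u) - A (x + s *\<^sub>R u))) (at s)" if "0 \<le> s" "s \<le> h" for s
    unfolding A_def
    using sq[OF that, of h] sq[OF that, of 0] h
    by (intro DERIV_diff line f) (auto simp: algebra_simps)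
  obtain s where s: "0 < s" "s < h" and e1:
    "f (x + h *\<^sub>R v + h *\<^sub>R u) - f (x + h *\<^sub>R u) - (f (x + h *\<^sub>R v + 0 *\<^sub>R u) - f (x + 0 *\<^sub>R u))
      = (h - 0) * (A (x + h *\<^sub>R v + s *\<^sub>R u) - A (x + s *\<^sub>R u))"
    using MVT2[OF h d1] by auto
  have d2: "((\<lambda>r. A (x + s *\<^sub>R u + r *\<^sub>R v)) has_real_derivative
     frechet_derivative A (at (x + s *\<^sub>R u + r *\<^sub>R v)) v) (at r)" if "0 \<le> r" "r \<le> h" for r
    using sq[of s r] s that by (intro line) (auto simp: A_def intro: f2)
  obtain r where r: "0 < r" "r < h" and e2:
    "A (x + s *\<^sub>R u + h *\<^sub>R v) - A (x + s *\<^sub>R u + 0 *\<^sub>R v)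
      = (h - 0) * frechet_derivative A (at (x + s *\<^sub>R u + r *\<^sub>R v)) v"
    using MVT2[OF h d2] by auto
  have "f (x + h *\<^sub>R u + h *\<^sub>R v) - f (x + h *\<^sub>R u) - f (x + h *\<^sub>R v) + f x
     = h * h * frechet_derivative A (at (x + s *\<^sub>R u + r *\<^sub>R v)) v"
    using e1 e2 by (simp add: algebra_simps)
  then show ?thesis using s r unfolding A_def by (intro exI[of _ s] exI[of _ r]) auto
qed

lemma second_derivative_symmetric_real:
  fixes f :: "'a::real_normed_vector \<Rightarrow> real"
  assumes S: "open S" "x \<in> S" and f: "Ck_on (Suc (Suc 0)) S f"
  shows "frechet_derivative (\<lambda>y. frechet_derivative f (at y) v) (at x) u =
         frechet_derivative (\<lambda>y. frechet_derivative f (at y) u) (at x) v"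
proof -
  define P where "P = (\<lambda>y. frechet_derivative (\<lambda>y. frechet_derivative f (at y) u) (at y) v)"
  define Q where "Q = (\<lambda>y. frechet_derivative (\<lambda>y. frechet_derivative f (at y) v) (at y) u)"
  have d: "f differentiable (at y)" "(\<lambda>y. frechet_derivative f (at y) w) differentiable (at y)"
    if "y \<in> S" for y w
    using f that by (auto simp: Ck_on_Suc_open[OF S(1)] simp del: Ck_on.simps(2))
  have "continuous_on S P" "continuous_on S Q"
    using f by (auto simp: Ck_on_Suc_open[OF S(1)] P_def Q_def simp del: Ck_on.simps(2))
  then have cont: "isCont P x" "isCont Q x"
    using S continuous_on_eq_continuous_at by blast+
  \<comment> \<open>the two mixed derivatives take a common value arbitrarily close to \<open>x\<close>\<close>
  have ex: "\<exists>y z. dist y x < e \<and> dist z x < e \<and> P y = Q z" if "e > 0" for e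
  proof -
    obtain d0 where d0: "d0 > 0" "ball x d0 \<subseteq> S" using S openE by blast
    define e' where "e' = min e d0"
    define n where "n = 1 + norm u + norm v"
    define h where "h = e' / (2 * n)"
    have e': "e' > 0" "e' \<le> e" "e' \<le> d0" using that d0 by (auto simp: e'_def)
    have n: "n > 0" unfolding n_def by (smt (verit) norm_ge_zero)
    have h: "h > 0" using e' n by (simp add: h_def)
    have near: "dist (x + s *\<^sub>R u + r *\<^sub>R v) x < e'"
      if "0 \<le> s" "s \<le> h" "0 \<le> r" "r \<le> h" for s r
    proof -
      have "dist (x + s *\<^sub>R u + r *\<^sub>R v) x = norm (s *\<^sub>R u + r *\<^sub>R v)" by (simp add: dist_norm)
      also have "\<dots> \<le> s * norm u + r * norm v"
        using norm_triangle_ineq[of "s *\<^sub>R u" "r *\<^sub>R v"] that by simp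
      also have "\<dots> \<le> h * norm u + h * norm v"
        using that by (intro add_mono mult_right_mono) auto
      also have "\<dots> \<le> h * n" using h by (simp add: n_def algebra_simps)
      also have "\<dots> = e' / 2" using n by (simp add: h_def)
      finally show ?thesis using e' by linarith
    qed
    have sq: "x + s *\<^sub>R u + r *\<^sub>R v \<in> S" if "0 \<le> s" "s \<le> h" "0 \<le> r" "r \<le> h" for s r
      using near[OF that] d0 e' by (auto simp: dist_commute subset_iff)
    have sq': "x + s *\<^sub>R v + r *\<^sub>R u \<in> S" if "0 \<le> s" "s \<le> h" "0 \<le> r" "r \<le> h" for s r
      using sq[of r s] that by (simp add: add_ac)
    obtain s r where 1: "0 \<le> s" "s \<le> h" "0 \<le> r" "r \<le> h" and e1:
      "f (x + h *\<^sub>R u + h *\<^sub>R v) - f (x + h *\<^sub>R u) - f (x + h *\<^sub>R v) + f x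
        = h * h * P (x + s *\<^sub>R u + r *\<^sub>R v)"
      using second_difference_eq[OF h sq d] unfolding P_def by blast
    obtain s' r' where 2: "0 \<le> s'" "s' \<le> h" "0 \<le> r'" "r' \<le> h" and e2:
      "f (x + h *\<^sub>R v + h *\<^sub>R u) - f (x + h *\<^sub>R v) - f (x + h *\<^sub>R u) + f x
        = h * h * Q (x + s' *\<^sub>R v + r' *\<^sub>R u)"
      using second_difference_eq[OF h sq' d] unfolding Q_def by blast
    have "h * h * P (x + s *\<^sub>R u + r *\<^sub>R v) = h * h * Q (x + s' *\<^sub>R v + r' *\<^sub>R u)"
      using e1 e2 add.commute[of "h *\<^sub>R u" "h *\<^sub>R v"] by (simp only: add.assoc)
    then have "P (x + s *\<^sub>R u + r *\<^sub>R v) = Q (x + s' *\<^sub>R v + r' *\<^sub>R u)" using h by simp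
    moreover have "dist (x + s' *\<^sub>R v + r' *\<^sub>R u) x < e'"
      using near[of r' s'] 2 by (simp add: add_ac)
    ultimately show ?thesis using near[OF 1] e' by (meson less_le_trans)
  qed
  have "P x = Q x"
  proof (rule ccontr)
    assume ne: "P x \<noteq> Q x"
    define e where "e = \<bar>P x - Q x\<bar> / 2"
    have e: "e > 0" using ne by (simp add: e_def)
    obtain d1 where d1: "d1 > 0" "\<And>y. dist y x < d1 \<Longrightarrow> dist (P y) (P x) < e"
      using cont(1) e unfolding continuous_at_eps_delta by blast
    obtain d2 where d2: "d2 > 0" "\<And>y. dist y x < d2 \<Longrightarrow> dist (Q y) (Q x) < e"
      using cont(2) e unfolding continuous_at_eps_delta by blast
    obtain y z where yz: "dist y x < min d1 d2" "dist z x < min d1 d2" "P y = Q z"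
      using ex[of "min d1 d2"] d1 d2 by auto
    have "dist (P y) (P x) < e" "dist (Q z) (Q x) < e"
      using d1(2)[of y] d2(2)[of z] yz by simp_all
    then show False unfolding e_def dist_real_def yz(3) by (simp add: abs_if field_simps split: if_splits)
  qed
  then show ?thesis by (simp add: P_def Q_def)
qed

lemma second_derivative_symmetric:
  fixes f :: "'a::euclidean_space \<Rightarrow> 'b::euclidean_space"
  assumes S: "open S" "x \<in> S" and f: "smooth_on S f"
  shows "frechet_derivative (\<lambda>y. frechet_derivative f (at y) v) (at x) u =
         frechet_derivative (\<lambda>y. frechet_derivative f (at y) u) (at x) v"
proof (rule euclidean_eqI)
  fix b :: 'b assume "b \<in> Basis"
  have f2: "Ck_on (Suc (Suc 0)) S f" using f unfolding smooth_on_def by blast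
  have d: "f differentiable (at y)" "(\<lambda>y. frechet_derivative f (at y) w) differentiable (at y)"
    if "y \<in> S" for y w
    using f2 that by (auto simp: Ck_on_Suc_open[OF S(1)] simp del: Ck_on.simps(2))
  have D1: "frechet_derivative (\<lambda>y. f y \<bullet> b) (at y) w = frechet_derivative f (at y) w \<bullet> b"
    if "y \<in> S" for y w
    using frechet_derivative_at_eq[OF has_derivative_inner_left[OF
          d(1)[OF that, unfolded frechet_derivative_works]]] by simp
  have D2: "frechet_derivative (\<lambda>y. frechet_derivative f (at y) w \<bullet> b) (at x) w' =
      frechet_derivative (\<lambda>y. frechet_derivative f (at y) w) (at x) w' \<bullet> b" for w w'
    using frechet_derivative_at_eq[OF has_derivative_inner_left[OF
          d(2)[OF S(2), unfolded frechet_derivative_works]]] by simp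
  have D3: "frechet_derivative (\<lambda>y. frechet_derivative (\<lambda>y. f y \<bullet> b) (at y) w) (at x) w' =
      frechet_derivative (\<lambda>y. frechet_derivative f (at y) w) (at x) w' \<bullet> b" for w w'
  proof -
    have "(\<lambda>y. frechet_derivative f (at y) w \<bullet> b) differentiable (at x)"
      using has_derivative_inner_left[OF d(2)[OF S(2), unfolded frechet_derivative_works]]
      by (auto simp: differentiable_def)
    from frechet_derivative_transform_within_open[OF this S, of "\<lambda>y. frechet_derivative (\<lambda>y. f y \<bullet> b) (at y) w"]
    have "frechet_derivative (\<lambda>y. frechet_derivative (\<lambda>y. f y \<bullet> b) (at y) w) (at x)
        = frechet_derivative (\<lambda>y. frechet_derivative f (at y) w \<bullet> b) (at x)"
      using D1 by simp
    then show ?thesis using D2[of w w'] by simp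
  qed
  show "frechet_derivative (\<lambda>y. frechet_derivative f (at y) v) (at x) u \<bullet> b =
         frechet_derivative (\<lambda>y. frechet_derivative f (at y) u) (at x) v \<bullet> b"
    using second_derivative_symmetric_real[OF S
        Ck_on_bounded_linear[OF S(1) bounded_linear_inner_left f2], of b v u]
    by (simp add: D3)
qed

section \<open>Charts and tangent spaces\<close>

locale smooth_manifold =
  fixes A :: "('m::{t2_space, second_countable_topology}, 'e::euclidean_space) chart set"
  assumes atlas: "smooth_atlas A"
begin

lemma open_dom [intro]: "c \<in> A \<Longrightarrow> open (dom_of c)"
  and open_image_dom: "c \<in> A \<Longrightarrow> open (coords c ` dom_of c)"
  and coords_homeomorphism:
    "c \<in> A \<Longrightarrow> homeomorphism (dom_of c) (coords c ` dom_of c) (coords c) (coords_inv c)"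
  and transition_smooth: "c \<in> A \<Longrightarrow> c' \<in> A \<Longrightarrow>
    smooth_on (coords c ` (dom_of c \<inter> dom_of c')) (\<lambda>x. coords c' (coords_inv c x))"
  using atlas unfolding smooth_atlas_def by blast+

lemma coords_inv_coords [simp]: "c \<in> A \<Longrightarrow> p \<in> dom_of c \<Longrightarrow> coords_inv c (coords c p) = p"
  using coords_homeomorphism homeomorphism_apply1 by blast

lemma open_image_coords:
  assumes "c \<in> A" "open S"
  shows "open (coords c ` (dom_of c \<inter> S))"
proof -
  have "coords c ` (dom_of c \<inter> S) = coords c ` dom_of c \<inter> coords_inv c -` S"
    using assms(1) by auto
  then show ?thesis
    using continuous_open_preimage[OF _ open_image_dom assms(2), of c "coords_inv c"]
      coords_homeomorphism[OF assms(1)] assms(1) unfolding homeomorphism_def by auto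
qed

lemma open_overlap: "c \<in> A \<Longrightarrow> c' \<in> A \<Longrightarrow> open (coords c ` (dom_of c \<inter> dom_of c'))"
  using open_image_coords open_dom by blast

lemma transition_has_derivative:
  assumes "c \<in> A" "c' \<in> A" "p \<in> dom_of c" "p \<in> dom_of c'"
  shows "((\<lambda>x. coords c' (coords_inv c x)) has_derivative transition_deriv c c' p) (at (coords c p))"
  unfolding transition_deriv_def
  by (rule smooth_on_has_derivative[OF transition_smooth open_overlap]) (use assms in auto)

lemma transition_deriv_linear:
  assumes "c \<in> A" "c' \<in> A" "p \<in> dom_of c" "p \<in> dom_of c'"
  shows "linear (transition_deriv c c' p)"
  using transition_has_derivative[OF assms] has_derivative_linear by blast

lemma transition_deriv_refl:
  assumes "c \<in> A" "p \<in> dom_of c"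
  shows "transition_deriv c c p u = u"
proof -
  have "((\<lambda>x. coords c (coords_inv c x)) has_derivative (\<lambda>u. u)) (at (coords c p))"
    by (rule has_derivative_transform_within_open[OF has_derivative_ident open_image_dom[OF assms(1)]])
      (use assms in auto)
  then show ?thesis
    unfolding transition_deriv_def by (simp add: frechet_derivative_at_eq)
qed

lemma transition_deriv_comp:
  assumes c: "c \<in> A" "c' \<in> A" "c'' \<in> A" and p: "p \<in> dom_of c" "p \<in> dom_of c'" "p \<in> dom_of c''"
  shows "transition_deriv c' c'' p (transition_deriv c c' p u) = transition_deriv c c'' p u"
proof -
  have "((\<lambda>x. coords c'' (coords_inv c' x)) has_derivative transition_deriv c' c'' p)
      (at (coords c' (coords_inv c (coords c p))))"
    using transition_has_derivative[of c' c'' p] c p by simp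
  from diff_chain_at[OF transition_has_derivative[OF c(1,2) p(1,2)] this]
  have "((\<lambda>x. coords c'' (coords_inv c' (coords c' (coords_inv c x)))) has_derivative
      (\<lambda>u. transition_deriv c' c'' p (transition_deriv c c' p u))) (at (coords c p))"
    by (simp add: o_def)
  then have "((\<lambda>x. coords c'' (coords_inv c x)) has_derivative
      (\<lambda>u. transition_deriv c' c'' p (transition_deriv c c' p u))) (at (coords c p))"
    by (rule has_derivative_transform_within_open[OF _ open_overlap[OF c(1,2)]]) (use c p in auto)
  then show ?thesis
    using frechet_derivative_at_eq unfolding transition_deriv_def[of c c''] by metis
qed

lemma tangent_of_apply [simp]:
  "c' \<in> A \<Longrightarrow> p \<in> dom_of c' \<Longrightarrow> tangent_of A c p u c' = transition_deriv c c' p u"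
  by (simp add: tangent_of_def)

lemma tangent_of_self: "c \<in> A \<Longrightarrow> p \<in> dom_of c \<Longrightarrow> tangent_of A c p u c = u"
  by (simp add: transition_deriv_refl)

lemma tangent_of_in:
  assumes "c \<in> A" "p \<in> dom_of c"
  shows "tangent_of A c p u \<in> tangent_space A p"
  using assms unfolding tangent_space_def
  by (auto simp: transition_deriv_comp) (auto simp: tangent_of_def)

lemma tangent_vector_eqI:
  assumes "v \<in> tangent_space A p" "w \<in> tangent_space A p" "c \<in> A" "p \<in> dom_of c" "v c = w c"
  shows "v = w"
proof
  fix c'
  show "v c' = w c'"
  proof (cases "c' \<in> A \<and> p \<in> dom_of c'")
    case True
    then have "v c' = transition_deriv c c' p (v c)" "w c' = transition_deriv c c' p (w c)"
      using assms unfolding tangent_space_def by blast+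
    then show ?thesis using assms by simp
  next
    case False
    then have "v c' = 0" "w c' = 0" using assms(1,2) unfolding tangent_space_def by blast+
    then show ?thesis by simp
  qed
qed

lemma tangent_of_comp:
  assumes "v \<in> tangent_space A p" "c \<in> A" "p \<in> dom_of c"
  shows "tangent_of A c p (v c) = v"
  by (rule tangent_vector_eqI[OF tangent_of_in assms(1) assms(2,3)])
    (use assms in \<open>simp_all add: transition_deriv_refl\<close>)

lemma tangent_vector_change:
  assumes "v \<in> tangent_space A p" "c \<in> A" "p \<in> dom_of c" "c' \<in> A" "p \<in> dom_of c'"
  shows "v c' = transition_deriv c c' p (v c)"
  using assms unfolding tangent_space_def by blast

lemma tangent_of_change:
  assumes "c \<in> A" "p \<in> dom_of c" "c' \<in> A" "p \<in> dom_of c'"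
  shows "tangent_of A c' p (transition_deriv c c' p u) = tangent_of A c p u"
  using tangent_of_comp[OF tangent_of_in[of c p u] assms(3,4)] assms by simp

lemma tangent_of_add:
  assumes "c \<in> A" "p \<in> dom_of c"
  shows "tangent_of A c p (u + v) = tangent_of A c p u + tangent_of A c p v"
  by (rule ext) (use assms in \<open>auto simp: tangent_of_def linear_add[OF transition_deriv_linear]\<close>)

lemma tangent_of_scaleR:
  assumes "c \<in> A" "p \<in> dom_of c"
  shows "tangent_of A c p (a *\<^sub>R u) = a *\<^sub>R tangent_of A c p u"
  by (rule ext) (use assms in \<open>auto simp: tangent_of_def scaleR_fun_def linear_scale[OF transition_deriv_linear]\<close>)

lemma tangent_of_zero: "c \<in> A \<Longrightarrow> p \<in> dom_of c \<Longrightarrow> tangent_of A c p 0 = 0"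
  using tangent_of_scaleR[of c p 0 0] by simp

lemma subspace_tangent_space:
  assumes "p \<in> carrier_of A"
  shows "subspace (tangent_space A p)"
proof -
  obtain c where c: "c \<in> A" "p \<in> dom_of c" using assms unfolding carrier_of_def by auto
  have "tangent_space A p = range (tangent_of A c p)"
    using tangent_of_in[OF c] tangent_of_comp[OF _ c] by (auto simp: image_iff) metis
  moreover have "linear (tangent_of A c p)"
    by (rule linearI) (simp_all add: tangent_of_add[OF c] tangent_of_scaleR[OF c])
  ultimately show ?thesis by (simp add: linear_subspace_image)
qed

lemma chart_at:
  assumes "p \<in> carrier_of A"
  shows "chart_at A p \<in> A" "p \<in> dom_of (chart_at A p)"
proof -
  have "\<exists>c. c \<in> A \<and> p \<in> dom_of c" using assms unfolding carrier_of_def by auto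
  from someI_ex[OF this] show "chart_at A p \<in> A" "p \<in> dom_of (chart_at A p)"
    unfolding chart_at_def by auto
qed

lemma dom_subset_carrier: "c \<in> A \<Longrightarrow> p \<in> dom_of c \<Longrightarrow> p \<in> carrier_of A"
  unfolding carrier_of_def by auto

text \<open>The vector field with constant components \<open>u\<close> in \<open>c\<close> has components in \<open>c'\<close> that are a derivative of
one transition map composed with the opposite transition map.  Such fields are the test fields for
the normality condition.\<close>

lemma smooth_coordinate_field:
  assumes c: "c \<in> A"
  shows "vector_field_on A (dom_of c) (\<lambda>q. tangent_of A c q u)"
  unfolding vector_field_on_def
proof (intro conjI ballI)
  show "tangent_of A c q u \<in> tangent_space A q" if "q \<in> dom_of c" for q
    using tangent_of_in[OF c that] .
  fix c' assume c': "c' \<in> A"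
  let ?W' = "coords c' ` (dom_of c' \<inter> dom_of c)" and ?W = "coords c ` (dom_of c \<inter> dom_of c')"
  have "smooth_on ?W' (\<lambda>x. frechet_derivative (\<lambda>y. coords c' (coords_inv c y))
           (at (coords c (coords_inv c' x))) u)"
  proof (rule smooth_on_compose[OF open_overlap[OF c' c] open_overlap[OF c c'] _
        transition_smooth[OF c' c] smooth_on_derivative[OF transition_smooth[OF c c'] open_overlap[OF c c']]])
    show "(\<lambda>x. coords c (coords_inv c' x)) ` ?W' \<subseteq> ?W" using c c' by auto
  qed
  then show "smooth_on ?W' (\<lambda>x. tangent_of A c (coords_inv c' x) u c')"
    by (rule smooth_on_cong[THEN iffD1, rotated])
      (use c c' in \<open>auto simp: transition_deriv_def\<close>)
qed

end

section \<open>Bilinear forms depending on a point\<close>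

lemma bilinear_expansion:
  fixes B :: "'a::euclidean_space \<Rightarrow> 'b::euclidean_space \<Rightarrow> real"
  assumes "bilinear B"
  shows "B u v = (\<Sum>i\<in>Basis. \<Sum>j\<in>Basis. (u \<bullet> i) * (v \<bullet> j) * B i j)"
proof -
  have "B u v = (\<Sum>i\<in>Basis. (u \<bullet> i) *\<^sub>R B i v)"
    by (rule linear_euclidean_expansion) (use assms in \<open>simp add: bilinear_def\<close>)
  also have "\<dots> = (\<Sum>i\<in>Basis. (u \<bullet> i) *\<^sub>R (\<Sum>j\<in>Basis. (v \<bullet> j) *\<^sub>R B i j))"
    by (intro sum.cong refl arg_cong[where f = "\<lambda>x. _ *\<^sub>R x"] linear_euclidean_expansion)
      (use assms in \<open>simp add: bilinear_def\<close>)
  finally show ?thesis by (simp add: sum_distrib_left mult.assoc)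
qed

text \<open>The product rule for \<open>y \<mapsto> B(X(y))(V(y), W(y))\<close>: only the derivatives of \<open>x \<mapsto> B(x)(u, v)\<close> for fixed
\<open>u\<close> and \<open>v\<close> are given, so \<open>B\<close> is expanded in a basis.  It covers derivatives along curves as well as
derivatives on charts.\<close>

lemma bilinear_field_has_derivative:
  fixes B :: "'a::euclidean_space \<Rightarrow> 'b::euclidean_space \<Rightarrow> 'b \<Rightarrow> real"
    and X :: "'z::real_normed_vector \<Rightarrow> 'a"
  assumes bil: "\<And>x. x \<in> U \<Longrightarrow> bilinear (B x)"
    and dB: "\<And>u v. (\<lambda>x. B x u v) differentiable (at (X z))"
    and U: "open U" "z \<in> S" "X ` S \<subseteq> U"
    and X: "(X has_derivative X') (at z within S)"
    and V: "(V has_derivative V') (at z within S)"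
    and W: "(W has_derivative W') (at z within S)"
  shows "((\<lambda>y. B (X y) (V y) (W y)) has_derivative
     (\<lambda>h. frechet_derivative (\<lambda>x. B x (V z) (W z)) (at (X z)) (X' h) + B (X z) (V' h) (W z)
        + B (X z) (V z) (W' h))) (at z within S)"
proof -
  define D where "D = (\<lambda>i j. frechet_derivative (\<lambda>x. B x i j) (at (X z)))"
  have Xz: "X z \<in> U" using U by auto
  have dD: "((\<lambda>x. B x i j) has_derivative D i j) (at (X z))" for i j
    unfolding D_def using dB frechet_derivative_works by blast
  have DX: "((\<lambda>y. B (X y) i j) has_derivative (\<lambda>h. D i j (X' h))) (at z within S)" for i j
    using diff_chain_within[OF X has_derivative_at_withinI[OF dD]] by (simp add: o_def)
  have D2: "((\<lambda>x. B x u v) has_derivative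
      (\<lambda>k. \<Sum>i\<in>Basis. \<Sum>j\<in>Basis. (u \<bullet> i) * (v \<bullet> j) * D i j k)) (at (X z))" for u v
  proof -
    have "((\<lambda>x. \<Sum>i\<in>Basis. \<Sum>j\<in>Basis. (u \<bullet> i) * (v \<bullet> j) * B x i j) has_derivative
      (\<lambda>k. \<Sum>i\<in>Basis. \<Sum>j\<in>Basis. (u \<bullet> i) * (v \<bullet> j) * D i j k)) (at (X z))"
      by (intro has_derivative_sum has_derivative_mult_right dD)
    then show ?thesis
      by (rule has_derivative_transform_within_open[OF _ U(1) Xz])
        (rule bilinear_expansion[OF bil, symmetric])
  qed
  have "((\<lambda>y. \<Sum>i\<in>Basis. \<Sum>j\<in>Basis. (V y \<bullet> i) * (W y \<bullet> j) * B (X y) i j) has_derivative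
      (\<lambda>h. \<Sum>i\<in>Basis. \<Sum>j\<in>Basis. (V z \<bullet> i) * (W z \<bullet> j) * D i j (X' h) +
         ((V z \<bullet> i) * (W' h \<bullet> j) + (V' h \<bullet> i) * (W z \<bullet> j)) * B (X z) i j)) (at z within S)"
    by (intro has_derivative_sum has_derivative_mult DX has_derivative_inner_left V W)
  then have main: "((\<lambda>y. B (X y) (V y) (W y)) has_derivative
      (\<lambda>h. \<Sum>i\<in>Basis. \<Sum>j\<in>Basis. (V z \<bullet> i) * (W z \<bullet> j) * D i j (X' h) +
         ((V z \<bullet> i) * (W' h \<bullet> j) + (V' h \<bullet> i) * (W z \<bullet> j)) * B (X z) i j)) (at z within S)"
    by (rule has_derivative_transform[OF U(2), rotated])
      (rule bilinear_expansion[OF bil], use U in auto)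
  have eq: "(\<Sum>i\<in>Basis. \<Sum>j\<in>Basis. (V z \<bullet> i) * (W z \<bullet> j) * D i j (X' h) +
         ((V z \<bullet> i) * (W' h \<bullet> j) + (V' h \<bullet> i) * (W z \<bullet> j)) * B (X z) i j)
      = frechet_derivative (\<lambda>x. B x (V z) (W z)) (at (X z)) (X' h) + B (X z) (V' h) (W z)
        + B (X z) (V z) (W' h)" for h
    unfolding frechet_derivative_at_eq[OF D2] bilinear_expansion[OF bil[OF Xz], of "V' h" "W z"]
      bilinear_expansion[OF bil[OF Xz], of "V z" "W' h"]
    by (simp add: sum.distrib[symmetric] algebra_simps)
  show ?thesis using main unfolding eq .
qed

lemma riesz_nondegenerate:
  fixes b :: "'a::euclidean_space \<Rightarrow> 'a \<Rightarrow> real"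
  assumes b: "bilinear b" and nd: "\<And>u. (\<And>v. b u v = 0) \<Longrightarrow> u = 0" and f: "linear f"
  shows "\<exists>z. \<forall>w. b z w = f w"
proof -
  define L where "L = (\<lambda>z. \<Sum>i\<in>Basis. b z i *\<^sub>R i)"
  have lb: "linear (b z)" "linear (\<lambda>x. b x z)" for z using b unfolding bilinear_def by auto
  have L: "linear L" unfolding L_def
    by (intro linear_compose_sum ballI linearI)
      (simp_all add: linear_add[OF lb(2)] linear_scale[OF lb(2)] scaleR_add_left)
  have Li: "L z \<bullet> i = b z i" if "i \<in> Basis" for z i
    unfolding L_def using that by simp
  have "inj L"
  proof (rule linear_injective_0[OF L, THEN iffD2], intro allI impI)
    fix z assume "L z = 0"
    then have "b z i = 0" if "i \<in> Basis" for i using Li[OF that, of z] by simp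
    then have "b z v = 0" for v using linear_euclidean_expansion[OF lb(1), of z v] by simp
    then show "z = 0" by (rule nd)
  qed
  then have "surj L" using linear_injective_imp_surjective[OF L] by simp
  then obtain z where z: "L z = (\<Sum>i\<in>Basis. f i *\<^sub>R i)" by (metis surjD)
  have "b z w = f w" for w
  proof -
    have "b z i = f i" if "i \<in> Basis" for i
      using Li[OF that, of z] that unfolding z by simp
    then have "(\<Sum>i\<in>Basis. (w \<bullet> i) *\<^sub>R b z i) = (\<Sum>i\<in>Basis. (w \<bullet> i) *\<^sub>R f i)"
      by (intro sum.cong) auto
    then show ?thesis
      using linear_euclidean_expansion[OF lb(1), of z w] linear_euclidean_expansion[OF f, of w] by simp
  qed
  then show ?thesis by blast
qed

text \<open>The algebra behind the fundamental lemma of Riemannian geometry.  With \<open>D\<close> the derivative of the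
metric components, the alternating sum of the compatibility condition over cyclic permutations of \<open>u, v, w\<close> yields the
Koszul formula, and nondegeneracy turns the formula into a unique solution.\<close>

lemma fundamental_lemma_pointwise:
  fixes b :: "'a::euclidean_space \<Rightarrow> 'a \<Rightarrow> real" and D :: "'a \<Rightarrow> 'a \<Rightarrow> 'a \<Rightarrow> real"
  assumes b: "bilinear b" "\<And>u v. b u v = b v u" "\<And>u. (\<And>v. b u v = 0) \<Longrightarrow> u = 0"
    and D: "\<And>v w. linear (\<lambda>u. D u v w)" "\<And>u. bilinear (D u)" "\<And>u v w. D u v w = D u w v"
  defines "K \<equiv> \<lambda>u v w. (D u v w + D v u w - D w u v) / 2"
    and "LC \<equiv> \<lambda>\<Gamma>. bilinear \<Gamma> \<and> (\<forall>u v. \<Gamma> u v = \<Gamma> v u) \<and>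
          (\<forall>u v w. D u v w = b (\<Gamma> u v) w + b v (\<Gamma> u w))"
  shows "LC (The LC)" "b (The LC u v) w = K u v w"
proof -
  have lb: "linear (b z)" "linear (\<lambda>x. b x z)" for z using b(1) unfolding bilinear_def by auto
  have lD: "linear (D u v)" "linear (\<lambda>v. D u v w)" for u v w
    using D(2) unfolding bilinear_def by auto
  have linK: "linear (K u v)" "linear (\<lambda>v. K u v w)" "linear (\<lambda>u. K u v w)" for u v w
    unfolding K_def
    by (auto intro!: linearI simp: linear_add[OF lD(1)] linear_add[OF lD(2)] linear_add[OF D(1)]
        linear_scale[OF lD(1)] linear_scale[OF lD(2)] linear_scale[OF D(1)] field_simps)
  have eqI: "z = z'" if "\<And>w. b z w = b z' w" for z z'
    using b(3)[of "z - z'"] that by (simp add: linear_diff[OF lb(2)])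
  define G where "G = (\<lambda>u v. SOME z. \<forall>w. b z w = K u v w)"
  have G: "b (G u v) w = K u v w" for u v w
    using someI_ex[OF riesz_nondegenerate[OF b(1,3) linK(1), of u v]] unfolding G_def by blast
  have "LC G"
    unfolding LC_def bilinear_def
  proof (intro conjI allI)
    show "linear (G u)" for u
      by (intro linearI eqI) (simp_all add: linear_add[OF lb(2)] linear_scale[OF lb(2)] G
          linear_add[OF linK(2)] linear_scale[OF linK(2)])
    show "linear (\<lambda>u. G u v)" for v
      by (intro linearI eqI) (simp_all add: linear_add[OF lb(2)] linear_scale[OF lb(2)] G
          linear_add[OF linK(3)] linear_scale[OF linK(3)])
    show "G u v = G v u" for u v
      by (rule eqI) (simp add: G K_def D(3)[of _ v u])
    show "D u v w = b (G u v) w + b v (G u w)" for u v w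
      unfolding b(2)[of v "G u w"] G by (simp add: K_def D(3)[of _ w] field_simps)
  qed
  moreover have eqK: "b (\<Gamma> u v) w = K u v w" if "LC \<Gamma>" for \<Gamma> u v w
  proof -
    have eq: "D u v w = b (\<Gamma> u v) w + b v (\<Gamma> u w)" for u v w using that unfolding LC_def by blast
    have sym: "\<Gamma> u v = \<Gamma> v u" for u v using that unfolding LC_def by blast
    show ?thesis unfolding K_def eq sym[of v u] sym[of w u] sym[of w v]
      using b(2)[of "\<Gamma> u w" v] b(2)[of "\<Gamma> v w" u] by (simp add: field_simps)
  qed
  ultimately have "\<exists>!\<Gamma>. LC \<Gamma>"
    by (intro ex1I[of _ G]) (auto intro!: ext eqI simp: G)
  from theI'[OF this] show "LC (The LC)" .
  then show "b (The LC u v) w = K u v w" by (rule eqK)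
qed

section \<open>The Levi-Civita connection in charts\<close>

lemma linear_between_sum:
  assumes "linear_between V W f" "subspace V" "finite F" "h ` F \<subseteq> V"
  shows "f (\<Sum>a\<in>F. q a *\<^sub>R h a) = (\<Sum>a\<in>F. q a *\<^sub>R f (h a))"
  using assms(3,4)
proof (induction F rule: finite_induct)
  case empty
  have "f (0 *\<^sub>R 0) = 0 *\<^sub>R f 0"
    using assms(1) subspace_0[OF assms(2)] unfolding linear_between_def by blast
  then show ?case by simp
next
  case (insert x F)
  have "(\<Sum>a\<in>F. q a *\<^sub>R h a) \<in> V" "q x *\<^sub>R h x \<in> V"
    using insert assms(2) by (auto intro!: subspace_sum subspace_scale)
  then have "f (q x *\<^sub>R h x + (\<Sum>a\<in>F. q a *\<^sub>R h a)) = f (q x *\<^sub>R h x) + f (\<Sum>a\<in>F. q a *\<^sub>R h a)"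
    "f (q x *\<^sub>R h x) = q x *\<^sub>R f (h x)"
    using assms(1) insert.prems unfolding linear_between_def by auto
  then show ?case using insert by simp
qed

text \<open>In the expansion of \<open>u\<close> in the pseudo-orthonormal vectors each coefficient is \<open>\<plusminus> b u a\<close>.\<close>

lemma signature_nondegenerate:
  assumes sig: "has_signature V b r s" and V: "subspace V"
    and lin: "\<And>w. w \<in> V \<Longrightarrow> linear_between V UNIV (\<lambda>u. b u w)"
    and u: "u \<in> V" "\<And>w. w \<in> V \<Longrightarrow> b u w = 0"
  shows "u = 0"
proof -
  obtain P N where PN: "finite P" "finite N" "P \<inter> N = {}" "span (P \<union> N) = V"
    "\<forall>u\<in>P \<union> N. \<forall>v\<in>P \<union> N. u \<noteq> v \<longrightarrow> b u v = 0" "\<forall>u\<in>P. b u u = 1" "\<forall>u\<in>N. b u u = - 1"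
    using sig unfolding has_signature_def by (elim exE conjE) (rule that; assumption)
  have sub: "P \<union> N \<subseteq> V" using PN(4) span_superset by blast
  obtain q where q: "u = (\<Sum>a\<in>P \<union> N. q a *\<^sub>R a)"
    using u(1) PN unfolding PN(4)[symmetric] by (auto simp: span_finite)
  have "q a = 0" if a: "a \<in> P \<union> N" for a
  proof -
    have aV: "a \<in> V" using a sub by auto
    have "0 = b u a" using u(2)[OF aV] by simp
    also have "\<dots> = (\<Sum>x\<in>P \<union> N. q x *\<^sub>R b x a)"
      unfolding q using linear_between_sum[OF lin[OF aV] V, of "P \<union> N" "\<lambda>x. x"] PN sub by simp
    also have "\<dots> = (\<Sum>x\<in>P \<union> N. if x = a then q a * b a a else 0)"
      by (rule sum.cong) (use PN(5) a in auto)
    also have "\<dots> = q a * b a a" using PN a by (simp add: sum.delta)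
    finally show ?thesis using PN a by auto
  qed
  then show ?thesis unfolding q by (simp add: sum.neutral)
qed

locale pseudo_riemannian_manifold = smooth_manifold A
  for A :: "('m::{t2_space, second_countable_topology}, 'e::euclidean_space) chart set" +
  fixes g :: "'m \<Rightarrow> ('m, 'e) tvec \<Rightarrow> ('m, 'e) tvec \<Rightarrow> real" and r s :: nat
  assumes metric: "pseudo_riemannian_metric A g r s"
begin

lemma metric_sym:
  "p \<in> carrier_of A \<Longrightarrow> u \<in> tangent_space A p \<Longrightarrow> v \<in> tangent_space A p \<Longrightarrow> g p u v = g p v u"
  using metric unfolding pseudo_riemannian_metric_def by blast

lemma metric_linear:
  assumes "p \<in> carrier_of A" "u \<in> tangent_space A p"
  shows "linear_between (tangent_space A p) UNIV (g p u)"
    and "linear_between (tangent_space A p) UNIV (\<lambda>v. g p v u)"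
proof -
  show 1: "linear_between (tangent_space A p) UNIV (g p u)"
    using assms metric unfolding pseudo_riemannian_metric_def by blast
  have V: "subspace (tangent_space A p)" using subspace_tangent_space[OF assms(1)] .
  show "linear_between (tangent_space A p) UNIV (\<lambda>v. g p v u)"
    using 1 metric_sym[OF assms(1) _ assms(2)] subspace_add[OF V] subspace_scale[OF V]
    unfolding linear_between_def by simp
qed

lemma metric_nondegenerate:
  assumes "p \<in> carrier_of A" "u \<in> tangent_space A p" "\<And>w. w \<in> tangent_space A p \<Longrightarrow> g p u w = 0"
  shows "u = 0"
proof -
  have sig: "has_signature (tangent_space A p) (g p) r s"
    using assms(1) metric unfolding pseudo_riemannian_metric_def by blast
  show ?thesis
    by (rule signature_nondegenerate[OF sig subspace_tangent_space[OF assms(1)]])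
      (use metric_linear(2)[OF assms(1)] assms(2,3) in auto)
qed

lemma local_form_coords:
  assumes "c \<in> A" "p \<in> dom_of c"
  shows "local_form A g c (coords c p) u v = g p (tangent_of A c p u) (tangent_of A c p v)"
  using assms by (simp add: local_form_def)

lemma metric_in_chart:
  assumes "c \<in> A" "p \<in> dom_of c" "v \<in> tangent_space A p" "w \<in> tangent_space A p"
  shows "g p v w = local_form A g c (coords c p) (v c) (w c)"
  using assms by (simp add: local_form_coords tangent_of_comp)

lemma local_form_bilinear:
  assumes "c \<in> A" "p \<in> dom_of c"
  shows "bilinear (local_form A g c (coords c p))"
  using metric_linear[OF dom_subset_carrier[OF assms] tangent_of_in[OF assms]] tangent_of_in[OF assms]
  unfolding bilinear_def local_form_coords[OF assms] linear_between_def
  by (auto intro!: linearI simp: local_form_coords[OF assms] tangent_of_add[OF assms] tangent_of_scaleR[OF assms])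

lemma local_form_sym:
  assumes "c \<in> A" "p \<in> dom_of c"
  shows "local_form A g c (coords c p) u v = local_form A g c (coords c p) v u"
  unfolding local_form_coords[OF assms]
  by (rule metric_sym[OF dom_subset_carrier[OF assms] tangent_of_in[OF assms] tangent_of_in[OF assms]])

lemma local_form_nondegenerate:
  assumes "c \<in> A" "p \<in> dom_of c" "\<And>v. local_form A g c (coords c p) u v = 0"
  shows "u = 0"
proof -
  have "tangent_of A c p u = 0"
    by (rule metric_nondegenerate[OF dom_subset_carrier[OF assms(1,2)] tangent_of_in[OF assms(1,2)]])
      (metis assms local_form_coords tangent_of_comp)
  then have "tangent_of A c p u c = 0" by simp
  then show ?thesis using tangent_of_self[OF assms(1,2)] by simp
qed

lemma local_form_smooth:
  "c \<in> A \<Longrightarrow> smooth_on (coords c ` dom_of c) (\<lambda>x. local_form A g c x u v)"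
  using metric unfolding pseudo_riemannian_metric_def by blast

lemma local_form_differentiable:
  assumes "c \<in> A" "p \<in> dom_of c"
  shows "(\<lambda>x. local_form A g c x u v) differentiable (at (coords c p))"
  using smooth_on_differentiable[OF local_form_smooth open_image_dom] assms by blast

lemma local_form_change:
  assumes "c \<in> A" "c' \<in> A" "p \<in> dom_of c" "p \<in> dom_of c'"
  shows "local_form A g c (coords c p) u v =
    local_form A g c' (coords c' p) (transition_deriv c c' p u) (transition_deriv c c' p v)"
  using assms by (simp add: local_form_coords tangent_of_change)

definition metric_deriv :: "('m, 'e) chart \<Rightarrow> 'e \<Rightarrow> 'e \<Rightarrow> 'e \<Rightarrow> 'e \<Rightarrow> real" where
  "metric_deriv c x w u v = frechet_derivative (\<lambda>y. local_form A g c y u v) (at x) w"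

text \<open>The Christoffel symbols of the first kind: half of the right-hand side of the Koszul formula for
coordinate fields.  Unlike the connection itself they need no inverse of the metric.\<close>

definition koszul :: "('m, 'e) chart \<Rightarrow> 'e \<Rightarrow> 'e \<Rightarrow> 'e \<Rightarrow> 'e \<Rightarrow> real" where
  "koszul c x u v w = (metric_deriv c x u v w + metric_deriv c x v u w - metric_deriv c x w u v) / 2"

lemma local_form_has_derivative:
  fixes X :: "'z::real_normed_vector \<Rightarrow> 'e"
  assumes c: "c \<in> A" "p \<in> dom_of c" and z: "z \<in> S" "X z = coords c p" "X ` S \<subseteq> coords c ` dom_of c"
    and "(X has_derivative X') (at z within S)" "(V has_derivative V') (at z within S)"
    "(W has_derivative W') (at z within S)"
  shows "((\<lambda>y. local_form A g c (X y) (V y) (W y)) has_derivative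
     (\<lambda>h. metric_deriv c (coords c p) (X' h) (V z) (W z) + local_form A g c (coords c p) (V' h) (W z)
        + local_form A g c (coords c p) (V z) (W' h))) (at z within S)"
  unfolding metric_deriv_def z(2)[symmetric]
  by (rule bilinear_field_has_derivative[OF _ _ open_image_dom[OF c(1)] z(1,3) assms(6-8)])
    (use local_form_bilinear[OF c(1)] local_form_differentiable[OF c] z(2) in auto)

lemma metric_deriv_linear:
  assumes "c \<in> A" "p \<in> dom_of c"
  shows "linear (\<lambda>w. metric_deriv c (coords c p) w u v)"
  unfolding metric_deriv_def using linear_frechet_derivative[OF local_form_differentiable[OF assms]] .

lemma metric_deriv_sym:
  assumes "c \<in> A" "p \<in> dom_of c"
  shows "metric_deriv c (coords c p) w u v = metric_deriv c (coords c p) w v u"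
proof -
  have "frechet_derivative (\<lambda>y. local_form A g c y u v) (at (coords c p)) =
      frechet_derivative (\<lambda>y. local_form A g c y v u) (at (coords c p))"
    by (rule frechet_derivative_transform_within_open[OF local_form_differentiable[OF assms]
          open_image_dom[OF assms(1)]]) (use assms(2) local_form_sym[OF assms(1)] in auto)
  then show ?thesis by (simp add: metric_deriv_def)
qed

lemma metric_deriv_bilinear:
  assumes c: "c \<in> A" "p \<in> dom_of c"
  shows "bilinear (metric_deriv c (coords c p) w)"
proof -
  note d = local_form_differentiable[OF c, unfolded frechet_derivative_works]
  note open_im = open_image_dom[OF c(1)]
  have x: "coords c p \<in> coords c ` dom_of c" using c by auto
  have lin: "linear (metric_deriv c (coords c p) w u)" for u
  proof (rule linearI)
    fix v v' :: 'e and a :: real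
    have "((\<lambda>y. local_form A g c y u (v + v')) has_derivative
       (\<lambda>w. metric_deriv c (coords c p) w u v + metric_deriv c (coords c p) w u v')) (at (coords c p))"
      unfolding metric_deriv_def
      by (rule has_derivative_transform_within_open[OF has_derivative_add[OF d d] open_im x])
        (use bilinear_radd[OF local_form_bilinear[OF c(1)]] in auto)
    then show "metric_deriv c (coords c p) w u (v + v') =
        metric_deriv c (coords c p) w u v + metric_deriv c (coords c p) w u v'"
      unfolding metric_deriv_def[of _ _ _ u "v + v'"] by (simp add: frechet_derivative_at_eq)
    have "((\<lambda>y. local_form A g c y u (a *\<^sub>R v)) has_derivative
       (\<lambda>w. a * metric_deriv c (coords c p) w u v)) (at (coords c p))"
      unfolding metric_deriv_def
      by (rule has_derivative_transform_within_open[OF has_derivative_mult_right[OF d] open_im x])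
        (use bilinear_rmul[OF local_form_bilinear[OF c(1)]] in auto)
    then show "metric_deriv c (coords c p) w u (a *\<^sub>R v) = a *\<^sub>R metric_deriv c (coords c p) w u v"
      unfolding metric_deriv_def[of _ _ _ u "a *\<^sub>R v"] by (simp add: frechet_derivative_at_eq)
  qed
  moreover have "linear (\<lambda>u. metric_deriv c (coords c p) w u v)" for v
    using lin[of v] unfolding metric_deriv_sym[OF c, of w _ v] .
  ultimately show ?thesis unfolding bilinear_def by blast
qed

lemma christoffel:
  assumes c: "c \<in> A" "p \<in> dom_of c"
  shows christoffel_bilinear: "bilinear (christoffel A g c p)"
    and christoffel_sym: "christoffel A g c p u v = christoffel A g c p v u"
    and metric_deriv_christoffel: "metric_deriv c (coords c p) u v w =
       local_form A g c (coords c p) (christoffel A g c p u v) w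
       + local_form A g c (coords c p) v (christoffel A g c p u w)"
    and christoffel_koszul: "local_form A g c (coords c p) (christoffel A g c p u v) w = koszul c (coords c p) u v w"
proof -
  note * = fundamental_lemma_pointwise[of "local_form A g c (coords c p)" "metric_deriv c (coords c p)",
     OF local_form_bilinear[OF c] local_form_sym[OF c] local_form_nondegenerate[OF c]
       metric_deriv_linear[OF c] metric_deriv_bilinear[OF c] metric_deriv_sym[OF c]]
  have eq: "(THE \<Gamma>. bilinear \<Gamma> \<and> (\<forall>u v. \<Gamma> u v = \<Gamma> v u) \<and>
          (\<forall>u v w. metric_deriv c (coords c p) u v w = local_form A g c (coords c p) (\<Gamma> u v) w
             + local_form A g c (coords c p) v (\<Gamma> u w))) = christoffel A g c p"
    unfolding christoffel_def metric_deriv_def ..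
  show "bilinear (christoffel A g c p)" "christoffel A g c p u v = christoffel A g c p v u"
     "metric_deriv c (coords c p) u v w =
       local_form A g c (coords c p) (christoffel A g c p u v) w
       + local_form A g c (coords c p) v (christoffel A g c p u w)"
    using *(1) unfolding eq by blast+
  show "local_form A g c (coords c p) (christoffel A g c p u v) w = koszul c (coords c p) u v w"
    using *(2)[of u v w] unfolding eq koszul_def .
qed

definition second_transition_deriv :: "('m, 'e) chart \<Rightarrow> ('m, 'e) chart \<Rightarrow> 'e \<Rightarrow> 'e \<Rightarrow> 'e \<Rightarrow> 'e" where
  "second_transition_deriv c c' x u v =
     frechet_derivative (\<lambda>y. frechet_derivative (\<lambda>z. coords c' (coords_inv c z)) (at y) v) (at x) u"

lemma second_transition_deriv_sym:
  assumes "c \<in> A" "c' \<in> A" "p \<in> dom_of c" "p \<in> dom_of c'"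
  shows "second_transition_deriv c c' (coords c p) u v = second_transition_deriv c c' (coords c p) v u"
  unfolding second_transition_deriv_def
  by (rule second_derivative_symmetric[OF open_overlap[OF assms(1,2)] _ transition_smooth[OF assms(1,2)]])
    (use assms in auto)

lemma transition_deriv_has_derivative:
  assumes "c \<in> A" "c' \<in> A" "p \<in> dom_of c" "p \<in> dom_of c'"
  shows "((\<lambda>y. frechet_derivative (\<lambda>z. coords c' (coords_inv c z)) (at y) v) has_derivative
     (\<lambda>u. second_transition_deriv c c' (coords c p) u v)) (at (coords c p))"
  unfolding second_transition_deriv_def
  by (rule smooth_on_has_derivative[OF smooth_on_derivative[OF transition_smooth[OF assms(1,2)]]])
    (use assms open_overlap in auto)

text \<open>Obtained by differentiating \<open>b(x)(u, v) = b'(\<tau>(x))(D\<tau>(x) u, D\<tau>(x) v)\<close>, where \<open>\<tau>\<close> is the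
transition map.\<close>

lemma metric_deriv_change:
  assumes c: "c \<in> A" "c' \<in> A" and p: "p \<in> dom_of c" "p \<in> dom_of c'"
  defines "\<tau> \<equiv> transition_deriv c c' p" and "H \<equiv> second_transition_deriv c c' (coords c p)"
    and "b' \<equiv> local_form A g c' (coords c' p)"
  shows "metric_deriv c (coords c p) w u v =
    metric_deriv c' (coords c' p) (\<tau> w) (\<tau> u) (\<tau> v) + b' (H w u) (\<tau> v) + b' (\<tau> u) (H w v)"
proof -
  let ?S = "coords c ` (dom_of c \<inter> dom_of c')"
  let ?tr = "\<lambda>z. coords c' (coords_inv c z)"
  have S: "open ?S" "coords c p \<in> ?S" using open_overlap c p by auto
  note within = at_within_open[OF S(2,1)]
  have tau: "frechet_derivative ?tr (at (coords c p)) = \<tau>"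
    unfolding \<tau>_def transition_deriv_def ..
  have "((\<lambda>y. local_form A g c' (?tr y) (frechet_derivative ?tr (at y) u) (frechet_derivative ?tr (at y) v))
     has_derivative (\<lambda>h. metric_deriv c' (coords c' p) (\<tau> h) (frechet_derivative ?tr (at (coords c p)) u)
         (frechet_derivative ?tr (at (coords c p)) v)
        + b' (H h u) (frechet_derivative ?tr (at (coords c p)) v)
        + b' (frechet_derivative ?tr (at (coords c p)) u) (H h v))) (at (coords c p) within ?S)"
    unfolding b'_def H_def \<tau>_def
    by (rule local_form_has_derivative[OF c(2) p(2) S(2)])
      (use c p in \<open>auto simp: within intro: transition_has_derivative transition_deriv_has_derivative\<close>)
  then have "((\<lambda>y. local_form A g c y u v) has_derivative
     (\<lambda>h. metric_deriv c' (coords c' p) (\<tau> h) (\<tau> u) (\<tau> v) + b' (H h u) (\<tau> v) + b' (\<tau> u) (H h v)))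
     (at (coords c p))"
    unfolding within tau
  proof (rule has_derivative_transform_within_open[OF _ S])
    fix y assume "y \<in> ?S"
    then obtain q where q: "q \<in> dom_of c" "q \<in> dom_of c'" "y = coords c q" by auto
    show "local_form A g c' (?tr y) (frechet_derivative ?tr (at y) u) (frechet_derivative ?tr (at y) v) =
        local_form A g c y u v"
      using local_form_change[OF c q(1,2)] c q unfolding transition_deriv_def by simp
  qed
  then show ?thesis unfolding metric_deriv_def[of c] by (simp add: frechet_derivative_at_eq)
qed

text \<open>The inhomogeneous transformation law of the Christoffel symbols.  Of the six second-derivative terms
that \<open>metric_deriv_change\<close> produces, four cancel because second derivatives of the transition map
are symmetric.\<close>

lemma koszul_change:
  assumes c: "c \<in> A" "c' \<in> A" and p: "p \<in> dom_of c" "p \<in> dom_of c'"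
  shows "koszul c (coords c p) u v w =
    koszul c' (coords c' p) (transition_deriv c c' p u) (transition_deriv c c' p v) (transition_deriv c c' p w)
    + local_form A g c' (coords c' p) (second_transition_deriv c c' (coords c p) u v) (transition_deriv c c' p w)"
  unfolding koszul_def metric_deriv_change[OF c p]
    second_transition_deriv_sym[OF c p, of v u] second_transition_deriv_sym[OF c p, of w u]
    second_transition_deriv_sym[OF c p, of w v]
    local_form_sym[OF c(2) p(2), of "transition_deriv c c' p v" "second_transition_deriv c c' (coords c p) u w"]
    local_form_sym[OF c(2) p(2), of "transition_deriv c c' p u" "second_transition_deriv c c' (coords c p) v w"]
  by (simp add: field_simps)

end

section \<open>Traces on finite-dimensional subspaces\<close>

text \<open>Both sides equal the double sum of the products of an entry of \<open>L\<close>, from \<open>B\<close> to \<open>C\<close>, with the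
opposite entry of the change of basis.\<close>

lemma sum_representation_basis_independent:
  assumes B: "finite B" "independent B" "span B = V" and C: "finite C" "independent C" "span C = V"
    and L: "linear_between V V L"
  shows "(\<Sum>b\<in>B. representation B (L b) b) = (\<Sum>c\<in>C. representation C (L c) c)"
proof -
  have V: "subspace V" using B(3) subspace_span by blast
  have BV: "b \<in> V" if "b \<in> B" for b using B(3) that span_base by blast
  have CV: "c \<in> V" if "c \<in> C" for c using C(3) that span_base by blast
  have LV: "L v \<in> V" if "v \<in> V" for v using L that unfolding linear_between_def by blast
  have repB: "v = (\<Sum>b\<in>B. representation B v b *\<^sub>R b)" if "v \<in> V" for v
    using sum_representation_eq[OF B(2) _ B(1), of v] that B(3) by simp
  have repC: "v = (\<Sum>c\<in>C. representation C v c *\<^sub>R c)" if "v \<in> V" for v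
    using sum_representation_eq[OF C(2) _ C(1), of v] that C(3) by simp
  have 1: "representation B (L b) b =
      (\<Sum>c\<in>C. representation C (L b) c * representation B c b)" if b: "b \<in> B" for b
  proof -
    have "representation B (L b) b = representation B (\<Sum>c\<in>C. representation C (L b) c *\<^sub>R c) b"
      by (rule arg_cong[OF repC[OF LV[OF BV[OF b]]], of "\<lambda>v. representation B v b"])
    also have "\<dots> = (\<Sum>c\<in>C. representation B (representation C (L b) c *\<^sub>R c) b)"
      by (subst representation_sum[OF B(2)]) (use CV B(3) in \<open>auto intro: span_scale\<close>)
    also have "\<dots> = (\<Sum>c\<in>C. representation C (L b) c * representation B c b)"
      by (intro sum.cong refl) (use CV B in \<open>simp add: representation_scale\<close>)
    finally show ?thesis .
  qed
  have 2: "representation C (L c) c =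
      (\<Sum>b\<in>B. representation B c b * representation C (L b) c)" if c: "c \<in> C" for c
  proof -
    have "L c = L (\<Sum>b\<in>B. representation B c b *\<^sub>R b)"
      by (rule arg_cong[OF repB[OF CV[OF c]]])
    also have "\<dots> = (\<Sum>b\<in>B. representation B c b *\<^sub>R L b)"
      using linear_between_sum[OF L V B(1), of "\<lambda>b. b"] BV by auto
    finally have "representation C (L c) c = representation C (\<Sum>b\<in>B. representation B c b *\<^sub>R L b) c"
      by simp
    also have "\<dots> = (\<Sum>b\<in>B. representation C (representation B c b *\<^sub>R L b) c)"
      by (subst representation_sum[OF C(2)]) (use BV LV C(3) in \<open>auto intro: span_scale\<close>)
    also have "\<dots> = (\<Sum>b\<in>B. representation B c b * representation C (L b) c)"
      by (intro sum.cong refl) (use BV LV C in \<open>simp add: representation_scale\<close>)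
    finally show ?thesis .
  qed
  have "(\<Sum>b\<in>B. representation B (L b) b) =
      (\<Sum>b\<in>B. \<Sum>c\<in>C. representation C (L b) c * representation B c b)"
    using 1 by (intro sum.cong) auto
  also have "\<dots> = (\<Sum>c\<in>C. \<Sum>b\<in>B. representation B c b * representation C (L b) c)"
    by (subst sum.swap) (simp add: mult.commute)
  also have "\<dots> = (\<Sum>c\<in>C. representation C (L c) c)"
    using 2 by (intro sum.cong) auto
  finally show ?thesis .
qed

lemma trace_on_eq:
  assumes C: "finite C" "independent C" "span C = V" and L: "linear_between V V L"
  shows "trace_on V L = (\<Sum>c\<in>C. representation C (L c) c)"
proof -
  define B where "B = (SOME B. independent B \<and> span B = V)"
  have "\<exists>B. independent B \<and> span B = V" using C by blast
  from someI_ex[OF this] have B: "independent B" "span B = V" unfolding B_def by auto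
  have "finite B"
    using independent_span_bound[OF C(1) B(1)] B(2) C(3) span_superset by blast
  from sum_representation_basis_independent[OF this B C L]
  show ?thesis unfolding trace_on_def B_def Let_def .
qed

lemma subspace_dim_one:
  assumes "subspace S" "dim S = 1"
  obtains e where "e \<in> S" "e \<noteq> 0" "\<And>v. v \<in> S \<Longrightarrow> \<exists>k. v = k *\<^sub>R e"
proof -
  obtain B where B: "B \<subseteq> S" "independent B" "S \<subseteq> span B" "card B = dim S"
    using basis_exists by blast
  then obtain e where e: "B = {e}" using assms card_1_singletonE by metis
  show ?thesis
  proof
    show "e \<in> S" "e \<noteq> 0" using B e by auto
    show "\<exists>k. v = k *\<^sub>R e" if "v \<in> S" for v
      using that B(3) e by (auto simp: span_singleton)
  qed
qed

lemma linear_between_rules: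
  assumes "linear_between V W f" "subspace V" "u \<in> V"
  shows "v \<in> V \<Longrightarrow> f (u + v) = f u + f v" "f (a *\<^sub>R u) = a *\<^sub>R f u" "f (- u) = - f u"
    "v \<in> V \<Longrightarrow> f (u - v) = f u - f v"
proof -
  have add: "f (u + v) = f u + f v" if "u \<in> V" "v \<in> V" for u v
    using that assms(1) unfolding linear_between_def by blast
  have scale: "f (a *\<^sub>R u) = a *\<^sub>R f u" if "u \<in> V" for u a
    using that assms(1) unfolding linear_between_def by blast
  show "f (u + v) = f u + f v" if "v \<in> V" using add assms that by blast
  show "f (a *\<^sub>R u) = a *\<^sub>R f u" using scale assms by blast
  show "f (- u) = - f u" using scale[OF assms(3), of "- 1"] by simp
  show "f (u - v) = f u - f v" if "v \<in> V"
    using add[OF assms(3), of "- 1 *\<^sub>R v"] scale[OF that, of "- 1"] subspace_neg[OF assms(2) that] by simp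
qed

section \<open>Three-dimensional paracontact metric vector spaces\<close>

locale paracontact_vector_space =
  fixes V :: "'a::real_vector set" and \<phi> :: "'a \<Rightarrow> 'a" and \<xi> :: 'a and \<eta> :: "'a \<Rightarrow> real"
    and b :: "'a \<Rightarrow> 'a \<Rightarrow> real"
  assumes V: "subspace V" and xi [simp]: "\<xi> \<in> V"
    and phi_lin: "linear_between V V \<phi>" and eta_lin: "linear_between V UNIV \<eta>"
    and b_lin: "\<And>u. u \<in> V \<Longrightarrow> linear_between V UNIV (b u)"
    and b_sym: "\<And>u v. u \<in> V \<Longrightarrow> v \<in> V \<Longrightarrow> b u v = b v u"
    and b_nondegenerate: "\<And>u. u \<in> V \<Longrightarrow> (\<And>v. v \<in> V \<Longrightarrow> b u v = 0) \<Longrightarrow> u = 0"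
    and eta_xi [simp]: "\<eta> \<xi> = 1"
    and phi_phi: "\<And>v. v \<in> V \<Longrightarrow> \<phi> (\<phi> v) = v - \<eta> v *\<^sub>R \<xi>"
    and dim_plus: "dim {v \<in> V. \<eta> v = 0 \<and> \<phi> v = v} = 1"
    and dim_minus: "dim {v \<in> V. \<eta> v = 0 \<and> \<phi> v = - v} = 1"
    and compatible: "\<And>u v. u \<in> V \<Longrightarrow> v \<in> V \<Longrightarrow> b (\<phi> u) (\<phi> v) = - b u v + \<eta> u * \<eta> v"
begin

lemma V_closed [simp]:
  "u \<in> V \<Longrightarrow> v \<in> V \<Longrightarrow> u + v \<in> V" "u \<in> V \<Longrightarrow> v \<in> V \<Longrightarrow> u - v \<in> V"
  "u \<in> V \<Longrightarrow> a *\<^sub>R u \<in> V" "0 \<in> V" "u \<in> V \<Longrightarrow> - u \<in> V" "u \<in> V \<Longrightarrow> \<phi> u \<in> V"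
  using V phi_lin by (auto simp: subspace_add subspace_diff subspace_scale subspace_0 subspace_neg linear_between_def)

lemmas phi_linear [simp] = linear_between_rules[OF phi_lin V]
  and eta_linear [simp] = linear_between_rules[OF eta_lin V, unfolded real_scaleR_def]
  and b_linear_right [simp] = linear_between_rules[OF b_lin V, unfolded real_scaleR_def]

lemma b_linear_left [simp]:
  assumes "u \<in> V" "w \<in> V"
  shows "v \<in> V \<Longrightarrow> b (u + v) w = b u w + b v w" "b (a *\<^sub>R u) w = a * b u w" "b (- u) w = - b u w"
    "v \<in> V \<Longrightarrow> b (u - v) w = b u w - b v w"
  using assms by (simp_all add: b_sym[of _ w])

lemma zero_simps [simp]: "\<phi> 0 = 0" "\<eta> 0 = 0" "u \<in> V \<Longrightarrow> b u 0 = 0" "u \<in> V \<Longrightarrow> b 0 u = 0"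
  using phi_linear(2)[OF xi, of 0] eta_linear(2)[OF xi, of 0] b_linear_right(2)[OF _ xi, of u 0]
    b_linear_left(2)[OF xi, of u 0] by simp_all

lemma phi_xi [simp]: "\<phi> \<xi> = 0"
proof -
  have "\<phi> (\<phi> \<xi>) = 0" using phi_phi[OF xi] by simp
  then have "\<phi> (\<phi> (\<phi> \<xi>)) = 0" by simp
  then have eq: "\<phi> \<xi> = \<eta> (\<phi> \<xi>) *\<^sub>R \<xi>" using phi_phi[of "\<phi> \<xi>"] by simp
  then have "\<phi> (\<phi> \<xi>) = \<eta> (\<phi> \<xi>) *\<^sub>R \<phi> \<xi>" using phi_linear(2)[OF xi] by metis
  then show ?thesis using \<open>\<phi> (\<phi> \<xi>) = 0\<close> eq by auto
qed

lemma xi_nonzero: "\<xi> \<noteq> 0"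
  using eta_xi zero_simps(2) by (metis zero_neq_one)

lemma b_xi: "v \<in> V \<Longrightarrow> b v \<xi> = \<eta> v"
  using compatible[of v \<xi>] by simp

lemma eta_phi [simp]:
  assumes "v \<in> V"
  shows "\<eta> (\<phi> v) = 0"
proof -
  have "\<phi> (\<phi> (\<phi> v)) = \<phi> v" using assms by (simp add: phi_phi[of v])
  then have "\<eta> (\<phi> v) *\<^sub>R \<xi> = 0" using phi_phi[of "\<phi> v"] assms by simp
  then show ?thesis using xi_nonzero by simp
qed

text \<open>Compatibility applied to \<open>u\<close> and \<open>\<phi> v\<close>, using that \<open>\<phi>\<close> is an involution on \<open>ker \<eta>\<close>.\<close>

lemma phi_skew:
  assumes "u \<in> V" "v \<in> V"
  shows "b (\<phi> u) v = - b u (\<phi> v)"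
  using compatible[of u "\<phi> v"] assms by (simp add: phi_phi b_xi)

lemma b_xi_left: "v \<in> V \<Longrightarrow> b \<xi> v = \<eta> v"
  using b_xi[of v] b_sym[of \<xi> v] by simp

lemma b_phi_self: "v \<in> V \<Longrightarrow> b v (\<phi> v) = 0" "v \<in> V \<Longrightarrow> b (\<phi> v) v = 0"
  using phi_skew[of v v] b_sym[of v "\<phi> v"] by simp_all

lemma b_eigenvector:
  "v \<in> V \<Longrightarrow> \<phi> v = v \<or> \<phi> v = - v \<Longrightarrow> b v v = 0"
  using b_phi_self(1)[of v] by auto

text \<open>Coordinates adapted to the structure: \<open>\<xi>\<close> together with null eigenvectors \<open>e\<close> and \<open>f\<close>.  They span
since \<open>v - \<eta>(v) \<xi>\<close> is the sum of its \<open>\<phi>\<close>-symmetric and \<open>\<phi>\<close>-antisymmetric halves, and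
\<open>b e f \<noteq> 0\<close> since otherwise \<open>e\<close> would be orthogonal to everything.\<close>

lemma eigenframe:
  obtains e f where "e \<in> V" "f \<in> V" "e \<noteq> 0" "f \<noteq> 0" "\<eta> e = 0" "\<eta> f = 0" "\<phi> e = e" "\<phi> f = - f"
    "b e e = 0" "b f f = 0" "b e f \<noteq> 0" "\<And>v. v \<in> V \<Longrightarrow> \<exists>x y. v = x *\<^sub>R e + y *\<^sub>R f + \<eta> v *\<^sub>R \<xi>"
proof -
  have S: "subspace {v \<in> V. \<eta> v = 0 \<and> \<phi> v = v}" "subspace {v \<in> V. \<eta> v = 0 \<and> \<phi> v = - v}"
    unfolding subspace_def by auto
  obtain e where e: "e \<in> {v \<in> V. \<eta> v = 0 \<and> \<phi> v = v}" "e \<noteq> 0"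
    and e': "\<And>v. v \<in> {v \<in> V. \<eta> v = 0 \<and> \<phi> v = v} \<Longrightarrow> \<exists>k. v = k *\<^sub>R e"
    using subspace_dim_one[OF S(1) dim_plus] by blast
  obtain f where f: "f \<in> {v \<in> V. \<eta> v = 0 \<and> \<phi> v = - v}" "f \<noteq> 0"
    and f': "\<And>v. v \<in> {v \<in> V. \<eta> v = 0 \<and> \<phi> v = - v} \<Longrightarrow> \<exists>k. v = k *\<^sub>R f"
    using subspace_dim_one[OF S(2) dim_minus] by blast
  have dec: "\<exists>x y. v = x *\<^sub>R e + y *\<^sub>R f + \<eta> v *\<^sub>R \<xi>" if v: "v \<in> V" for v
  proof -
    define h where "h = v - \<eta> v *\<^sub>R \<xi>"
    have h: "h \<in> V" "\<eta> h = 0" "\<phi> h = \<phi> v" using v by (simp_all add: h_def)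
    have hh: "\<phi> (\<phi> v) = h" using phi_phi[OF v] by (simp add: h_def)
    have "(1/2) *\<^sub>R (h + \<phi> v) \<in> {v \<in> V. \<eta> v = 0 \<and> \<phi> v = v}"
      using h hh v by (simp add: add.commute)
    then obtain x where x: "(1/2) *\<^sub>R (h + \<phi> v) = x *\<^sub>R e" using e' by blast
    have "(1/2) *\<^sub>R (h - \<phi> v) \<in> {v \<in> V. \<eta> v = 0 \<and> \<phi> v = - v}"
      using h hh v by (simp add: scaleR_minus_right[symmetric] del: scaleR_minus_right)
    then obtain y where y: "(1/2) *\<^sub>R (h - \<phi> v) = y *\<^sub>R f" using f' by blast
    have "v = (1/2) *\<^sub>R (h + \<phi> v) + (1/2) *\<^sub>R (h - \<phi> v) + \<eta> v *\<^sub>R \<xi>"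
      by (simp add: h_def scaleR_add_right[symmetric] scaleR_2[symmetric] del: scaleR_add_right)
    then show ?thesis using x y by metis
  qed
  have ee: "b e e = 0" "b f f = 0" using b_eigenvector e f by auto
  have "b e f \<noteq> 0"
  proof
    assume ef: "b e f = 0"
    have "b e v = 0" if v: "v \<in> V" for v
    proof -
      obtain x y where "v = x *\<^sub>R e + y *\<^sub>R f + \<eta> v *\<^sub>R \<xi>" using dec[OF v] by blast
      moreover have "b e (x *\<^sub>R e + y *\<^sub>R f + \<eta> v *\<^sub>R \<xi>) = 0"
        using e f ee ef by (simp add: b_xi)
      ultimately show ?thesis by simp
    qed
    then show False using b_nondegenerate[of e] e by blast
  qed
  then show ?thesis using that[of e f] e f ee dec by blast
qed

text \<open>Thus \<open>\<xi>\<close>, \<open>T\<close> and \<open>\<phi> T\<close> span the space.  In null coordinates \<open>b T T - \<eta>(T)\<^sup>2\<close> is twice the product of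
the two null components of \<open>T\<close> and \<open>b e f\<close>, so the hypothesis says that neither component
vanishes.\<close>

lemma orthogonal_frame_trivial:
  assumes T: "T \<in> V" "b T T \<noteq> (\<eta> T)\<^sup>2" and R: "R \<in> V" "\<eta> R = 0" "b R T = 0" "b R (\<phi> T) = 0"
  shows "R = 0"
proof -
  obtain e f where ef: "e \<in> V" "f \<in> V" "\<eta> e = 0" "\<eta> f = 0" "\<phi> e = e" "\<phi> f = - f"
    "b e e = 0" "b f f = 0" "b e f \<noteq> 0"
    and dec: "\<And>v. v \<in> V \<Longrightarrow> \<exists>x y. v = x *\<^sub>R e + y *\<^sub>R f + \<eta> v *\<^sub>R \<xi>"
    using eigenframe by metis
  note [simp] = ef(1-8) b_xi b_xi_left
  have fe [simp]: "b f e = b e f" using b_sym[of f e] by simp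
  obtain x y where Teq: "T = x *\<^sub>R e + y *\<^sub>R f + \<eta> T *\<^sub>R \<xi>" using dec T by blast
  obtain p q where "R = p *\<^sub>R e + q *\<^sub>R f + \<eta> R *\<^sub>R \<xi>" using dec R by blast
  then have Req: "R = p *\<^sub>R e + q *\<^sub>R f" using R by simp
  define c where "c = \<eta> T"
  have Tc: "T = x *\<^sub>R e + y *\<^sub>R f + c *\<^sub>R \<xi>" using Teq c_def by simp
  have phiT: "\<phi> T = x *\<^sub>R e - y *\<^sub>R f" unfolding Tc by simp
  have "b T T = 2 * x * y * b e f + c\<^sup>2"
    unfolding Tc by (simp add: algebra_simps power2_eq_square)
  then have xy: "x \<noteq> 0" "y \<noteq> 0" using T c_def by auto
  have "(p * y + q * x) * b e f = 0" using R(3) unfolding Req Tc by (simp add: algebra_simps)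
  moreover have "(q * x - p * y) * b e f = 0" using R(4) unfolding Req phiT by (simp add: algebra_simps)
  ultimately have "p * y + q * x = 0" "q * x - p * y = 0" using ef(9) by simp_all
  then have "p * y = 0" "q * x = 0" by linarith+
  then show ?thesis using xy Req by simp
qed

text \<open>The hypotheses make \<open>L\<close> diagonal in the eigenframe: \<open>L e\<close> is orthogonal to \<open>\<xi>\<close> and to \<open>e\<close>, hence a
multiple of \<open>e\<close>, and likewise for \<open>f\<close>.  With eigenvalues \<open>k\<close> and \<open>l\<close> on \<open>e\<close> and \<open>f\<close>, the operators \<open>L\<close>
and \<open>\<phi> L\<close> have traces \<open>k + l\<close> and \<open>k - l\<close>.\<close>

lemma normal_operator_form:
  assumes L: "linear_between V V L" and Lxi: "L \<xi> = 0"
    and Leta: "\<And>v. v \<in> V \<Longrightarrow> \<eta> (L v) = 0"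
    and Lnull: "\<And>v. v \<in> V \<Longrightarrow> \<eta> v = 0 \<Longrightarrow> \<phi> v = v \<or> \<phi> v = - v \<Longrightarrow> b (L v) v = 0"
    and v: "v \<in> V"
  shows "L v = (trace_on V L / 2) *\<^sub>R (v - \<eta> v *\<^sub>R \<xi>) + (trace_on V (\<lambda>u. \<phi> (L u)) / 2) *\<^sub>R \<phi> v"
proof -
  obtain e f where ef: "e \<in> V" "f \<in> V" "\<eta> e = 0" "\<eta> f = 0" "\<phi> e = e" "\<phi> f = - f"
    "b e e = 0" "b f f = 0" "b e f \<noteq> 0" "e \<noteq> 0" "f \<noteq> 0"
    and dec: "\<And>v. v \<in> V \<Longrightarrow> \<exists>x y. v = x *\<^sub>R e + y *\<^sub>R f + \<eta> v *\<^sub>R \<xi>"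
    using eigenframe by metis
  note [simp] = ef(1-8) b_xi b_xi_left
  have fe [simp]: "b f e = b e f" using b_sym[of f e] by simp
  have LV [simp]: "L u \<in> V" and Ladd: "w \<in> V \<Longrightarrow> L (u + w) = L u + L w"
    and Lscale: "L (a *\<^sub>R u) = a *\<^sub>R L u" if "u \<in> V" for u w a
    using L that unfolding linear_between_def by blast+
  have ex_x: "\<exists>x. L e = x *\<^sub>R e"
  proof -
    obtain x y where xy: "L e = x *\<^sub>R e + y *\<^sub>R f" using dec[of "L e"] Leta[of e] by auto
    have "y * b e f = 0" using Lnull[of e] unfolding xy by simp
    then show ?thesis using xy ef(9) by auto
  qed
  have ex_y: "\<exists>x. L f = x *\<^sub>R f"
  proof -
    obtain x y where xy: "L f = x *\<^sub>R e + y *\<^sub>R f" using dec[of "L f"] Leta[of f] by auto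
    have "x * b e f = 0" using Lnull[of f] unfolding xy by simp
    then show ?thesis using xy ef(9) by auto
  qed
  obtain k where k: "L e = k *\<^sub>R e" using ex_x by blast
  obtain l where l: "L f = l *\<^sub>R f" using ex_y by blast
  have f_notin: "f \<notin> span {\<xi>}"
  proof
    assume "f \<in> span {\<xi>}"
    then obtain t where t: "f = t *\<^sub>R \<xi>" by (auto simp: span_singleton)
    have "\<eta> (t *\<^sub>R \<xi>) = 0" using ef(4) unfolding t .
    then show False using t ef(11) by simp
  qed
  have e_notin: "e \<notin> span {f, \<xi>}"
  proof
    assume "e \<in> span {f, \<xi>}"
    then obtain t s where "e - t *\<^sub>R f = s *\<^sub>R \<xi>" by (auto simp: span_insert span_singleton)
    then have ts: "e = t *\<^sub>R f + s *\<^sub>R \<xi>" by (simp add: algebra_simps)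
    have "\<eta> (t *\<^sub>R f + s *\<^sub>R \<xi>) = 0" using ef(3) unfolding ts .
    then have e_eq: "e = t *\<^sub>R f" using ts by simp
    have "\<phi> (t *\<^sub>R f) = t *\<^sub>R f" using ef(5) unfolding e_eq .
    then have "t *\<^sub>R f = 0" by (simp add: neg_eq_iff_add_eq_0 scaleR_2[symmetric])
    then show False using e_eq ef(10) by simp
  qed
  let ?C = "{e, f, \<xi>}"
  have ind: "independent ?C"
    using f_notin e_notin xi_nonzero by (intro independent_insertI) (auto simp: independent_empty)
  have dist: "e \<noteq> f" "e \<noteq> \<xi>" "f \<noteq> \<xi>"
    using f_notin e_notin span_base[of f "{f, \<xi>}"] span_base[of \<xi> "{f, \<xi>}"] span_base[of \<xi> "{\<xi>}"] by auto
  have sp: "span ?C = V"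
  proof
    show "span ?C \<subseteq> V" by (rule span_minimal) (use V in auto)
    show "V \<subseteq> span ?C"
    proof
      fix v assume "v \<in> V"
      then obtain x y where "v = x *\<^sub>R e + y *\<^sub>R f + \<eta> v *\<^sub>R \<xi>" using dec by blast
      moreover have "x *\<^sub>R e + y *\<^sub>R f + \<eta> v *\<^sub>R \<xi> \<in> span ?C"
        by (intro span_add span_scale span_base) auto
      ultimately show "v \<in> span ?C" by simp
    qed
  qed
  have rep: "representation ?C (t *\<^sub>R w) w = t" if "w \<in> ?C" for t w
    using that by (simp add: representation_scale[OF ind span_base] representation_basis[OF ind])
  have phiL: "linear_between V V (\<lambda>u. \<phi> (L u))"
    unfolding linear_between_def by (auto simp: Ladd Lscale)
  have tr: "trace_on V L = k + l"
    unfolding trace_on_eq[OF _ ind sp L, simplified]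
    using dist rep[of e k] rep[of f l] by (simp add: k l Lxi representation_zero)
  have "\<phi> (L f) = (- l) *\<^sub>R f" by (simp add: l)
  then have tr': "trace_on V (\<lambda>u. \<phi> (L u)) = k - l"
    unfolding trace_on_eq[OF _ ind sp phiL, simplified]
    using dist rep[of e k] rep[of f "- l"]
    by (simp add: k Lxi representation_zero)
  obtain x y where xy: "v = x *\<^sub>R e + y *\<^sub>R f + \<eta> v *\<^sub>R \<xi>" using dec v by blast
  define z where "z = \<eta> v"
  have vz: "v = x *\<^sub>R e + y *\<^sub>R f + z *\<^sub>R \<xi>" using xy z_def by simp
  have "L v = (x * k) *\<^sub>R e + (y * l) *\<^sub>R f" unfolding vz by (simp add: Ladd Lscale k l Lxi)
  moreover have "v - \<eta> v *\<^sub>R \<xi> = x *\<^sub>R e + y *\<^sub>R f" unfolding diff_eq_eq by (rule xy)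
  moreover have "\<phi> v = x *\<^sub>R e - y *\<^sub>R f" unfolding vz by simp
  moreover have "x * k = (k + l) / 2 * x + (k - l) / 2 * x" "y * l = (k + l) / 2 * y - (k - l) / 2 * y"
    by (simp_all add: field_simps)
  ultimately show ?thesis unfolding tr tr'
    by (simp only: scaleR_add_right scaleR_diff_right scaleR_scaleR scaleR_add_left scaleR_diff_left) simp
qed

lemma b_phi_phi: "v \<in> V \<Longrightarrow> b (\<phi> v) (\<phi> v) = (\<eta> v)\<^sup>2 - b v v"
  using compatible[of v v] by (simp add: power2_eq_square)

text \<open>Expand \<open>N\<close> in \<open>\<xi>\<close>, \<open>T\<close>, \<open>\<phi> T\<close>.  Being orthogonal to \<open>T\<close>, it is a combination
\<open>a (\<xi> - \<epsilon> c T) + d \<phi> T\<close> with \<open>\<epsilon> = b T T\<close>, and \<open>b N N = (a\<^sup>2 - \<epsilon> d\<^sup>2)(1 - \<epsilon> c\<^sup>2)\<close>.  For \<open>\<epsilon> = - 1\<close> this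
vanishes only for \<open>N = 0\<close>; for \<open>\<epsilon> = 1\<close> it gives \<open>d = \<plusminus> a\<close>.\<close>

lemma null_vector_normal_form:
  assumes T [simp]: "T \<in> V" and N [simp]: "N \<in> V" and eps: "b T T = 1 \<or> b T T = - 1"
    and c: "\<eta> T = c" "c\<^sup>2 \<noteq> 1"
    and NT: "b N T = 0" and NN: "b N N = 0" and N0: "N \<noteq> 0"
  shows "b T T = 1" "\<eta> N \<noteq> 0"
    "\<exists>\<sigma>\<in>{1, -1}. N = (\<eta> N / (1 - c\<^sup>2)) *\<^sub>R (\<xi> - c *\<^sub>R T + \<sigma> *\<^sub>R \<phi> T)"
proof -
  define \<epsilon> where "\<epsilon> = b T T"
  have TT [simp]: "b T T = \<epsilon>" by (simp add: \<epsilon>_def)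
  have ee: "\<epsilon> * \<epsilon> = 1" using eps by auto
  note [simp] = NT c(1) b_xi b_xi_left b_phi_self
  have ne: "1 - \<epsilon> * c\<^sup>2 \<noteq> 0"
  proof (cases "\<epsilon> = 1")
    case False
    then have "\<epsilon> = - 1" using eps by auto
    moreover have "1 + c\<^sup>2 > 0" by (rule add_pos_nonneg) simp_all
    ultimately show ?thesis by simp
  qed (use c in simp)
  have PP [simp]: "b (\<phi> T) (\<phi> T) = - \<epsilon> * (1 - \<epsilon> * c\<^sup>2)"
  proof -
    have "\<epsilon> * (\<epsilon> * c\<^sup>2) = c\<^sup>2" using ee by (metis mult.assoc mult_1)
    then show ?thesis by (simp add: b_phi_phi right_diff_distrib)
  qed
  \<comment> \<open>The coefficients are forced by the products of \<open>N\<close> with \<open>\<xi>\<close> and \<open>\<phi> T\<close>.\<close>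
  define a where "a = \<eta> N / (1 - \<epsilon> * c\<^sup>2)"
  define d where "d = - \<epsilon> * b N (\<phi> T) / (1 - \<epsilon> * c\<^sup>2)"
  have etaN: "\<eta> N = a * (1 - \<epsilon> * c\<^sup>2)" using ne by (simp add: a_def)
  have Nphi: "b N (\<phi> T) = d * (- \<epsilon> * (1 - \<epsilon> * c\<^sup>2))"
  proof -
    have "d * (1 - \<epsilon> * c\<^sup>2) = - \<epsilon> * b N (\<phi> T)" using ne by (simp add: d_def)
    then have "\<epsilon> * (d * (1 - \<epsilon> * c\<^sup>2)) = - (\<epsilon> * \<epsilon>) * b N (\<phi> T)" by simp
    then show ?thesis using ee by (simp add: mult_ac)
  qed
  have "N - (a *\<^sub>R (\<xi> - (\<epsilon> * c) *\<^sub>R T) + d *\<^sub>R \<phi> T) = 0"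
  proof (rule orthogonal_frame_trivial[of T])
    show "b T T \<noteq> (\<eta> T)\<^sup>2"
    proof
      assume "b T T = (\<eta> T)\<^sup>2"
      then have "1 - \<epsilon> * c\<^sup>2 = 1 - \<epsilon> * \<epsilon>" by simp
      then show False using ne ee by simp
    qed
    show "\<eta> (N - (a *\<^sub>R (\<xi> - (\<epsilon> * c) *\<^sub>R T) + d *\<^sub>R \<phi> T)) = 0"
      by (simp add: etaN power2_eq_square algebra_simps)
    show "b (N - (a *\<^sub>R (\<xi> - (\<epsilon> * c) *\<^sub>R T) + d *\<^sub>R \<phi> T)) T = 0"
    proof -
      have "\<epsilon> * c * \<epsilon> = c" using ee by (metis mult.commute mult.left_commute mult_1_right)
      then show ?thesis by simp
    qed
    show "b (N - (a *\<^sub>R (\<xi> - (\<epsilon> * c) *\<^sub>R T) + d *\<^sub>R \<phi> T)) (\<phi> T) = 0"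
      by (simp add: Nphi)
  qed simp_all
  then have Neq: "N = a *\<^sub>R (\<xi> - (\<epsilon> * c) *\<^sub>R T) + d *\<^sub>R \<phi> T" by simp
  have "b N N = b N (a *\<^sub>R (\<xi> - (\<epsilon> * c) *\<^sub>R T) + d *\<^sub>R \<phi> T)" using Neq by simp
  also have "\<dots> = a * \<eta> N + d * b N (\<phi> T)" by simp
  also have "\<dots> = (a\<^sup>2 - \<epsilon> * d\<^sup>2) * (1 - \<epsilon> * c\<^sup>2)"
    unfolding etaN Nphi by (simp add: power2_eq_square algebra_simps)
  finally have ad: "a\<^sup>2 = \<epsilon> * d\<^sup>2" using NN ne by simp
  have "\<epsilon> = 1"
  proof (rule ccontr)
    assume "\<epsilon> \<noteq> 1"
    then have "\<epsilon> = - 1" using eps by auto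
    then have "a\<^sup>2 + d\<^sup>2 = 0" using ad by simp
    then have "a = 0" "d = 0" by (simp_all add: sum_power2_eq_zero_iff)
    then show False using Neq N0 by simp
  qed
  then show "b T T = 1" by simp
  have ne1: "1 - c\<^sup>2 \<noteq> 0" using c by simp
  have aeq: "a = \<eta> N / (1 - c\<^sup>2)" using \<open>\<epsilon> = 1\<close> by (simp add: a_def)
  have "d = a \<or> d = - a" using ad \<open>\<epsilon> = 1\<close> by (auto simp: power2_eq_iff)
  then obtain \<sigma> where \<sigma>: "\<sigma> \<in> {1, -1}" "d = a * \<sigma>" by (metis insertCI mult.right_neutral mult_minus1_right)
  have N_form: "N = a *\<^sub>R (\<xi> - c *\<^sub>R T + \<sigma> *\<^sub>R \<phi> T)"
    using Neq \<open>\<epsilon> = 1\<close> \<sigma>(2) by (simp add: scaleR_add_right)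
  then show "\<exists>\<sigma>\<in>{1, -1}. N = (\<eta> N / (1 - c\<^sup>2)) *\<^sub>R (\<xi> - c *\<^sub>R T + \<sigma> *\<^sub>R \<phi> T)"
    using \<sigma>(1) unfolding aeq by blast
  show "\<eta> N \<noteq> 0" using N_form N0 unfolding aeq by auto
qed

text \<open>The Cartan frame at a point.  The null vectors orthogonal to \<open>T\<close> form two lines, and \<open>W\<close> lies on the
one that does not contain \<open>N\<close>: a competitor has the normal form above, and the same sign as \<open>N\<close> would make its product
with \<open>N\<close> vanish.\<close>

lemma null_frame:
  assumes T [simp]: "T \<in> V" and TT [simp]: "b T T = 1" and c [simp]: "\<eta> T = c" and c1: "c\<^sup>2 \<noteq> 1"
    and a: "a \<noteq> 0" and s: "\<sigma> \<in> {1, -1 :: real}"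
  defines "N \<equiv> - a *\<^sub>R (\<xi> - c *\<^sub>R T + \<sigma> *\<^sub>R \<phi> T)"
    and "W \<equiv> (- 1 / (2 * a * (1 - c\<^sup>2))) *\<^sub>R (\<xi> - c *\<^sub>R T - \<sigma> *\<^sub>R \<phi> T)"
  shows null_frame_products: "b N (\<phi> T) = \<sigma> * a * (1 - c\<^sup>2)" "b N W = 1" "b W W = 0" "b T W = 0"
    and null_frame_unique: "(THE w. w \<in> V \<and> b N w = 1 \<and> b w w = 0 \<and> b T w = 0) = W"
    and null_frame_expansion: "X \<in> V \<Longrightarrow> X = b X T *\<^sub>R T + b X W *\<^sub>R N + b X N *\<^sub>R W"
proof -
  note [simp] = b_xi b_xi_left b_phi_self
  have ss [simp]: "\<sigma> * \<sigma> = 1" "\<sigma> * (\<sigma> * x) = x" for x using s by auto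
  have ne: "1 - c\<^sup>2 \<noteq> 0" using c1 by simp
  have cc: "c * c = c\<^sup>2" by (simp add: power2_eq_square)
  have PP [simp]: "b (\<phi> T) (\<phi> T) = c\<^sup>2 - 1" by (simp add: b_phi_phi)
  define P where "P = \<xi> - c *\<^sub>R T + \<sigma> *\<^sub>R \<phi> T"
  define Q where "Q = \<xi> - c *\<^sub>R T - \<sigma> *\<^sub>R \<phi> T"
  define w0 where "w0 = - 1 / (2 * a * (1 - c\<^sup>2))"
  have PQ [simp]: "P \<in> V" "Q \<in> V" by (simp_all add: P_def Q_def)
  have NW: "N = (- a) *\<^sub>R P" "W = w0 *\<^sub>R Q" unfolding N_def W_def P_def Q_def w0_def by simp_all
  have NWV [simp]: "N \<in> V" "W \<in> V" unfolding NW by simp_all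
  have prods: "b P T = 0" "b T P = 0" "b Q T = 0" "b T Q = 0" "b P (\<phi> T) = - \<sigma> * (1 - c\<^sup>2)"
    "b Q Q = 0" "b P Q = 2 * (1 - c\<^sup>2)"
    unfolding P_def Q_def by (simp_all add: cc algebra_simps)
  show "b N (\<phi> T) = \<sigma> * a * (1 - c\<^sup>2)" unfolding NW by (simp add: prods)
  show bNW: "b N W = 1" unfolding NW by (simp add: prods w0_def a c1)
  show bWW: "b W W = 0" unfolding NW by (simp add: prods)
  show bTW: "b T W = 0" unfolding NW by (simp add: prods)
  show "(THE w. w \<in> V \<and> b N w = 1 \<and> b w w = 0 \<and> b T w = 0) = W"
  proof (rule the_equality)
    show "W \<in> V \<and> b N W = 1 \<and> b W W = 0 \<and> b T W = 0" using bNW bWW bTW by simp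
    fix w assume "w \<in> V \<and> b N w = 1 \<and> b w w = 0 \<and> b T w = 0"
    then have w [simp]: "w \<in> V" and w': "b N w = 1" "b w w = 0" "b T w = 0" by auto
    have "w \<noteq> 0" using w' by auto
    moreover have "b w T = 0" using w'(3) b_sym[of w T] by simp
    ultimately have "\<exists>\<rho>\<in>{1, -1}. w = (\<eta> w / (1 - c\<^sup>2)) *\<^sub>R (\<xi> - c *\<^sub>R T + \<rho> *\<^sub>R \<phi> T)"
      using null_vector_normal_form(3)[OF T w _ c c1 _ w'(2)] by simp
    then obtain \<rho> where \<rho>: "\<rho> \<in> {1, -1}"
      "w = (\<eta> w / (1 - c\<^sup>2)) *\<^sub>R (\<xi> - c *\<^sub>R T + \<rho> *\<^sub>R \<phi> T)"
      by (elim bexE) (rule that)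
    define h where "h = \<eta> w / (1 - c\<^sup>2)"
    define S where "S = \<xi> - c *\<^sub>R T + \<rho> *\<^sub>R \<phi> T"
    have S [simp]: "S \<in> V" by (simp add: S_def)
    have weq: "w = h *\<^sub>R S" using \<rho>(2) unfolding h_def S_def .
    have PS: "b P S = (1 - c\<^sup>2) * (1 - \<sigma> * \<rho>)"
      unfolding P_def S_def by (simp add: cc algebra_simps)
    have "b N w = - a * h * b P S" unfolding NW weq by simp
    then have prod: "- a * h * ((1 - c\<^sup>2) * (1 - \<sigma> * \<rho>)) = 1"
      using w'(1) unfolding PS by simp
    have "\<rho> \<noteq> \<sigma>" using prod by auto
    then have \<rho>': "\<rho> = - \<sigma>" using \<rho>(1) s by auto
    have "- a * h * ((1 - c\<^sup>2) * 2) = 1" using prod unfolding \<rho>' by simp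
    then have "h = w0" using a ne unfolding w0_def by (simp add: field_simps)
    then show "w = W" unfolding weq S_def NW Q_def \<rho>' by simp
  qed
  show "X = b X T *\<^sub>R T + b X W *\<^sub>R N + b X N *\<^sub>R W" if X [simp]: "X \<in> V"
  proof -
    define R where "R = X - (b X T *\<^sub>R T + b X W *\<^sub>R N + b X N *\<^sub>R W)"
    have R [simp]: "R \<in> V" by (simp add: R_def)
    have bNN: "b N N = 0" unfolding NW P_def by (simp add: cc algebra_simps)
    have bNT: "b N T = 0" "b W T = 0" unfolding NW by (simp_all add: prods)
    have bWN: "b W N = 1" using bNW b_sym[of W N] by simp
    have RT: "b R T = 0" "b R N = 0" "b R W = 0"
      unfolding R_def by (simp_all add: bNT bNN bWN bNW bWW bTW b_sym[of T N])
    have "w0 \<noteq> 0" using a ne by (simp add: w0_def)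
    then have "b R P = 0" "b R Q = 0" using RT a unfolding NW by simp_all
    then have "\<eta> R + \<sigma> * b R (\<phi> T) = 0" "\<eta> R - \<sigma> * b R (\<phi> T) = 0"
      unfolding P_def Q_def by (simp_all add: RT)
    then have "\<eta> R = 0" "\<sigma> * b R (\<phi> T) = 0" by linarith+
    then have "R = 0" using orthogonal_frame_trivial[of T R] RT(1) c1 s by auto
    then show ?thesis by (simp add: R_def)
  qed
qed

end

section \<open>The covariant derivative of the structure vector field\<close>

locale normal_paracontact_manifold = pseudo_riemannian_manifold A g 2 1
  for A :: "('m::{t2_space, second_countable_topology}, 'e::euclidean_space) chart set"
    and g :: "'m \<Rightarrow> ('m, 'e) tvec \<Rightarrow> ('m, 'e) tvec \<Rightarrow> real" +
  fixes \<phi> :: "'m \<Rightarrow> ('m, 'e) tvec \<Rightarrow> ('m, 'e) tvec"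
    and \<xi> :: "'m \<Rightarrow> ('m, 'e) tvec"
    and \<eta> :: "'m \<Rightarrow> ('m, 'e) tvec \<Rightarrow> real"
  assumes paracontact: "almost_paracontact_metric 1 A \<phi> \<xi> \<eta> g"
    and normal: "normal_structure A \<phi> \<xi> \<eta>"
begin

lemma tangent_paracontact:
  assumes p: "p \<in> carrier_of A"
  shows "paracontact_vector_space (tangent_space A p) (\<phi> p) (\<xi> p) (\<eta> p) (g p)"
proof
  show "subspace (tangent_space A p)" using subspace_tangent_space[OF p] .
  show "\<xi> p \<in> tangent_space A p"
    using p paracontact unfolding almost_paracontact_metric_def almost_paracontact_def vector_field_on_def by blast
  show "linear_between (tangent_space A p) (tangent_space A p) (\<phi> p)"
    using p paracontact unfolding almost_paracontact_metric_def almost_paracontact_def endomorphism_field_def by blast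
  show "linear_between (tangent_space A p) UNIV (\<eta> p)"
    using p paracontact unfolding almost_paracontact_metric_def almost_paracontact_def one_form_def by blast
  show "linear_between (tangent_space A p) UNIV (g p u)" if "u \<in> tangent_space A p" for u
    using metric_linear[OF p that] by blast
  show "g p u v = g p v u" if "u \<in> tangent_space A p" "v \<in> tangent_space A p" for u v
    using metric_sym[OF p that] .
  show "u = 0" if "u \<in> tangent_space A p" "\<And>v. v \<in> tangent_space A p \<Longrightarrow> g p u v = 0" for u
    using metric_nondegenerate[OF p that] .
  show "\<eta> p (\<xi> p) = 1"
    using p paracontact unfolding almost_paracontact_metric_def almost_paracontact_def by blast
  show "\<phi> p (\<phi> p v) = v - \<eta> p v *\<^sub>R \<xi> p" if "v \<in> tangent_space A p" for v
    using p that paracontact unfolding almost_paracontact_metric_def almost_paracontact_def by blast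
  show "dim {v \<in> tangent_space A p. \<eta> p v = 0 \<and> \<phi> p v = v} = 1"
    and "dim {v \<in> tangent_space A p. \<eta> p v = 0 \<and> \<phi> p v = - v} = 1"
    using p paracontact unfolding almost_paracontact_metric_def almost_paracontact_def by blast+
  show "g p (\<phi> p u) (\<phi> p v) = - g p u v + \<eta> p u * \<eta> p v"
    if "u \<in> tangent_space A p" "v \<in> tangent_space A p" for u v
    using p that paracontact unfolding almost_paracontact_metric_def by blast
qed

lemma xi_smooth:
  assumes "c \<in> A"
  shows "smooth_on (coords c ` dom_of c) (\<lambda>x. \<xi> (coords_inv c x) c)"
proof -
  have "dom_of c \<inter> carrier_of A = dom_of c" using assms unfolding carrier_of_def by auto
  then show ?thesis
    using assms paracontact unfolding almost_paracontact_metric_def almost_paracontact_def vector_field_on_def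
    by metis
qed

lemma phi_smooth:
  assumes "c \<in> A"
  shows "smooth_on (coords c ` dom_of c) (\<lambda>x. \<phi> (coords_inv c x) (tangent_of A c (coords_inv c x) u) c)"
  using assms paracontact unfolding almost_paracontact_metric_def almost_paracontact_def endomorphism_field_def
  by blast

lemma xi_field_restricted:
  assumes "open S" "S \<subseteq> carrier_of A"
  shows "vector_field_on A S \<xi>"
  unfolding vector_field_on_def
proof (intro conjI ballI)
  show "\<xi> p \<in> tangent_space A p" if "p \<in> S" for p
    using paracontact_vector_space.xi[OF tangent_paracontact] assms that by blast
  show "smooth_on (coords c ` (dom_of c \<inter> S)) (\<lambda>x. \<xi> (coords_inv c x) c)" if "c \<in> A" for c
    by (rule smooth_on_subset[OF open_image_dom[OF that] open_image_coords[OF that assms(1)] _ xi_smooth[OF that]])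
      auto
qed

text \<open>These are the hypotheses of \<open>normal_operator_form\<close> for \<open>L v = \<nabla>\<^bsub>v\<^esub>\<xi>\<close>.  In a chart let \<open>Z\<close> be the
components of \<open>\<xi>\<close>, and let \<open>F u\<close> be those of \<open>\<phi>\<close> applied to the coordinate field \<open>u\<close>.
Differentiating \<open>b(Z, Z) = 1\<close> gives \<open>L v \<bottom> \<xi>\<close>.  Normality for the coordinate field \<open>u\<close> and \<open>\<xi>\<close> splits:
its image under \<open>\<eta>\<close> gives \<open>b(u, L \<xi>) = 0\<close>, while its product with an eigenvector \<open>u\<close> of \<open>\<phi>\<close>,
combined with the derivative of \<open>b(F u, u) = 0\<close>, gives \<open>2 b(DZ u, u) + D\<^bsub>Z\<^esub>b(u, u) = 0\<close>.  The left-hand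
side is the value on \<open>(u, u)\<close> of the Lie derivative of \<open>g\<close> along \<open>\<xi>\<close>, which is \<open>2 g(L u, u)\<close>.\<close>

lemma
  assumes p: "p \<in> carrier_of A"
  shows eta_nabla_xi: "v \<in> tangent_space A p \<Longrightarrow> \<eta> p (nabla A g v \<xi> p) = 0"
    and nabla_xi_xi: "nabla A g (\<xi> p) \<xi> p = 0"
    and nabla_xi_null: "v \<in> tangent_space A p \<Longrightarrow> \<eta> p v = 0 \<Longrightarrow> \<phi> p v = v \<or> \<phi> p v = - v
          \<Longrightarrow> g p (nabla A g v \<xi> p) v = 0"
    and nabla_xi_linear: "linear_between (tangent_space A p) (tangent_space A p) (\<lambda>v. nabla A g v \<xi> p)"
proof -
  interpret P: paracontact_vector_space "tangent_space A p" "\<phi> p" "\<xi> p" "\<eta> p" "g p"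
    by (rule tangent_paracontact[OF p])
  define c where "c = chart_at A p"
  have c: "c \<in> A" "p \<in> dom_of c" using chart_at[OF p] unfolding c_def by auto
  define x where "x = coords c p"
  define b where "b = local_form A g c x"
  define \<Gamma> where "\<Gamma> = christoffel A g c p"
  define Z where "Z = (\<lambda>y. \<xi> (coords_inv c y) c)"
  define Z' where "Z' = frechet_derivative Z (at x)"
  let ?U = "coords c ` dom_of c"
  have U: "open ?U" "x \<in> ?U" using open_image_dom[OF c(1)] c(2) by (auto simp: x_def)
  note within = at_within_open[OF U(2,1)]
  have Zx: "Z x = \<xi> p c" using c by (simp add: Z_def x_def)
  have dZ: "(Z has_derivative Z') (at x)"
    unfolding Z_def Z'_def by (rule smooth_on_has_derivative[OF xi_smooth[OF c(1)] U])
  have linZ: "linear Z'" using has_derivative_linear[OF dZ] .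
  have bil: "bilinear b" unfolding b_def x_def using local_form_bilinear[OF c] .
  have bsym: "b u v = b v u" for u v unfolding b_def x_def by (rule local_form_sym[OF c])
  have \<Gamma>: "bilinear \<Gamma>" "\<And>u v. \<Gamma> u v = \<Gamma> v u" "\<And>u v w. metric_deriv c x u v w = b (\<Gamma> u v) w + b v (\<Gamma> u w)"
    unfolding \<Gamma>_def b_def x_def
    using christoffel_bilinear[OF c] christoffel_sym[OF c] metric_deriv_christoffel[OF c] by blast+
  define L where "L = (\<lambda>v. nabla A g v \<xi> p)"
  have L: "L v = tangent_of A c p (Z' (v c) + \<Gamma> (v c) (Z x))" for v
    unfolding Zx unfolding L_def nabla_def c_def[symmetric] Let_def Z'_def Z_def x_def \<Gamma>_def ..
  have Lc: "L v c = Z' (v c) + \<Gamma> (v c) (Z x)" for v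
    unfolding L using tangent_of_self[OF c] by simp
  have LV [simp]: "L v \<in> tangent_space A p" for v unfolding L by (rule tangent_of_in[OF c])
  have g_chart: "g p v w = b (v c) (w c)" if "v \<in> tangent_space A p" "w \<in> tangent_space A p" for v w
    unfolding b_def x_def by (rule metric_in_chart[OF c that])
  have eta_chart: "\<eta> p v = b (v c) (Z x)" if "v \<in> tangent_space A p" for v
    using g_chart[OF that P.xi] P.b_xi[OF that] Zx by simp
  have scale_apply: "(a *\<^sub>R v) c = a *\<^sub>R v c" for a and v :: "('m, 'e) tvec"
    by (simp add: scaleR_fun_def)
  have L_add: "L (v + w) = L v + L w" for v w
    unfolding L by (simp add: linear_add[OF linZ] bilinear_ladd[OF \<Gamma>(1)] tangent_of_add[OF c, symmetric] algebra_simps)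
  have L_scale: "L (a *\<^sub>R v) = a *\<^sub>R L v" for a v
    unfolding L scale_apply
    by (simp add: linear_scale[OF linZ] bilinear_lmul[OF \<Gamma>(1)] tangent_of_scaleR[OF c, symmetric] scaleR_add_right)
  show "linear_between (tangent_space A p) (tangent_space A p) (\<lambda>v. nabla A g v \<xi> p)"
    using LV L_add L_scale unfolding linear_between_def L_def by blast
  have unit: "b (Z' h + \<Gamma> h (Z x)) (Z x) = 0" for h
  proof -
    have "((\<lambda>y. local_form A g c y (Z y) (Z y)) has_derivative
      (\<lambda>h. metric_deriv c x h (Z x) (Z x) + b (Z' h) (Z x) + b (Z x) (Z' h))) (at x within ?U)"
      unfolding b_def x_def
      by (rule local_form_has_derivative[OF c, where X = "\<lambda>y. y"])
        (use U dZ in \<open>auto simp: x_def intro: has_derivative_at_withinI\<close>)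
    then have "((\<lambda>y. 1) has_derivative
      (\<lambda>h. metric_deriv c x h (Z x) (Z x) + b (Z' h) (Z x) + b (Z x) (Z' h))) (at x)"
      unfolding within
    proof (rule has_derivative_transform_within_open[OF _ U])
      fix y assume "y \<in> ?U"
      then obtain q where q: "q \<in> dom_of c" "y = coords c q" by auto
      have qc: "q \<in> carrier_of A" using dom_subset_carrier[OF c(1) q(1)] .
      interpret Q: paracontact_vector_space "tangent_space A q" "\<phi> q" "\<xi> q" "\<eta> q" "g q"
        by (rule tangent_paracontact[OF qc])
      show "local_form A g c y (Z y) (Z y) = 1"
        using metric_in_chart[OF c(1) q(1) Q.xi Q.xi] Q.b_xi[OF Q.xi] q c by (simp add: Z_def)
    qed
    from has_derivative_unique[OF this has_derivative_const]
    have "metric_deriv c x h (Z x) (Z x) + b (Z' h) (Z x) + b (Z x) (Z' h) = 0" by metis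
    then show ?thesis
      unfolding \<Gamma>(3) bilinear_ladd[OF bil] using bsym[of "Z x"] by simp
  qed
  then show "\<eta> p (nabla A g v \<xi> p) = 0" if "v \<in> tangent_space A p" for v
    using eta_chart[OF LV, of v] unfolding Lc by (simp add: L_def)
  define F where "F = (\<lambda>u y. \<phi> (coords_inv c y) (tangent_of A c (coords_inv c y) u) c)"
  define F' where "F' = (\<lambda>u. frechet_derivative (F u) (at x))"
  have dF: "(F u has_derivative F' u) (at x)" for u
    unfolding F_def F'_def by (rule smooth_on_has_derivative[OF phi_smooth[OF c(1)] U])
  have Fx: "F u x = \<phi> p (tangent_of A c p u) c" for u using c by (simp add: F_def x_def)
  have cU: "coords_inv c y \<in> dom_of c" if "y \<in> ?U" for y using that c by auto
  have normality: "\<phi> p (\<phi> p (tangent_of A c p (Z' u))) - \<phi> p (tangent_of A c p (Z' (F u x) - F' u (Z x)))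
      = (- (metric_deriv c x (Z x) u (Z x) + b u (Z' (Z x))) - b (Z' u) (Z x)) *\<^sub>R \<xi> p" for u
  proof -
    define X where "X = (\<lambda>q. tangent_of A c q u)"
    have X: "X p c = u" "X p = tangent_of A c p u" using tangent_of_self[OF c] by (simp_all add: X_def)
    have XV: "X p \<in> tangent_space A p" using X tangent_of_in[OF c] by simp
    have 0: "nijenhuis A \<phi> X \<xi> p - (2 * ext_deriv A \<eta> X \<xi> p) *\<^sub>R \<xi> p = 0"
    proof -
      have "open (dom_of c)" "dom_of c \<subseteq> carrier_of A"
        using open_dom[OF c(1)] dom_subset_carrier[OF c(1)] by auto
      then show ?thesis
        using normal smooth_coordinate_field[OF c(1), of u] xi_field_restricted[of "dom_of c"] c(2)
        unfolding normal_structure_def X_def by blast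
    qed
    have dX: "((\<lambda>y. X (coords_inv c y) c) has_derivative (\<lambda>_. 0)) (at x)"
      by (rule has_derivative_transform_within_open[OF has_derivative_const[of u] U])
        (use c cU tangent_of_self in \<open>auto simp: X_def\<close>)
    have phi_xi0: "\<phi> q (\<xi> q) = 0" if "q \<in> dom_of c" for q
      using paracontact_vector_space.phi_xi[OF tangent_paracontact] dom_subset_carrier[OF c(1) that] by blast
    have dphixi: "((\<lambda>y. \<phi> (coords_inv c y) (\<xi> (coords_inv c y)) c) has_derivative (\<lambda>_. 0)) (at x)"
      by (rule has_derivative_transform_within_open[OF has_derivative_const[of 0] U])
        (use cU phi_xi0 in auto)
    have dphiX: "((\<lambda>y. \<phi> (coords_inv c y) (X (coords_inv c y)) c) has_derivative F' u) (at x)"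
      using dF[of u] unfolding F_def X_def .
    note fr = frechet_derivative_at_eq[OF dX] frechet_derivative_at_eq[OF dphixi]
      frechet_derivative_at_eq[OF dphiX] Z'_def[unfolded Z_def, symmetric]
    have lb: "lie_bracket A X \<xi> p = tangent_of A c p (Z' u)"
      unfolding lie_bracket_def c_def[symmetric] Let_def x_def[symmetric] fr by (simp add: X(1))
    have lb1: "lie_bracket A (\<lambda>q. \<phi> q (X q)) (\<lambda>q. \<phi> q (\<xi> q)) p = 0"
      unfolding lie_bracket_def c_def[symmetric] Let_def x_def[symmetric] fr phi_xi0[OF c(2)]
      using linear_0[OF has_derivative_linear[OF dF]] tangent_of_zero[OF c] by simp
    have lb2: "lie_bracket A X (\<lambda>q. \<phi> q (\<xi> q)) p = 0"
      unfolding lie_bracket_def c_def[symmetric] Let_def x_def[symmetric] fr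
      using tangent_of_zero[OF c] by simp
    have lb3: "lie_bracket A (\<lambda>q. \<phi> q (X q)) \<xi> p = tangent_of A c p (Z' (F u x) - F' u (Z x))"
      unfolding lie_bracket_def c_def[symmetric] Let_def x_def[symmetric] fr by (simp add: X(2) Fx Zx)
    have d1: "dir_deriv A X (\<lambda>q. \<eta> q (\<xi> q)) p = 0"
    proof -
      have "((\<lambda>y. \<eta> (coords_inv c y) (\<xi> (coords_inv c y))) has_derivative (\<lambda>_. 0)) (at x)"
        by (rule has_derivative_transform_within_open[OF has_derivative_const[of 1] U])
          (metis cU dom_subset_carrier[OF c(1)] paracontact_vector_space.eta_xi tangent_paracontact)
      then show ?thesis
        unfolding dir_deriv_def c_def[symmetric] Let_def x_def[symmetric]
        by (simp add: frechet_derivative_at_eq)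
    qed
    have d2: "dir_deriv A \<xi> (\<lambda>q. \<eta> q (X q)) p = metric_deriv c x (Z x) u (Z x) + b u (Z' (Z x))"
    proof -
      have "((\<lambda>y. local_form A g c y u (Z y)) has_derivative
        (\<lambda>h. metric_deriv c x h u (Z x) + b 0 (Z x) + b u (Z' h))) (at x within ?U)"
        unfolding b_def x_def
        by (rule local_form_has_derivative[OF c, where X = "\<lambda>y. y" and V = "\<lambda>_. u" and V' = "\<lambda>_. 0"])
          (use U dZ in \<open>auto simp: x_def intro: has_derivative_at_withinI\<close>)
      then have "((\<lambda>y. \<eta> (coords_inv c y) (X (coords_inv c y))) has_derivative
        (\<lambda>h. metric_deriv c x h u (Z x) + b 0 (Z x) + b u (Z' h))) (at x)"
        unfolding within
      proof (rule has_derivative_transform_within_open[OF _ U])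
        fix y assume "y \<in> ?U"
        then obtain q where q: "q \<in> dom_of c" "y = coords c q" by auto
        have qc: "q \<in> carrier_of A" using dom_subset_carrier[OF c(1) q(1)] .
        interpret Q: paracontact_vector_space "tangent_space A q" "\<phi> q" "\<xi> q" "\<eta> q" "g q"
          by (rule tangent_paracontact[OF qc])
        show "local_form A g c y u (Z y) = \<eta> (coords_inv c y) (X (coords_inv c y))"
          using metric_in_chart[OF c(1) q(1) tangent_of_in[OF c(1) q(1)] Q.xi]
            Q.b_xi[OF tangent_of_in[OF c(1) q(1)]] q c tangent_of_self[OF c(1) q(1)]
          by (simp add: Z_def X_def)
      qed
      then show ?thesis
        unfolding dir_deriv_def c_def[symmetric] Let_def x_def[symmetric]
        by (simp add: frechet_derivative_at_eq Zx bilinear_lzero[OF bil])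
    qed
    have eb: "\<eta> p (tangent_of A c p (Z' u)) = b (Z' u) (Z x)"
      using eta_chart[OF tangent_of_in[OF c]] tangent_of_self[OF c] by simp
    have "2 * ((0 - (metric_deriv c x (Z x) u (Z x) + b u (Z' (Z x))) - b (Z' u) (Z x)) / 2)
      = - (metric_deriv c x (Z x) u (Z x) + b u (Z' (Z x))) - b (Z' u) (Z x)" by simp
    with 0 have "\<phi> p (\<phi> p (tangent_of A c p (Z' u))) + 0 - \<phi> p (tangent_of A c p (Z' (F u x) - F' u (Z x))) - \<phi> p 0
      - (- (metric_deriv c x (Z x) u (Z x) + b u (Z' (Z x))) - b (Z' u) (Z x)) *\<^sub>R \<xi> p = 0"
      unfolding nijenhuis_def ext_deriv_def lb lb1 lb2 lb3 d1 d2 eb by metis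
    then show ?thesis by (simp only: P.zero_simps add_0_right diff_zero right_minus_eq)
  qed
  have deta: "b u (Z' (Z x) + \<Gamma> (Z x) (Z x)) = 0" for u
  proof -
    have "\<eta> p (\<phi> p (\<phi> p (tangent_of A c p (Z' u))) - \<phi> p (tangent_of A c p (Z' (F u x) - F' u (Z x)))) = 0"
      using tangent_of_in[OF c] by simp
    then have "metric_deriv c x (Z x) u (Z x) + b u (Z' (Z x)) + b (Z' u) (Z x) = 0"
      unfolding normality by simp
    then show ?thesis
      using unit[of u] unfolding \<Gamma>(3) \<Gamma>(2)[of "Z x" u] by (simp add: bilinear_ladd[OF bil] bilinear_radd[OF bil])
  qed
  show "nabla A g (\<xi> p) \<xi> p = 0"
  proof -
    have "Z' (Z x) + \<Gamma> (Z x) (Z x) = 0"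
      by (rule local_form_nondegenerate[OF c]) (use deta bsym in \<open>simp add: b_def x_def\<close>)
    then show ?thesis using L[of "\<xi> p"] tangent_of_zero[OF c] unfolding L_def Zx by simp
  qed
  show "g p (nabla A g v \<xi> p) v = 0"
    if v: "v \<in> tangent_space A p" and ev: "\<eta> p v = 0" and pv: "\<phi> p v = v \<or> \<phi> p v = - v" for v
  proof -
    obtain \<sigma> :: real where \<sigma>: "\<phi> p v = \<sigma> *\<^sub>R v" "\<sigma> * \<sigma> = 1"
      using pv by (metis mult_1 mult_minus1 minus_minus scaleR_minus1_left scaleR_one)
    define u where "u = v c"
    have tu: "tangent_of A c p u = v" unfolding u_def by (rule tangent_of_comp[OF v c])
    have Fu: "F u x = \<sigma> *\<^sub>R u" unfolding Fx tu \<sigma>(1) by (simp add: u_def scaleR_fun_def)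
    \<comment> \<open>the derivative along \<open>\<xi>\<close> of \<open>b(F u, u) = 0\<close>\<close>
    have skew: "\<sigma> * metric_deriv c x (Z x) u u + b (F' u (Z x)) u = 0"
    proof -
      have "((\<lambda>y. local_form A g c y (F u y) u) has_derivative
        (\<lambda>h. metric_deriv c x h (F u x) u + b (F' u h) u + b (F u x) 0)) (at x within ?U)"
        unfolding b_def x_def
        by (rule local_form_has_derivative[OF c, where X = "\<lambda>y. y" and W = "\<lambda>_. u" and W' = "\<lambda>_. 0"])
          (use U dF in \<open>auto simp: x_def intro: has_derivative_at_withinI\<close>)
      then have "((\<lambda>y. 0) has_derivative
        (\<lambda>h. metric_deriv c x h (F u x) u + b (F' u h) u + b (F u x) 0)) (at x)"
        unfolding within
      proof (rule has_derivative_transform_within_open[OF _ U])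
        fix y assume "y \<in> ?U"
        then obtain q where q: "q \<in> dom_of c" "y = coords c q" by auto
        have qc: "q \<in> carrier_of A" using dom_subset_carrier[OF c(1) q(1)] .
        interpret Q: paracontact_vector_space "tangent_space A q" "\<phi> q" "\<xi> q" "\<eta> q" "g q"
          by (rule tangent_paracontact[OF qc])
        show "local_form A g c y (F u y) u = 0"
          using metric_in_chart[OF c(1) q(1) Q.V_closed(6) tangent_of_in[OF c(1) q(1)], of "tangent_of A c q u" u]
            Q.b_phi_self(2)[OF tangent_of_in[OF c(1) q(1)], of u] tangent_of_in[OF c(1) q(1)] q c
            tangent_of_self[OF c(1) q(1)]
          by (simp add: F_def)
      qed
      from has_derivative_unique[OF this has_derivative_const]
      have "metric_deriv c x (Z x) (F u x) u + b (F' u (Z x)) u + b (F u x) 0 = 0" by metis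
      moreover have "metric_deriv c x (Z x) (\<sigma> *\<^sub>R u) u = \<sigma> * metric_deriv c x (Z x) u u"
        using bilinear_lmul[OF metric_deriv_bilinear[OF c]] unfolding x_def by simp
      ultimately show ?thesis unfolding Fu by (simp add: bilinear_rzero[OF bil])
    qed
    have gb: "g p (tangent_of A c p w) v = b w u" for w
      using g_chart[OF tangent_of_in[OF c] v] tangent_of_self[OF c] by (simp add: u_def)
    have "g p (\<phi> p (\<phi> p (tangent_of A c p (Z' u))) - \<phi> p (tangent_of A c p (Z' (F u x) - F' u (Z x)))) v = 0"
      unfolding normality using P.b_linear_left(2)[OF P.xi v] P.b_xi_left[OF v] ev by simp
    then have "b (Z' u) u + \<sigma> * b (Z' (F u x) - F' u (Z x)) u = 0"
      using tangent_of_in[OF c] v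
      by (simp add: P.phi_skew \<sigma>(1) gb \<sigma>(2) mult.assoc[symmetric])
    then have "2 * b (Z' u) u - \<sigma> * b (F' u (Z x)) u = 0"
      unfolding Fu linear_scale[OF linZ] bilinear_lsub[OF bil] bilinear_lmul[OF bil]
      by (simp add: \<sigma>(2) right_diff_distrib mult.assoc[symmetric])
    moreover have "\<sigma> * (\<sigma> * metric_deriv c x (Z x) u u + b (F' u (Z x)) u) = 0" using skew by simp
    then have "metric_deriv c x (Z x) u u + \<sigma> * b (F' u (Z x)) u = 0"
      by (simp add: \<sigma>(2) distrib_left mult.assoc[symmetric])
    ultimately have "2 * b (Z' u) u + metric_deriv c x (Z x) u u = 0" by linarith
    then have "b (Z' u + \<Gamma> u (Z x)) u = 0"
      unfolding \<Gamma>(3) \<Gamma>(2)[of "Z x" u] bilinear_ladd[OF bil] using bsym[of u] by simp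
    then show ?thesis using g_chart[OF LV v, of v] unfolding Lc by (simp add: L_def u_def)
  qed
qed

theorem nabla_xi:
  assumes p: "p \<in> carrier_of A" and v: "v \<in> tangent_space A p"
  shows "nabla A g v \<xi> p = assoc_alpha A \<xi> g p *\<^sub>R (v - \<eta> p v *\<^sub>R \<xi> p) + assoc_beta A \<phi> \<xi> g p *\<^sub>R \<phi> p v"
proof -
  interpret P: paracontact_vector_space "tangent_space A p" "\<phi> p" "\<xi> p" "\<eta> p" "g p"
    by (rule tangent_paracontact[OF p])
  show ?thesis
    unfolding assoc_alpha_def assoc_beta_def
    by (rule P.normal_operator_form[OF nabla_xi_linear[OF p] nabla_xi_xi[OF p] eta_nabla_xi[OF p]
          nabla_xi_null[OF p] v])
qed

end

section \<open>Covariant derivatives along curves\<close>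

text \<open>Nonisolated points make the one-sided derivatives at end points of an interval unique, so that
\<^const>\<open>vector_derivative\<close> agrees with the derivative that occurs in \<^const>\<open>smooth_on\<close> and can be
iterated.\<close>

lemma smooth_on_real:
  fixes f :: "real \<Rightarrow> 'a::real_normed_vector"
  assumes f: "smooth_on J f" and nb: "\<forall>t\<in>J. at t within J \<noteq> bot"
  shows "t \<in> J \<Longrightarrow> (f has_vector_derivative vector_derivative f (at t within J)) (at t within J)"
    and "smooth_on J (\<lambda>t. vector_derivative f (at t within J))"
proof -
  have d: "f differentiable (at t within J)" if "t \<in> J" for t
    using f that unfolding smooth_on_def differentiable_on_def
    by (metis Ck_on.simps(2) differentiable_on_def)
  show hvd: "(f has_vector_derivative vector_derivative f (at t within J)) (at t within J)" if "t \<in> J" for t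
    using d[OF that] vector_derivative_works by blast
  have eq: "frechet_derivative f (at t within J) 1 = vector_derivative f (at t within J)" if t: "t \<in> J" for t
  proof -
    have D: "(f has_derivative frechet_derivative f (at t within J)) (at t within J)"
      using d[OF t] frechet_derivative_works by blast
    have "frechet_derivative f (at t within J) = (\<lambda>h. h *\<^sub>R frechet_derivative f (at t within J) 1)"
    proof
      fix h :: real
      show "frechet_derivative f (at t within J) h = h *\<^sub>R frechet_derivative f (at t within J) 1"
        using linear_scale[OF has_derivative_linear[OF D], of h 1] by simp
    qed
    then have "(f has_vector_derivative frechet_derivative f (at t within J) 1) (at t within J)"
      unfolding has_vector_derivative_def by (rule has_derivative_eq_rhs[OF D])
    then show ?thesis by (rule vector_derivative_within[OF nb[rule_format, OF t], symmetric])
  qed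
  have "Ck_on k J (\<lambda>t. vector_derivative f (at t within J))" for k
  proof -
    have "Ck_on (Suc k) J f" using f unfolding smooth_on_def by blast
    then have "Ck_on k J (\<lambda>t. frechet_derivative f (at t within J) 1)" by simp
    then show ?thesis by (rule Ck_on_cong[THEN iffD1, rotated]) (rule eq)
  qed
  then show "smooth_on J (\<lambda>t. vector_derivative f (at t within J))" unfolding smooth_on_def by blast
qed

locale pseudo_riemannian_curve = pseudo_riemannian_manifold A g r s
  for A :: "('m::{t2_space, second_countable_topology}, 'e::euclidean_space) chart set"
    and g :: "'m \<Rightarrow> ('m, 'e) tvec \<Rightarrow> ('m, 'e) tvec \<Rightarrow> real" and r s :: nat +
  fixes I :: "real set" and \<gamma> :: "real \<Rightarrow> 'm"
  assumes curve: "smooth_curve A I \<gamma>"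
begin

abbreviation T :: "real \<Rightarrow> ('m, 'e) tvec" where "T \<equiv> velocity A I \<gamma>"
abbreviation N :: "real \<Rightarrow> ('m, 'e) tvec" where "N \<equiv> cartan_N A g I \<gamma>"

definition times_in :: "'m set \<Rightarrow> real set" where "times_in S = {t \<in> I. \<gamma> t \<in> S}"

text \<open>Components of the velocity in a chart, and their ordinary derivative; the latter is not tensorial.\<close>

definition vel :: "('m, 'e) chart \<Rightarrow> real \<Rightarrow> 'e" where
  "vel c t = vector_derivative (\<lambda>s. coords c (\<gamma> s)) (at t within I)"

definition acc :: "('m, 'e) chart \<Rightarrow> real \<Rightarrow> 'e" where
  "acc c t = vector_derivative (vel c) (at t within I)"

lemma curve_in_carrier: "t \<in> I \<Longrightarrow> \<gamma> t \<in> carrier_of A"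
  using curve unfolding smooth_curve_def by blast

lemma interval_not_isolated:
  assumes "t \<in> I"
  shows "at t within I \<noteq> bot"
proof -
  have I: "connected I" "interior I \<noteq> {}"
    using curve unfolding smooth_curve_def by (auto simp: is_interval_connected)
  have "\<not> (\<exists>a. I = {a})" using I(2) by auto
  then have "t islimpt I" using connected_imp_perfect[OF I(1) assms] by blast
  then show ?thesis by (simp add: trivial_limit_within)
qed

text \<open>The times at which the curve lies in an open set are relatively open in \<open>I\<close>, so derivatives may be
computed while the curve stays in one chart.\<close>

lemma at_within_times_in:
  assumes "open S" "t \<in> times_in S"
  shows "at t within times_in S = at t within I"
proof -
  have "openin (top_of_set I) (I \<inter> \<gamma> -` S)"
    using continuous_openin_preimage_gen[of I \<gamma> S] curve assms(1) unfolding smooth_curve_def by blast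
  then obtain U where U: "open U" "I \<inter> \<gamma> -` S = I \<inter> U" by (auto simp: openin_open)
  have eq: "times_in S = I \<inter> U" using U(2) by (auto simp: times_in_def)
  show ?thesis
    by (rule at_within_nhd[of t U]) (use assms U(1) eq in auto)
qed

lemma times_in_chart_at: "t \<in> I \<Longrightarrow> t \<in> times_in (dom_of (chart_at A (\<gamma> t)))"
  using chart_at(2)[OF curve_in_carrier] by (simp add: times_in_def)

lemma smooth_along_chart:
  assumes c: "c \<in> A"
  shows "smooth_on (times_in (dom_of c)) (\<lambda>t. coords c (\<gamma> t))"
    and "smooth_on (times_in (dom_of c)) (vel c)" "smooth_on (times_in (dom_of c)) (acc c)"
    and "t \<in> times_in (dom_of c) \<Longrightarrow> ((\<lambda>t. coords c (\<gamma> t)) has_vector_derivative vel c t) (at t within I)"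
    and "t \<in> times_in (dom_of c) \<Longrightarrow> (vel c has_vector_derivative acc c t) (at t within I)"
    and "t \<in> times_in (dom_of c) \<Longrightarrow> acc c differentiable (at t within I)"
proof -
  let ?J = "times_in (dom_of c)"
  have w: "at t within ?J = at t within I" if "t \<in> ?J" for t
    using at_within_times_in[OF open_dom[OF c] that] .
  have nb: "\<forall>t\<in>?J. at t within ?J \<noteq> bot"
    using w interval_not_isolated by (auto simp: times_in_def)
  show 1: "smooth_on ?J (\<lambda>t. coords c (\<gamma> t))"
    using curve c unfolding smooth_curve_def times_in_def by blast
  note x = smooth_on_real[OF 1 nb]
  show 2: "smooth_on ?J (vel c)"
    by (rule smooth_on_cong[THEN iffD1, OF _ x(2)]) (simp add: vel_def w)
  note v = smooth_on_real[OF 2 nb]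
  show 3: "smooth_on ?J (acc c)"
    by (rule smooth_on_cong[THEN iffD1, OF _ v(2)]) (simp add: acc_def w)
  note a = smooth_on_real[OF 3 nb]
  show "((\<lambda>t. coords c (\<gamma> t)) has_vector_derivative vel c t) (at t within I)" if "t \<in> ?J"
    using x(1)[OF that] unfolding vel_def w[OF that] .
  show "(vel c has_vector_derivative acc c t) (at t within I)" if "t \<in> ?J"
    using v(1)[OF that] unfolding acc_def w[OF that] .
  show "acc c differentiable (at t within I)" if "t \<in> ?J"
    using a(1)[OF that] unfolding w[OF that] by (rule differentiableI_vector)
qed

lemma vel_change:
  assumes c: "c \<in> A" "c' \<in> A" and t: "t \<in> times_in (dom_of c)" "t \<in> times_in (dom_of c')"
  shows "vel c' t = transition_deriv c c' (\<gamma> t) (vel c t)"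
proof -
  have p: "\<gamma> t \<in> dom_of c" "\<gamma> t \<in> dom_of c'" "t \<in> I" using t by (auto simp: times_in_def)
  have w: "at t within times_in (dom_of c) = at t within I" using at_within_times_in[OF open_dom[OF c(1)] t(1)] .
  have "((\<lambda>s. coords c' (coords_inv c (coords c (\<gamma> s)))) has_vector_derivative
      transition_deriv c c' (\<gamma> t) (vel c t)) (at t within times_in (dom_of c))"
    using vector_derivative_diff_chain_within[OF smooth_along_chart(4)[OF c(1) t(1)]
        has_derivative_at_withinI[OF transition_has_derivative[OF c p(1,2)]]]
    unfolding w by (simp add: o_def)
  then have "((\<lambda>s. coords c' (\<gamma> s)) has_vector_derivative transition_deriv c c' (\<gamma> t) (vel c t))
      (at t within times_in (dom_of c))"
    by (rule has_vector_derivative_transform[OF t(1), rotated]) (use c in \<open>simp add: times_in_def\<close>)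
  then show ?thesis
    unfolding w vel_def[of c'] by (rule vector_derivative_within[OF interval_not_isolated[OF p(3)]])
qed

lemma velocity_in: "t \<in> I \<Longrightarrow> T t \<in> tangent_space A (\<gamma> t)"
  unfolding velocity_def Let_def using tangent_of_in chart_at curve_in_carrier by blast

lemma velocity_chart:
  assumes "c \<in> A" "t \<in> times_in (dom_of c)"
  shows "T t c = vel c t"
proof -
  have t: "t \<in> I" "\<gamma> t \<in> dom_of c" using assms by (auto simp: times_in_def)
  note c0 = chart_at[OF curve_in_carrier[OF t(1)]]
  show ?thesis
    unfolding velocity_def Let_def
    using vel_change[OF c0(1) assms(1) times_in_chart_at[OF t(1)] assms(2)] assms(1) t
    by (simp add: vel_def)
qed

text \<open>The derivative of \<open>D\<tau>(x(s)) x'(s)\<close>, where \<open>\<tau>\<close> is the transition map and \<open>x\<close> is the curve in the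
chart \<open>c\<close>.\<close>

lemma acc_change:
  assumes c: "c \<in> A" "c' \<in> A" and t: "t \<in> times_in (dom_of c)" "t \<in> times_in (dom_of c')"
  shows "acc c' t = second_transition_deriv c c' (coords c (\<gamma> t)) (vel c t) (vel c t)
      + transition_deriv c c' (\<gamma> t) (acc c t)"
proof -
  define p where "p = \<gamma> t"
  let ?tr = "\<lambda>z. coords c' (coords_inv c z)"
  define D where "D = (\<lambda>y i. frechet_derivative ?tr (at y) i)"
  define H where "H = second_transition_deriv c c' (coords c p)"
  let ?K = "times_in (dom_of c \<inter> dom_of c')"
  have p: "p \<in> dom_of c" "p \<in> dom_of c'" "t \<in> I" "t \<in> ?K" using t by (auto simp: times_in_def p_def)
  have w: "at t within ?K = at t within I"
    by (rule at_within_times_in) (use open_dom c p in auto)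
  have dH: "((\<lambda>y. D y i) has_derivative (\<lambda>u. H u i)) (at (coords c p))" for i
    unfolding D_def H_def by (rule transition_deriv_has_derivative[OF c p(1,2)])
  have H_lin: "linear (H u)" for u
    using has_derivative_linear[OF dH, of u] unfolding H_def second_transition_deriv_sym[OF c p(1,2), of _ u] .
  have Dx: "((\<lambda>s. D (coords c (\<gamma> s)) i) has_vector_derivative H (vel c t) i) (at t within ?K)" for i
    using vector_derivative_diff_chain_within[OF smooth_along_chart(4)[OF c(1) t(1)]
        has_derivative_at_withinI[OF dH[unfolded p_def]]]
    unfolding w by (simp add: o_def)
  have "((\<lambda>s. \<Sum>i\<in>Basis. (vel c s \<bullet> i) *\<^sub>R D (coords c (\<gamma> s)) i) has_vector_derivative
     (\<Sum>i\<in>Basis. (vel c t \<bullet> i) *\<^sub>R H (vel c t) i + (acc c t \<bullet> i) *\<^sub>R D (coords c (\<gamma> t)) i)) (at t within ?K)"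
  proof (intro has_vector_derivative_sum has_vector_derivative_scaleR Dx)
    fix i :: 'e
    show "((\<lambda>s. vel c s \<bullet> i) has_real_derivative acc c t \<bullet> i) (at t within ?K)"
      using bounded_linear.has_vector_derivative[OF bounded_linear_inner_left smooth_along_chart(5)[OF c(1) t(1)], of i]
      unfolding w has_real_derivative_iff_has_vector_derivative .
  qed
  also have "(\<Sum>i\<in>Basis. (vel c t \<bullet> i) *\<^sub>R H (vel c t) i + (acc c t \<bullet> i) *\<^sub>R D (coords c (\<gamma> t)) i)
      = H (vel c t) (vel c t) + transition_deriv c c' p (acc c t)"
  proof -
    have "D (coords c (\<gamma> t)) = transition_deriv c c' p" unfolding D_def transition_deriv_def p_def ..
    then show ?thesis
      using linear_euclidean_expansion[OF H_lin, of "vel c t" "vel c t"]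
        linear_euclidean_expansion[OF transition_deriv_linear[OF c p(1,2)], of "acc c t"]
      by (simp add: sum.distrib)
  qed
  finally have "(vel c' has_vector_derivative H (vel c t) (vel c t) + transition_deriv c c' p (acc c t)) (at t within ?K)"
  proof (rule has_vector_derivative_transform[OF p(4), rotated])
    fix s assume s: "s \<in> ?K"
    then have q: "\<gamma> s \<in> dom_of c" "\<gamma> s \<in> dom_of c'" "s \<in> times_in (dom_of c)" "s \<in> times_in (dom_of c')"
      by (auto simp: times_in_def)
    show "vel c' s = (\<Sum>i\<in>Basis. (vel c s \<bullet> i) *\<^sub>R D (coords c (\<gamma> s)) i)"
      unfolding vel_change[OF c q(3,4)] D_def transition_deriv_def[symmetric]
      by (rule linear_euclidean_expansion[OF transition_deriv_linear[OF c q(1,2)]])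
  qed
  then show ?thesis
    unfolding w acc_def[of c'] H_def p_def
    by (rule vector_derivative_within[OF interval_not_isolated[OF p(3)]])
qed

lemma cov_along_in: "t \<in> I \<Longrightarrow> cov_along A g I \<gamma> V t \<in> tangent_space A (\<gamma> t)"
  unfolding cov_along_def Let_def using tangent_of_in chart_at curve_in_carrier by blast

lemma cov_along_chart_at:
  assumes t: "t \<in> I" and V: "((\<lambda>s. V s (chart_at A (\<gamma> t))) has_vector_derivative V') (at t within I)"
  defines "c \<equiv> chart_at A (\<gamma> t)"
  shows "cov_along A g I \<gamma> V t c = V' + christoffel A g c (\<gamma> t) (vel c t) (V t c)"
proof -
  note c0 = chart_at[OF curve_in_carrier[OF t], folded c_def]
  show ?thesis
    unfolding cov_along_def Let_def c_def[symmetric] vector_derivative_within[OF interval_not_isolated[OF t] V[folded c_def]]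
      velocity_chart[OF c0(1) times_in_chart_at[OF t, folded c_def]]
    by (rule tangent_of_self[OF c0])
qed

lemma velocity_has_derivative:
  assumes "c \<in> A" "t \<in> times_in (dom_of c)"
  shows "((\<lambda>s. T s c) has_vector_derivative acc c t) (at t within I)"
proof -
  have w: "at t within times_in (dom_of c) = at t within I" using at_within_times_in[OF open_dom[OF assms(1)] assms(2)] .
  show ?thesis
    unfolding w[symmetric]
    by (rule has_vector_derivative_transform[OF assms(2) _ smooth_along_chart(5)[OF assms, folded w]])
      (rule velocity_chart[OF assms(1)])
qed

text \<open>The second derivatives of the transition map that occur in \<open>acc_change\<close> and in \<open>koszul_change\<close> are the
same, so the formula for \<open>g(N, w)\<close> in the chart chosen at \<open>\<gamma>(t)\<close> carries over to every other chart.\<close>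

lemma cartan_N_any_chart:
  assumes c: "c \<in> A" and t: "t \<in> times_in (dom_of c)"
  shows "local_form A g c (coords c (\<gamma> t)) (N t c) w =
    local_form A g c (coords c (\<gamma> t)) (acc c t) w + koszul c (coords c (\<gamma> t)) (vel c t) (vel c t) w"
proof -
  have tI: "t \<in> I" and p: "\<gamma> t \<in> dom_of c" using t by (auto simp: times_in_def)
  define c0 where "c0 = chart_at A (\<gamma> t)"
  note c0 = chart_at[OF curve_in_carrier[OF tI], folded c0_def]
  note t0 = times_in_chart_at[OF tI, folded c0_def]
  let ?\<tau> = "transition_deriv c c0 (\<gamma> t)"
  note lin = linear_add[OF transition_deriv_linear[OF c c0(1) p c0(2)]]
  have NT: "N t \<in> tangent_space A (\<gamma> t)" unfolding cartan_N_def by (rule cov_along_in[OF tI])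
  have "N t c0 = acc c0 t + christoffel A g c0 (\<gamma> t) (vel c0 t) (vel c0 t)"
    unfolding cartan_N_def c0_def
    using cov_along_chart_at[OF tI, of T, OF velocity_has_derivative[OF c0(1) t0, unfolded c0_def]]
      velocity_chart[OF c0(1) t0] unfolding c0_def by simp
  then have N0: "?\<tau> (N t c) = second_transition_deriv c c0 (coords c (\<gamma> t)) (vel c t) (vel c t)
      + ?\<tau> (acc c t) + christoffel A g c0 (\<gamma> t) (?\<tau> (vel c t)) (?\<tau> (vel c t))"
    using tangent_vector_change[OF NT c p c0] acc_change[OF c c0(1) t t0] vel_change[OF c c0(1) t t0] by simp
  show ?thesis
    unfolding local_form_change[OF c c0(1) p c0(2)] N0 bilinear_ladd[OF local_form_bilinear[OF c0]]
      christoffel_koszul[OF c0] koszul_change[OF c c0(1) p c0(2)]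
    by simp
qed

lemma metric_product_rule:
  assumes t: "t \<in> I" and VT: "\<And>s. s \<in> I \<Longrightarrow> V s \<in> tangent_space A (\<gamma> s)" "\<And>s. s \<in> I \<Longrightarrow> W s \<in> tangent_space A (\<gamma> s)"
    and dV: "(\<lambda>s. V s (chart_at A (\<gamma> t))) differentiable (at t within I)"
    and dW: "(\<lambda>s. W s (chart_at A (\<gamma> t))) differentiable (at t within I)"
  shows "((\<lambda>s. g (\<gamma> s) (V s) (W s)) has_real_derivative
    g (\<gamma> t) (cov_along A g I \<gamma> V t) (W t) + g (\<gamma> t) (V t) (cov_along A g I \<gamma> W t)) (at t within I)"
proof -
  define c where "c = chart_at A (\<gamma> t)"
  note c = chart_at[OF curve_in_carrier[OF t], folded c_def]
  note tc = times_in_chart_at[OF t, folded c_def]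
  define J where "J = times_in (dom_of c)"
  have w: "at t within J = at t within I" unfolding J_def using at_within_times_in[OF open_dom[OF c(1)] tc] .
  obtain V' where V': "((\<lambda>s. V s c) has_vector_derivative V') (at t within I)"
    using dV vector_derivative_works unfolding c_def by blast
  obtain W' where W': "((\<lambda>s. W s c) has_vector_derivative W') (at t within I)"
    using dW vector_derivative_works unfolding c_def by blast
  note x = smooth_along_chart(4)[OF c(1) tc]
  let ?b = "local_form A g c (coords c (\<gamma> t))" and ?\<Gamma> = "christoffel A g c (\<gamma> t)"
  have "((\<lambda>s. local_form A g c (coords c (\<gamma> s)) (V s c) (W s c)) has_derivative
     (\<lambda>h. metric_deriv c (coords c (\<gamma> t)) (h *\<^sub>R vel c t) (V t c) (W t c) + ?b (h *\<^sub>R V') (W t c)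
        + ?b (V t c) (h *\<^sub>R W'))) (at t within J)"
    by (rule local_form_has_derivative[OF c])
      (use x V' W' tc w in \<open>auto simp: J_def times_in_def has_vector_derivative_def\<close>)
  then have "((\<lambda>s. g (\<gamma> s) (V s) (W s)) has_derivative
     (\<lambda>h. metric_deriv c (coords c (\<gamma> t)) (h *\<^sub>R vel c t) (V t c) (W t c) + ?b (h *\<^sub>R V') (W t c)
        + ?b (V t c) (h *\<^sub>R W'))) (at t within J)"
    by (rule has_derivative_transform[rotated 2])
      (use tc metric_in_chart[OF c(1)] VT in \<open>auto simp: J_def times_in_def\<close>)
  then have "((\<lambda>s. g (\<gamma> s) (V s) (W s)) has_derivative
     (*) (metric_deriv c (coords c (\<gamma> t)) (vel c t) (V t c) (W t c) + ?b V' (W t c) + ?b (V t c) W'))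
     (at t within I)"
    unfolding w linear_scale[OF metric_deriv_linear[OF c]] bilinear_lmul[OF local_form_bilinear[OF c]]
      bilinear_rmul[OF local_form_bilinear[OF c]]
    by (rule has_derivative_eq_rhs) (simp add: fun_eq_iff algebra_simps)
  moreover have "g (\<gamma> t) (cov_along A g I \<gamma> V t) (W t) = ?b V' (W t c) + ?b (?\<Gamma> (vel c t) (V t c)) (W t c)"
    unfolding metric_in_chart[OF c cov_along_in[OF t] VT(2)[OF t]]
    using cov_along_chart_at[OF t, of V, folded c_def, OF V'] bilinear_ladd[OF local_form_bilinear[OF c]] by simp
  moreover have "g (\<gamma> t) (V t) (cov_along A g I \<gamma> W t) = ?b (V t c) W' + ?b (V t c) (?\<Gamma> (vel c t) (W t c))"
    unfolding metric_in_chart[OF c VT(1)[OF t] cov_along_in[OF t]]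
    using cov_along_chart_at[OF t, of W, folded c_def, OF W'] bilinear_radd[OF local_form_bilinear[OF c]] by simp
  ultimately show ?thesis
    unfolding has_field_derivative_def metric_deriv_christoffel[OF c] by (simp add: add_ac)
qed

lemma metric_deriv_differentiable:
  assumes c: "c \<in> A" and z: "z \<in> S" "X ` S \<subseteq> coords c ` dom_of c"
    and d: "X differentiable (at z within S)" "u differentiable (at z within S)"
      "v differentiable (at z within S)" "w differentiable (at z within S)"
  shows "(\<lambda>y. metric_deriv c (X y) (u y) (v y) (w y)) differentiable (at (z::real) within S)"
proof -
  have eq: "metric_deriv c (X y) a v' w' = (\<Sum>k\<in>Basis. \<Sum>i\<in>Basis. \<Sum>j\<in>Basis.
      (a \<bullet> k) * ((v' \<bullet> i) * (w' \<bullet> j) * metric_deriv c (X y) k i j))"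
    if y: "y \<in> S" for y a v' w'
  proof -
    obtain p where p: "p \<in> dom_of c" "X y = coords c p" using z(2) y by auto
    show ?thesis
      unfolding p(2) linear_euclidean_expansion[OF metric_deriv_linear[OF c p(1)], of a v' w']
      by (rule sum.cong[OF refl], subst bilinear_expansion[OF metric_deriv_bilinear[OF c p(1)]])
        (simp add: sum_distrib_left)
  qed
  have "(\<lambda>y. metric_deriv c (X y) k i j) differentiable (at z within S)" for k i j
  proof -
    have "(\<lambda>x. metric_deriv c x k i j) differentiable (at (X z))"
      unfolding metric_deriv_def
      by (rule smooth_on_differentiable[OF smooth_on_derivative[OF local_form_smooth[OF c] open_image_dom[OF c]]
            open_image_dom[OF c]]) (use z in auto)
    then show ?thesis
      using differentiable_chain_within[OF d(1), of "\<lambda>x. metric_deriv c x k i j"]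
        differentiable_at_withinI by (auto simp: o_def)
  qed
  moreover have "(\<lambda>y. u y \<bullet> k) differentiable (at z within S)" "(\<lambda>y. v y \<bullet> k) differentiable (at z within S)"
    "(\<lambda>y. w y \<bullet> k) differentiable (at z within S)" for k
    using d bounded_linear_imp_differentiable[OF bounded_linear_inner_left]
      differentiable_chain_within[of _ z S "\<lambda>a. a \<bullet> k"] by (auto simp: o_def)
  ultimately have "(\<lambda>y. \<Sum>k\<in>Basis. \<Sum>i\<in>Basis. \<Sum>j\<in>Basis. (u y \<bullet> k) * ((v y \<bullet> i) * (w y \<bullet> j) * metric_deriv c (X y) k i j))
      differentiable (at z within S)"
    by (intro differentiable_sum differentiable_mult finite_Basis ballI) auto
  then show ?thesis
    by (rule differentiable_transform_within[of _ _ _ 1]) (use z eq in auto)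
qed

text \<open>In a fixed chart around \<open>\<gamma>(t)\<close> the Koszul expression for \<open>g(N, W)\<close> involves only smooth functions and
the components of \<open>W\<close>.\<close>

lemma N_product_differentiable:
  assumes t: "t \<in> I" and W: "\<And>s. s \<in> I \<Longrightarrow> W s \<in> tangent_space A (\<gamma> s)"
    and dW: "(\<lambda>s. W s (chart_at A (\<gamma> t))) differentiable (at t within I)"
  shows "(\<lambda>s. g (\<gamma> s) (N s) (W s)) differentiable (at t within I)"
proof -
  define c where "c = chart_at A (\<gamma> t)"
  note c = chart_at[OF curve_in_carrier[OF t], folded c_def]
  note tc = times_in_chart_at[OF t, folded c_def]
  define J where "J = times_in (dom_of c)"
  have w: "at t within J = at t within I" unfolding J_def using at_within_times_in[OF open_dom[OF c(1)] tc] .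
  have x: "(\<lambda>s. coords c (\<gamma> s)) differentiable (at t within J)"
    unfolding w using differentiableI_vector[OF smooth_along_chart(4)[OF c(1) tc]] .
  have v: "vel c differentiable (at t within J)"
    unfolding w using differentiableI_vector[OF smooth_along_chart(5)[OF c(1) tc]] .
  have a: "acc c differentiable (at t within J)"
    unfolding w using smooth_along_chart(6)[OF c(1) tc] .
  have Wd: "(\<lambda>s. W s c) differentiable (at t within J)" unfolding w using dW unfolding c_def .
  have img: "(\<lambda>s. coords c (\<gamma> s)) ` J \<subseteq> coords c ` dom_of c" "t \<in> J"
    using tc by (auto simp: J_def times_in_def)
  have "(\<lambda>s. local_form A g c (coords c (\<gamma> s)) (acc c s) (W s c)) differentiable (at t within J)"
    using local_form_has_derivative[OF c img(2) refl img(1) x[unfolded frechet_derivative_works]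
        a[unfolded frechet_derivative_works] Wd[unfolded frechet_derivative_works]]
    by (rule Derivative.differentiableI)
  moreover have "(\<lambda>s. koszul c (coords c (\<gamma> s)) (vel c s) (vel c s) (W s c)) differentiable (at t within J)"
    unfolding koszul_def divide_inverse
    by (intro differentiable_mult differentiable_add differentiable_diff differentiable_const
        metric_deriv_differentiable[OF c(1) img(2,1) x] v Wd)
  ultimately have "(\<lambda>s. local_form A g c (coords c (\<gamma> s)) (acc c s) (W s c) +
      koszul c (coords c (\<gamma> s)) (vel c s) (vel c s) (W s c)) differentiable (at t within J)"
    by (rule differentiable_add)
  then have "(\<lambda>s. g (\<gamma> s) (N s) (W s)) differentiable (at t within J)"
  proof (rule differentiable_transform_within[of _ _ _ 1])
    fix s assume "s \<in> J"
    then have s: "s \<in> I" "\<gamma> s \<in> dom_of c" "s \<in> times_in (dom_of c)" by (auto simp: J_def times_in_def)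
    have "N s \<in> tangent_space A (\<gamma> s)" unfolding cartan_N_def by (rule cov_along_in[OF s(1)])
    then show "local_form A g c (coords c (\<gamma> s)) (acc c s) (W s c) +
        koszul c (coords c (\<gamma> s)) (vel c s) (vel c s) (W s c) = g (\<gamma> s) (N s) (W s)"
      using metric_in_chart[OF c(1) s(2) _ W[OF s(1)]] cartan_N_any_chart[OF c(1) s(3)] by simp
  qed (use img in auto)
  then show ?thesis unfolding w .
qed

end

section \<open>Slant curves with null normal\<close>

locale slant_null_curve =
  normal_paracontact_manifold A g \<phi> \<xi> \<eta> + pseudo_riemannian_curve A g 2 1 I \<gamma>
  for A :: "('m::{t2_space, second_countable_topology}, 'e::euclidean_space) chart set"
    and g :: "'m \<Rightarrow> ('m, 'e) tvec \<Rightarrow> ('m, 'e) tvec \<Rightarrow> real"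
    and \<phi> :: "'m \<Rightarrow> ('m, 'e) tvec \<Rightarrow> ('m, 'e) tvec"
    and \<xi> :: "'m \<Rightarrow> ('m, 'e) tvec"
    and \<eta> :: "'m \<Rightarrow> ('m, 'e) tvec \<Rightarrow> real"
    and I :: "real set" and \<gamma> :: "real \<Rightarrow> 'm" +
  fixes c :: real
  assumes slant: "slant A \<eta> I \<gamma> c" and null: "null_normal A g I \<gamma>" and c_sq: "c\<^sup>2 \<noteq> 1"
begin

abbreviation \<alpha> :: "real \<Rightarrow> real" where "\<alpha> t \<equiv> assoc_alpha A \<xi> g (\<gamma> t)"
abbreviation \<beta> :: "real \<Rightarrow> real" where "\<beta> t \<equiv> assoc_beta A \<phi> \<xi> g (\<gamma> t)"
abbreviation cov :: "(real \<Rightarrow> ('m, 'e) tvec) \<Rightarrow> real \<Rightarrow> ('m, 'e) tvec" where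
  "cov V t \<equiv> cov_along A g I \<gamma> V t"

text \<open>For a field along the curve that is tangent to the manifold, the choice of chart is immaterial; this
one is the chart in which the covariant derivative at \<open>t\<close> is computed.\<close>

definition differentiable_along :: "(real \<Rightarrow> ('m, 'e) tvec) \<Rightarrow> real \<Rightarrow> bool" where
  "differentiable_along V t \<longleftrightarrow> (\<lambda>s. V s (chart_at A (\<gamma> t))) differentiable (at t within I)"

lemma along_add:
  "differentiable_along V t \<Longrightarrow> differentiable_along W t \<Longrightarrow> differentiable_along (\<lambda>s. V s + W s) t"
  unfolding differentiable_along_def by (simp add: differentiable_add)

lemma along_diff:
  "differentiable_along V t \<Longrightarrow> differentiable_along W t \<Longrightarrow> differentiable_along (\<lambda>s. V s - W s) t"
  unfolding differentiable_along_def by (simp add: differentiable_diff)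

lemma along_scaleR:
  "f differentiable (at t within I) \<Longrightarrow> differentiable_along V t \<Longrightarrow> differentiable_along (\<lambda>s. f s *\<^sub>R V s) t"
  unfolding differentiable_along_def scaleR_fun_def by (rule differentiable_scaleR)

lemma along_cong:
  assumes "t \<in> I" "\<And>s. s \<in> I \<Longrightarrow> V s = W s" "differentiable_along W t"
  shows "differentiable_along V t"
  using assms(3) unfolding differentiable_along_def
  by (rule differentiable_transform_within[of _ _ _ 1]) (use assms(1,2) in auto)

lemma velocity_along: "t \<in> I \<Longrightarrow> differentiable_along T t"
  unfolding differentiable_along_def
  by (rule differentiableI_vector[OF velocity_has_derivative[OF chart_at(1)[OF curve_in_carrier] times_in_chart_at]])

lemma xi_along_derivative:
  assumes t: "t \<in> I"
  defines "ch \<equiv> chart_at A (\<gamma> t)"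
  shows "((\<lambda>s. \<xi> (\<gamma> s) ch) has_vector_derivative
     frechet_derivative (\<lambda>x. \<xi> (coords_inv ch x) ch) (at (coords ch (\<gamma> t))) (vel ch t)) (at t within I)"
proof -
  note ch = chart_at[OF curve_in_carrier[OF t], folded ch_def]
  note tc = times_in_chart_at[OF t, folded ch_def]
  have w: "at t within times_in (dom_of ch) = at t within I" using at_within_times_in[OF open_dom[OF ch(1)] tc] .
  have "((\<lambda>x. \<xi> (coords_inv ch x) ch) has_derivative
      frechet_derivative (\<lambda>x. \<xi> (coords_inv ch x) ch) (at (coords ch (\<gamma> t)))) (at (coords ch (\<gamma> t)))"
    by (rule smooth_on_has_derivative[OF xi_smooth[OF ch(1)] open_image_dom[OF ch(1)]]) (use ch in auto)
  from vector_derivative_diff_chain_within[OF smooth_along_chart(4)[OF ch(1) tc] has_derivative_at_withinI[OF this]]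
  have "((\<lambda>s. \<xi> (coords_inv ch (coords ch (\<gamma> s))) ch) has_vector_derivative
     frechet_derivative (\<lambda>x. \<xi> (coords_inv ch x) ch) (at (coords ch (\<gamma> t))) (vel ch t)) (at t within times_in (dom_of ch))"
    unfolding w by (simp add: o_def)
  then show ?thesis
    unfolding w[symmetric]
    by (rule has_vector_derivative_transform[OF tc, rotated]) (use ch in \<open>simp add: times_in_def\<close>)
qed

lemma xi_along: "t \<in> I \<Longrightarrow> differentiable_along (\<lambda>s. \<xi> (\<gamma> s)) t"
  unfolding differentiable_along_def by (rule differentiableI_vector[OF xi_along_derivative])

lemma cov_xi:
  assumes t: "t \<in> I"
  shows "cov (\<lambda>s. \<xi> (\<gamma> s)) t = nabla A g (T t) \<xi> (\<gamma> t)"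
  unfolding cov_along_def nabla_def Let_def
    vector_derivative_within[OF interval_not_isolated[OF t] xi_along_derivative[OF t]]
    velocity_chart[OF chart_at(1)[OF curve_in_carrier[OF t]] times_in_chart_at[OF t]] ..

lemma phi_velocity_along:
  assumes t: "t \<in> I"
  shows "differentiable_along (\<lambda>s. \<phi> (\<gamma> s) (T s)) t"
proof -
  define ch where "ch = chart_at A (\<gamma> t)"
  note ch = chart_at[OF curve_in_carrier[OF t], folded ch_def]
  note tc = times_in_chart_at[OF t, folded ch_def]
  let ?J = "times_in (dom_of ch)"
  have w: "at t within ?J = at t within I" using at_within_times_in[OF open_dom[OF ch(1)] tc] .
  define F where "F = (\<lambda>x i. \<phi> (coords_inv ch x) (tangent_of A ch (coords_inv ch x) i) ch)"
  have "(\<lambda>s. F (coords ch (\<gamma> s)) i) differentiable (at t within ?J)" for i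
  proof -
    have "(\<lambda>x. F x i) differentiable (at (coords ch (\<gamma> t)))"
      unfolding F_def
      by (rule smooth_on_differentiable[OF phi_smooth[OF ch(1)] open_image_dom[OF ch(1)]]) (use ch in auto)
    moreover have "(\<lambda>s. coords ch (\<gamma> s)) differentiable (at t within ?J)"
      unfolding w using differentiableI_vector[OF smooth_along_chart(4)[OF ch(1) tc]] .
    ultimately show ?thesis
      using differentiable_chain_within[of "\<lambda>s. coords ch (\<gamma> s)" t ?J "\<lambda>x. F x i"]
        differentiable_at_withinI by (auto simp: o_def)
  qed
  moreover have "(\<lambda>s. vel ch s \<bullet> i) differentiable (at t within ?J)" for i
    unfolding w
    using bounded_linear.has_vector_derivative[OF bounded_linear_inner_left smooth_along_chart(5)[OF ch(1) tc]]
    by (rule differentiableI_vector)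
  ultimately have "(\<lambda>s. \<Sum>i\<in>Basis. (vel ch s \<bullet> i) *\<^sub>R F (coords ch (\<gamma> s)) i) differentiable (at t within ?J)"
    by (intro differentiable_sum differentiable_scaleR finite_Basis ballI) auto
  then have "(\<lambda>s. \<phi> (\<gamma> s) (T s) ch) differentiable (at t within ?J)"
  proof (rule differentiable_transform_within[of _ _ _ 1])
    fix s assume "s \<in> ?J"
    then have s: "\<gamma> s \<in> dom_of ch" "s \<in> I" "s \<in> ?J" by (auto simp: times_in_def)
    interpret P: paracontact_vector_space "tangent_space A (\<gamma> s)" "\<phi> (\<gamma> s)" "\<xi> (\<gamma> s)" "\<eta> (\<gamma> s)" "g (\<gamma> s)"
      by (rule tangent_paracontact[OF curve_in_carrier[OF s(2)]])
    have sc: "(a *\<^sub>R u) ch = a *\<^sub>R u ch" for a and u :: "('m, 'e) tvec" by (simp add: scaleR_fun_def)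
    have lin: "linear (\<lambda>u. \<phi> (\<gamma> s) (tangent_of A ch (\<gamma> s) u) ch)"
      by (rule linearI) (simp_all add: tangent_of_add[OF ch(1) s(1)] tangent_of_scaleR[OF ch(1) s(1)]
          tangent_of_in[OF ch(1) s(1)] sc)
    have "T s = tangent_of A ch (\<gamma> s) (vel ch s)"
      using tangent_of_comp[OF velocity_in[OF s(2)] ch(1) s(1)] velocity_chart[OF ch(1) s(3)] by simp
    then show "(\<Sum>i\<in>Basis. (vel ch s \<bullet> i) *\<^sub>R F (coords ch (\<gamma> s)) i) = \<phi> (\<gamma> s) (T s) ch"
      using linear_euclidean_expansion[OF lin, of "vel ch s"] s(1) ch(1) by (simp add: F_def)
  qed (use tc in auto)
  then show ?thesis unfolding differentiable_along_def ch_def[symmetric] w .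
qed

lemma N_in: "t \<in> I \<Longrightarrow> N t \<in> tangent_space A (\<gamma> t)"
  unfolding cartan_N_def by (rule cov_along_in)

lemma xi_in: "t \<in> I \<Longrightarrow> \<xi> (\<gamma> t) \<in> tangent_space A (\<gamma> t)"
  using paracontact_vector_space.xi[OF tangent_paracontact[OF curve_in_carrier]] .

lemma phi_in: "t \<in> I \<Longrightarrow> v \<in> tangent_space A (\<gamma> t) \<Longrightarrow> \<phi> (\<gamma> t) v \<in> tangent_space A (\<gamma> t)"
  using paracontact_vector_space.V_closed(6)[OF tangent_paracontact[OF curve_in_carrier]] .

lemma product_rule:
  assumes t: "t \<in> I" and "\<And>s. s \<in> I \<Longrightarrow> V s \<in> tangent_space A (\<gamma> s)" "\<And>s. s \<in> I \<Longrightarrow> W s \<in> tangent_space A (\<gamma> s)"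
    and "differentiable_along V t" "differentiable_along W t"
    and f: "\<And>s. s \<in> I \<Longrightarrow> g (\<gamma> s) (V s) (W s) = f s" "(f has_vector_derivative f') (at t within I)"
  shows "g (\<gamma> t) (cov V t) (W t) + g (\<gamma> t) (V t) (cov W t) = f'"
proof -
  have "((\<lambda>s. g (\<gamma> s) (V s) (W s)) has_vector_derivative
      g (\<gamma> t) (cov V t) (W t) + g (\<gamma> t) (V t) (cov W t)) (at t within I)"
    using metric_product_rule[OF assms(1-3) assms(4,5)[unfolded differentiable_along_def]]
    unfolding has_real_derivative_iff_has_vector_derivative .
  moreover have "((\<lambda>s. g (\<gamma> s) (V s) (W s)) has_vector_derivative f') (at t within I)"
    by (rule has_vector_derivative_transform[OF t _ f(2)]) (rule f(1))
  ultimately show ?thesis by (rule vector_derivative_unique_within[OF interval_not_isolated[OF t]])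
qed

lemma product_rule_const:
  assumes "t \<in> I" "\<And>s. s \<in> I \<Longrightarrow> V s \<in> tangent_space A (\<gamma> s)" "\<And>s. s \<in> I \<Longrightarrow> W s \<in> tangent_space A (\<gamma> s)"
    and "differentiable_along V t" "differentiable_along W t"
    and "\<And>s. s \<in> I \<Longrightarrow> g (\<gamma> s) (V s) (W s) = k"
  shows "g (\<gamma> t) (cov V t) (W t) + g (\<gamma> t) (V t) (cov W t) = 0"
  by (rule product_rule[OF assms]) simp_all

lemma cov_T: "cov T t = N t"
  unfolding cartan_N_def ..

lemma eta_T: "t \<in> I \<Longrightarrow> \<eta> (\<gamma> t) (T t) = c"
  using slant unfolding slant_def by blast

text \<open>The derivative of the constant \<open>g(T, T)\<close>.\<close>

lemma N_orthogonal:
  assumes t: "t \<in> I"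
  shows "g (\<gamma> t) (N t) (T t) = 0"
proof -
  obtain \<epsilon> where "\<And>s. s \<in> I \<Longrightarrow> g (\<gamma> s) (T s) (T s) = \<epsilon>" using null unfolding null_normal_def by blast
  from product_rule_const[OF t velocity_in velocity_in velocity_along[OF t] velocity_along[OF t] this]
  show ?thesis
    unfolding cov_T using metric_sym[OF curve_in_carrier[OF t] velocity_in[OF t] N_in[OF t]] by simp
qed

text \<open>The value of \<open>\<eta>(N) = g(N, \<xi>)\<close> comes from differentiating \<open>g(T, \<xi>) = c\<close> with \<open>\<nabla>\<^bsub>T\<^esub>\<xi>\<close> known; the rest is
the normal form of null vectors.\<close>

lemma
  assumes t: "t \<in> I"
  shows T_unit: "g (\<gamma> t) (T t) (T t) = 1"
    and eta_N: "\<eta> (\<gamma> t) (N t) = - \<alpha> t * (1 - c\<^sup>2)"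
    and alpha_nonzero: "\<alpha> t \<noteq> 0"
    and N_form: "\<exists>\<sigma>\<in>{1, -1}. N t = - \<alpha> t *\<^sub>R (\<xi> (\<gamma> t) - c *\<^sub>R T t + \<sigma> *\<^sub>R \<phi> (\<gamma> t) (T t))"
proof -
  interpret P: paracontact_vector_space "tangent_space A (\<gamma> t)" "\<phi> (\<gamma> t)" "\<xi> (\<gamma> t)" "\<eta> (\<gamma> t)" "g (\<gamma> t)"
    by (rule tangent_paracontact[OF curve_in_carrier[OF t]])
  have eps: "g (\<gamma> t) (T t) (T t) = 1 \<or> g (\<gamma> t) (T t) (T t) = - 1"
    and NN: "g (\<gamma> t) (N t) (N t) = 0" "N t \<noteq> 0"
    using null t unfolding null_normal_def by blast+
  note nf = P.null_vector_normal_form[OF velocity_in[OF t] N_in[OF t] eps eta_T[OF t] c_sq N_orthogonal[OF t] NN]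
  show TT: "g (\<gamma> t) (T t) (T t) = 1" using nf(1) .
  have xi_T: "g (\<gamma> s) (T s) (\<xi> (\<gamma> s)) = c" if "s \<in> I" for s
    using paracontact_vector_space.b_xi[OF tangent_paracontact[OF curve_in_carrier[OF that]] velocity_in[OF that]]
      eta_T[OF that] by simp
  have "g (\<gamma> t) (N t) (\<xi> (\<gamma> t)) + g (\<gamma> t) (T t) (nabla A g (T t) \<xi> (\<gamma> t)) = 0"
    using product_rule_const[OF t velocity_in xi_in velocity_along[OF t] xi_along[OF t] xi_T]
    unfolding cov_T cov_xi[OF t] .
  then show eta_N: "\<eta> (\<gamma> t) (N t) = - \<alpha> t * (1 - c\<^sup>2)"
    unfolding nabla_xi[OF curve_in_carrier[OF t] velocity_in[OF t]]
    using velocity_in[OF t] N_in[OF t] TT xi_T[OF t] P.b_phi_self(1)[OF velocity_in[OF t]]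
    by (simp add: P.b_xi eta_T[OF t] power2_eq_square algebra_simps)
  show "\<alpha> t \<noteq> 0" using nf(2) eta_N by auto
  have "\<eta> (\<gamma> t) (N t) / (1 - c\<^sup>2) = - \<alpha> t" unfolding eta_N using c_sq by simp
  then show "\<exists>\<sigma>\<in>{1, -1}. N t = - \<alpha> t *\<^sub>R (\<xi> (\<gamma> t) - c *\<^sub>R T t + \<sigma> *\<^sub>R \<phi> (\<gamma> t) (T t))"
    using nf(3) by simp
qed

lemma alpha_differentiable:
  assumes t: "t \<in> I"
  shows "\<alpha> differentiable (at t within I)"
proof -
  have "(\<lambda>s. - g (\<gamma> s) (N s) (\<xi> (\<gamma> s)) / (1 - c\<^sup>2)) differentiable (at t within I)"
    unfolding divide_inverse
    using N_product_differentiable[OF t xi_in] xi_along[OF t]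
    by (intro differentiable_mult differentiable_const differentiable_minus) (simp_all add: differentiable_along_def)
  then show ?thesis
  proof (rule differentiable_transform_within[of _ _ _ 1])
    fix s assume s: "s \<in> I"
    show "- g (\<gamma> s) (N s) (\<xi> (\<gamma> s)) / (1 - c\<^sup>2) = \<alpha> s"
      using paracontact_vector_space.b_xi[OF tangent_paracontact[OF curve_in_carrier[OF s]] N_in[OF s]]
        eta_N[OF s] c_sq by simp
  qed (use t in auto)
qed

text \<open>At each point the sign is recovered as \<open>g(N, \<phi> T) / (\<alpha> (1 - c\<^sup>2))\<close>, a continuous function on the interval
\<open>I\<close> with values in \<open>{1, -1}\<close>.\<close>

lemma constant_sign:
  "\<exists>\<sigma>\<in>{1, -1}. \<forall>t\<in>I. N t = - \<alpha> t *\<^sub>R (\<xi> (\<gamma> t) - c *\<^sub>R T t + \<sigma> *\<^sub>R \<phi> (\<gamma> t) (T t))"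
proof -
  define f where "f = (\<lambda>t. g (\<gamma> t) (N t) (\<phi> (\<gamma> t) (T t)) / (\<alpha> t * (1 - c\<^sup>2)))"
  have ne: "1 - c\<^sup>2 \<noteq> 0" using c_sq by simp
  have f: "f t = \<sigma>" if t: "t \<in> I" and s: "\<sigma> \<in> {1, -1}"
    and N: "N t = - \<alpha> t *\<^sub>R (\<xi> (\<gamma> t) - c *\<^sub>R T t + \<sigma> *\<^sub>R \<phi> (\<gamma> t) (T t))" for t \<sigma>
  proof -
    interpret P: paracontact_vector_space "tangent_space A (\<gamma> t)" "\<phi> (\<gamma> t)" "\<xi> (\<gamma> t)" "\<eta> (\<gamma> t)" "g (\<gamma> t)"
      by (rule tangent_paracontact[OF curve_in_carrier[OF t]])
    show ?thesis
      using P.null_frame_products(1)[OF velocity_in[OF t] T_unit[OF t] eta_T[OF t] c_sq alpha_nonzero[OF t] s]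
        alpha_nonzero[OF t] ne unfolding f_def N[symmetric] by simp
  qed
  have cont: "continuous_on I f"
    unfolding continuous_on_eq_continuous_within
  proof
    fix t assume t: "t \<in> I"
    have "(\<lambda>t. g (\<gamma> t) (N t) (\<phi> (\<gamma> t) (T t))) differentiable (at t within I)"
      using N_product_differentiable[OF t phi_in[OF _ velocity_in]] phi_velocity_along[OF t]
      by (simp add: differentiable_along_def)
    then show "continuous (at t within I) f"
      unfolding f_def using alpha_differentiable[OF t] alpha_nonzero[OF t] ne
      by (intro continuous_divide continuous_mult continuous_const differentiable_imp_continuous_within) auto
  qed
  have range: "f ` I \<subseteq> {1, -1}"
  proof
    fix y assume "y \<in> f ` I"
    then obtain t where t: "t \<in> I" "y = f t" by auto
    obtain \<sigma> where \<sigma>: "\<sigma> \<in> {1, -1}" "N t = - \<alpha> t *\<^sub>R (\<xi> (\<gamma> t) - c *\<^sub>R T t + \<sigma> *\<^sub>R \<phi> (\<gamma> t) (T t))"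
      using N_form[OF t(1)] by blast
    show "y \<in> {1, -1}" unfolding t(2) f[OF t(1) \<sigma>] by (rule \<sigma>(1))
  qed
  have "connected I" using curve unfolding smooth_curve_def by (auto simp: is_interval_connected)
  then have "f constant_on I"
    by (rule continuous_finite_range_constant[OF _ cont finite_subset[OF range]]) simp
  then obtain k where k: "\<And>t. t \<in> I \<Longrightarrow> f t = k" unfolding constant_on_def by blast
  have form: "N t = - \<alpha> t *\<^sub>R (\<xi> (\<gamma> t) - c *\<^sub>R T t + k *\<^sub>R \<phi> (\<gamma> t) (T t))" if t: "t \<in> I" for t
  proof -
    obtain \<sigma> where \<sigma>: "\<sigma> \<in> {1, -1}" "N t = - \<alpha> t *\<^sub>R (\<xi> (\<gamma> t) - c *\<^sub>R T t + \<sigma> *\<^sub>R \<phi> (\<gamma> t) (T t))"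
      using N_form[OF t] by blast
    have "\<sigma> = k" using f[OF t \<sigma>] k[OF t] by simp
    then show ?thesis using \<sigma>(2) by simp
  qed
  have "I \<noteq> {}" using curve unfolding smooth_curve_def by auto
  then obtain t where "t \<in> I" by blast
  then have "k \<in> {1, -1}" using k range by blast
  then show ?thesis using form by blast
qed

text \<open>\<open>\<nabla>\<^bsub>T\<^esub>N\<close> and \<open>\<nabla>\<^bsub>T\<^esub>W\<close> are expanded in the frame; their coefficients are found by differentiating the
constant products of \<open>T\<close>, \<open>N\<close> and \<open>W\<close>.  The only coefficient not determined in this way, \<open>k\<close>, is read off
from the derivative of \<open>g(N, \<xi>) = - \<alpha> (1 - c\<^sup>2)\<close>.\<close>

lemma frame_and_curvature:
  assumes \<sigma>: "\<sigma> \<in> {1, -1}"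
    and N: "\<And>t. t \<in> I \<Longrightarrow> N t = - \<alpha> t *\<^sub>R (\<xi> (\<gamma> t) - c *\<^sub>R T t + \<sigma> *\<^sub>R \<phi> (\<gamma> t) (T t))"
    and t: "t \<in> I"
  shows "\<alpha> t = \<sigma> * (g (\<gamma> t) (N t) (\<phi> (\<gamma> t) (T t)) / (1 - c\<^sup>2))"
    and "cartan_W A g I \<gamma> t = (- 1 / (2 * \<alpha> t * (1 - c\<^sup>2))) *\<^sub>R (\<xi> (\<gamma> t) - c *\<^sub>R T t - \<sigma> *\<^sub>R \<phi> (\<gamma> t) (T t))"
    and "cartan_curvature A g I \<gamma> t = vector_derivative \<alpha> (at t within I) / \<alpha> t + \<sigma> * \<beta> t + \<alpha> t * c"
proof -
  have ne: "1 - c\<^sup>2 \<noteq> 0" using c_sq by simp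
  have ss: "\<sigma> * \<sigma> = 1" using \<sigma> by auto
  \<comment> \<open>the claimed value of \<open>W\<close>, whose differentiability is visible\<close>
  define w where "w = (\<lambda>s. (- 1 / (2 * \<alpha> s * (1 - c\<^sup>2))) *\<^sub>R (\<xi> (\<gamma> s) - c *\<^sub>R T s - \<sigma> *\<^sub>R \<phi> (\<gamma> s) (T s)))"
  note point = tangent_paracontact[OF curve_in_carrier]
  have phiT_in: "\<phi> (\<gamma> s) (T s) \<in> tangent_space A (\<gamma> s)" if "s \<in> I" for s
    using phi_in[OF that velocity_in[OF that]] .
  have frame: "g (\<gamma> s) (N s) (\<phi> (\<gamma> s) (T s)) = \<sigma> * \<alpha> s * (1 - c\<^sup>2)"
      "g (\<gamma> s) (N s) (w s) = 1" "g (\<gamma> s) (w s) (w s) = 0" "g (\<gamma> s) (T s) (w s) = 0"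
      "(THE v. v \<in> tangent_space A (\<gamma> s) \<and> g (\<gamma> s) (N s) v = 1 \<and> g (\<gamma> s) v v = 0 \<and> g (\<gamma> s) (T s) v = 0) = w s"
      "X \<in> tangent_space A (\<gamma> s) \<Longrightarrow>
         X = g (\<gamma> s) X (T s) *\<^sub>R T s + g (\<gamma> s) X (w s) *\<^sub>R N s + g (\<gamma> s) X (N s) *\<^sub>R w s" if s: "s \<in> I" for s X
  proof -
    interpret P: paracontact_vector_space "tangent_space A (\<gamma> s)" "\<phi> (\<gamma> s)" "\<xi> (\<gamma> s)" "\<eta> (\<gamma> s)" "g (\<gamma> s)"
      by (rule point[OF s])
    note * = P.null_frame[OF velocity_in[OF s] T_unit[OF s] eta_T[OF s] c_sq alpha_nonzero[OF s] \<sigma>,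
        folded N[OF s], folded w_def]
    show "g (\<gamma> s) (N s) (\<phi> (\<gamma> s) (T s)) = \<sigma> * \<alpha> s * (1 - c\<^sup>2)"
      "g (\<gamma> s) (N s) (w s) = 1" "g (\<gamma> s) (w s) (w s) = 0" "g (\<gamma> s) (T s) (w s) = 0"
      "(THE v. v \<in> tangent_space A (\<gamma> s) \<and> g (\<gamma> s) (N s) v = 1 \<and> g (\<gamma> s) v v = 0 \<and> g (\<gamma> s) (T s) v = 0) = w s"
      using *(1-5) unfolding w_def by auto
    show "X = g (\<gamma> s) X (T s) *\<^sub>R T s + g (\<gamma> s) X (w s) *\<^sub>R N s + g (\<gamma> s) X (N s) *\<^sub>R w s"
      if "X \<in> tangent_space A (\<gamma> s)"
      using *(6)[OF that] unfolding w_def .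
  qed
  have W: "cartan_W A g I \<gamma> s = w s" if "s \<in> I" for s
    unfolding cartan_W_def frame(5)[OF that] ..
  show "cartan_W A g I \<gamma> t = (- 1 / (2 * \<alpha> t * (1 - c\<^sup>2))) *\<^sub>R (\<xi> (\<gamma> t) - c *\<^sub>R T t - \<sigma> *\<^sub>R \<phi> (\<gamma> t) (T t))"
    using W[OF t] unfolding w_def .
  show "\<alpha> t = \<sigma> * (g (\<gamma> t) (N t) (\<phi> (\<gamma> t) (T t)) / (1 - c\<^sup>2))"
    unfolding frame(1)[OF t] using ne ss by (simp add: mult.assoc[symmetric])
  have w_in: "w s \<in> tangent_space A (\<gamma> s)" if s: "s \<in> I" for s
  proof -
    interpret P: paracontact_vector_space "tangent_space A (\<gamma> s)" "\<phi> (\<gamma> s)" "\<xi> (\<gamma> s)" "\<eta> (\<gamma> s)" "g (\<gamma> s)"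
      by (rule point[OF s])
    show ?thesis unfolding w_def using velocity_in[OF s] by simp
  qed
  have const: "(\<lambda>_. k) differentiable (at t within I)" for k :: real by simp
  have form_along: "differentiable_along (\<lambda>s. - \<alpha> s *\<^sub>R (\<xi> (\<gamma> s) - c *\<^sub>R T s + \<sigma> *\<^sub>R \<phi> (\<gamma> s) (T s))) t"
    by (intro along_scaleR along_add along_diff xi_along velocity_along phi_velocity_along t const
        differentiable_minus alpha_differentiable)
  have N_along: "differentiable_along N t"
    by (rule along_cong[OF t N form_along])
  have w_along: "differentiable_along w t"
    unfolding w_def
    by (intro along_scaleR along_diff xi_along velocity_along phi_velocity_along t const
        differentiable_divide differentiable_mult alpha_differentiable)
      (use alpha_nonzero[OF t] ne in auto)
  have W_along: "differentiable_along (cartan_W A g I \<gamma>) t"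
    by (rule along_cong[OF t W w_along])
  have W_in: "cartan_W A g I \<gamma> s \<in> tangent_space A (\<gamma> s)" if "s \<in> I" for s
    unfolding W[OF that] using w_in[OF that] .
  interpret P: paracontact_vector_space "tangent_space A (\<gamma> t)" "\<phi> (\<gamma> t)" "\<xi> (\<gamma> t)" "\<eta> (\<gamma> t)" "g (\<gamma> t)"
    by (rule point[OF t])
  note [simp] = velocity_in[OF t] N_in[OF t] w_in[OF t] cov_along_in[OF t]
  let ?g = "g (\<gamma> t)" and ?W = "cartan_W A g I \<gamma>"
  have NN: "g (\<gamma> s) (N s) (N s) = 0" if "s \<in> I" for s
    using null that unfolding null_normal_def by blast
  have N0: "N t \<noteq> 0" using null t unfolding null_normal_def by blast
  define k where "k = ?g (cov N t) (w t)"
  have "?g (cov N t) (N t) + ?g (N t) (cov N t) = 0"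
    by (rule product_rule_const[OF t N_in N_in N_along N_along NN])
  then have 1: "?g (cov N t) (N t) = 0" using P.b_sym[of "N t" "cov N t"] by simp
  have "?g (cov N t) (T t) + ?g (N t) (N t) = 0"
    using product_rule_const[OF t N_in velocity_in N_along velocity_along[OF t] N_orthogonal] unfolding cov_T .
  then have 2: "?g (cov N t) (T t) = 0" using NN[OF t] by simp
  have covN: "cov N t = k *\<^sub>R N t"
    using frame(6)[OF t, of "cov N t"] unfolding 1 2 k_def[symmetric] by simp
  have "?g (cov N t) (\<xi> (\<gamma> t)) + ?g (N t) (cov (\<lambda>s. \<xi> (\<gamma> s)) t)
      = - vector_derivative \<alpha> (at t within I) * (1 - c\<^sup>2)"
  proof (rule product_rule[OF t N_in xi_in N_along xi_along[OF t], where f = "\<lambda>s. - \<alpha> s * (1 - c\<^sup>2)"])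
    show "g (\<gamma> s) (N s) (\<xi> (\<gamma> s)) = - \<alpha> s * (1 - c\<^sup>2)" if "s \<in> I" for s
      using paracontact_vector_space.b_xi[OF point[OF that] N_in[OF that]] eta_N[OF that] by simp
    show "((\<lambda>s. - \<alpha> s * (1 - c\<^sup>2)) has_vector_derivative
        - vector_derivative \<alpha> (at t within I) * (1 - c\<^sup>2)) (at t within I)"
      using alpha_differentiable[OF t] unfolding vector_derivative_works
      by (intro has_vector_derivative_mult_left has_vector_derivative_minus)
  qed
  then have "- k * \<alpha> t * (1 - c\<^sup>2) + (\<alpha> t * c * \<alpha> t + \<sigma> * \<beta> t * \<alpha> t) * (1 - c\<^sup>2)
      = - vector_derivative \<alpha> (at t within I) * (1 - c\<^sup>2)"
    unfolding covN cov_xi[OF t] nabla_xi[OF curve_in_carrier[OF t] velocity_in[OF t]]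
    by (simp add: P.b_xi eta_N[OF t] eta_T[OF t] N_orthogonal[OF t] frame(1)[OF t] algebra_simps)
  then have "(- k * \<alpha> t + (\<alpha> t * c * \<alpha> t + \<sigma> * \<beta> t * \<alpha> t)) * (1 - c\<^sup>2)
      = - vector_derivative \<alpha> (at t within I) * (1 - c\<^sup>2)" by (simp add: distrib_right left_diff_distrib)
  then have "- k * \<alpha> t + (\<alpha> t * c * \<alpha> t + \<sigma> * \<beta> t * \<alpha> t) = - vector_derivative \<alpha> (at t within I)"
    by (rule mult_right_cancel[OF ne, THEN iffD1])
  then have k: "k = vector_derivative \<alpha> (at t within I) / \<alpha> t + \<sigma> * \<beta> t + \<alpha> t * c"
    using alpha_nonzero[OF t] by (simp add: field_simps)
  have "?g (cov ?W t) (T t) + ?g (?W t) (N t) = 0"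
    using product_rule_const[OF t W_in velocity_in W_along velocity_along[OF t], of 0] frame(4)
      metric_sym[OF curve_in_carrier W_in velocity_in] W unfolding cov_T by simp
  then have 3: "?g (cov ?W t) (T t) = - 1"
    using frame(2)[OF t] P.b_sym[of "w t" "N t"] by (simp add: W[OF t])
  have "?g (cov ?W t) (?W t) + ?g (?W t) (cov ?W t) = 0"
    by (rule product_rule_const[OF t W_in W_in W_along W_along, of 0]) (simp_all add: W frame(3))
  then have 4: "?g (cov ?W t) (w t) = 0" using P.b_sym[of "w t" "cov ?W t"] by (simp add: W[OF t])
  have "?g (cov ?W t) (N t) + ?g (?W t) (cov N t) = 0"
    using product_rule_const[OF t W_in N_in W_along N_along, of 1] frame(2)
      metric_sym[OF curve_in_carrier W_in N_in] W by simp
  then have 5: "?g (cov ?W t) (N t) = - k"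
    using frame(2)[OF t] P.b_sym[of "w t" "N t"] unfolding covN by (simp add: W[OF t])
  have covW: "cov ?W t = - T t - k *\<^sub>R ?W t"
    using frame(6)[OF t, of "cov ?W t"] unfolding 3 4 5 W[OF t] by simp
  have "cartan_curvature A g I \<gamma> t = k"
    unfolding cartan_curvature_def
  proof (rule the_equality)
    show "cov N t = k *\<^sub>R N t \<and> cov ?W t = - T t - k *\<^sub>R ?W t" using covN covW by blast
    fix k' assume "cov N t = k' *\<^sub>R N t \<and> cov ?W t = - T t - k' *\<^sub>R ?W t"
    then show "k' = k" using covN N0 by simp
  qed
  then show "cartan_curvature A g I \<gamma> t = vector_derivative \<alpha> (at t within I) / \<alpha> t + \<sigma> * \<beta> t + \<alpha> t * c"
    using k by simp
qed

end

theorem theorem4p1: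
  fixes A :: "('m::{t2_space, second_countable_topology}, real ^ 3) chart set"
    and \<phi> :: "'m \<Rightarrow> ('m, real ^ 3) tvec \<Rightarrow> ('m, real ^ 3) tvec"
    and \<xi> :: "'m \<Rightarrow> ('m, real ^ 3) tvec"
    and \<eta> :: "'m \<Rightarrow> ('m, real ^ 3) tvec \<Rightarrow> real"
    and g :: "'m \<Rightarrow> ('m, real ^ 3) tvec \<Rightarrow> ('m, real ^ 3) tvec \<Rightarrow> real"
    and I :: "real set" and \<gamma> :: "real \<Rightarrow> 'm" and c :: real
    and \<alpha> \<beta> \<kappa> :: "real \<Rightarrow> real"
    and T N W :: "real \<Rightarrow> ('m, real ^ 3) tvec"
  assumes "smooth_atlas A"
    and "almost_paracontact_metric 1 A \<phi> \<xi> \<eta> g"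
    and "normal_structure A \<phi> \<xi> \<eta>"
    and "smooth_curve A I \<gamma>"
    and "slant A \<eta> I \<gamma> c"
    and "null_normal A g I \<gamma>"
    and "c\<^sup>2 \<noteq> 1"
  defines "\<alpha> \<equiv> \<lambda>t. assoc_alpha A \<xi> g (\<gamma> t)"
    and "\<beta> \<equiv> \<lambda>t. assoc_beta A \<phi> \<xi> g (\<gamma> t)"
    and "T \<equiv> velocity A I \<gamma>"
    and "N \<equiv> cartan_N A g I \<gamma>"
    and "W \<equiv> cartan_W A g I \<gamma>"
    and "\<kappa> \<equiv> cartan_curvature A g I \<gamma>"
  shows "\<exists>\<sigma>\<in>{1, -1 :: real}. \<forall>t\<in>I.
     \<alpha> t = \<sigma> * (g (\<gamma> t) (N t) (\<phi> (\<gamma> t) (T t)) / (1 - c\<^sup>2)) \<and> \<alpha> t \<noteq> 0 \<and>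
     N t = - \<alpha> t *\<^sub>R (\<xi> (\<gamma> t) - c *\<^sub>R T t + \<sigma> *\<^sub>R \<phi> (\<gamma> t) (T t)) \<and>
     \<kappa> t = vector_derivative \<alpha> (at t within I) / \<alpha> t + \<sigma> * \<beta> t + \<alpha> t * c \<and>
     W t = (- 1 / (2 * \<alpha> t * (1 - c\<^sup>2))) *\<^sub>R
             (\<xi> (\<gamma> t) - c *\<^sub>R T t - \<sigma> *\<^sub>R \<phi> (\<gamma> t) (T t))"
proof -
  have "pseudo_riemannian_metric A g 2 1"
    using assms(2) unfolding almost_paracontact_metric_def by (simp add: numeral_2_eq_2)
  then interpret slant_null_curve A g \<phi> \<xi> \<eta> I \<gamma> c
    using assms(1-7) by unfold_locales
  obtain \<sigma> where \<sigma>: "\<sigma> \<in> {1, -1}" and N: "\<And>t. t \<in> I \<Longrightarrow> cartan_N A g I \<gamma> t =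
      - assoc_alpha A \<xi> g (\<gamma> t) *\<^sub>R (\<xi> (\<gamma> t) - c *\<^sub>R velocity A I \<gamma> t + \<sigma> *\<^sub>R \<phi> (\<gamma> t) (velocity A I \<gamma> t))"
    using constant_sign by blast
  show ?thesis
    unfolding \<alpha>_def \<beta>_def T_def N_def W_def \<kappa>_def
    using \<sigma> N alpha_nonzero frame_and_curvature[OF \<sigma> N] by (intro bexI[of _ \<sigma>] ballI conjI) auto
qed

end
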